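(* Let $N\ge1$ be an integer, $\tau>0$, $\mu>0$, and let $\varphi$ be $\mu$-strongly-convex-strongly-concave, $M$-Lipschitz with respect to $\|\cdot\|_2$, and differentiable with $L$-Lipschitz gradient with respect to $\|\cdot\|_2$ on the neighbourhood $U$ of $\mathcal Z$ described in the context. Let $z_0\in\mathcal Z$ and let $z_{k+1}=\Pi_{\mathcal Z}\big(z_k-\gamma_k\, g(z_k,\mathbf e_k,\tau,\xi_k^{\pm})\big)$ with $\gamma_k=\frac1{\mu(k+1)}$, $k=0,\dots,N$, and let $\bar z_N=(\bar x_N,\bar y_N)=\frac1{N+1}\sum_{k=0}^N z_k$. Let $(x^*,y^* )$ be the saddle point of $\varphi$ on $\mathcal X\times\mathcal Y$. Then $$\mathbb E\left[\varphi(\bar x_N,y^* )-\varphi(x^*,\bar y_N)\right]\le\frac{M_{all}^2\log(N+1)}{2\mu(N+1)}+\frac{\Delta n\Omega}{\tau}+L\tau^2,$$ where $M_{all}^2=3\left(3nM^2+\frac{n^2(\sigma^2+\Delta^2)}{\tau^2}\right)$.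
   Context: Problem: $\min_{x\in\mathcal X}\max_{y\in\mathcal Y}\varphi(x,y)$, where $\mathcal X\subset\mathbb R^{n_x}$, $\mathcal Y\subset\mathbb R^{n_y}$ are nonempty compact convex sets, $\mathcal Z=\mathcal X\times\mathcal Y$, $n=n_x+n_y$, $z=(x,y)$, $\varphi(z)=\varphi(x,y)$. $\Omega$ is the Euclidean diameter of $\mathcal Z$, and $\Pi_{\mathcal Z}$ is the Euclidean projection onto $\mathcal Z$ (this is the prox-operator step of Mirror Descent with the Bregman divergence $V_z(w)=\frac12\|z-w\|_2^2$). The function $\varphi$ is defined on $U=U_X\times U_Y$, with $U_X\subset\mathbb R^{n_x}$, $U_Y\subset\mathbb R^{n_y}$ open convex, such that $U$ contains all points $z+\tau e$ with $z\in\mathcal Z$, $\|e\|_2\le1$. A function $f$ is $\mu$-strongly convex on a set if it is continuously differentiable and $f(y)\ge f(x)+\langle\nabla f(x),y-x\rangle+\frac\mu2\|y-x\|_2^2$ for all $x,y$ in the set; $f$ is $\mu$-strongly concave if $-f$ is $\mu$-strongly convex. $\varphi$ is $\mu$-strongly-convex-strongly-concave if $\varphi(\cdot,y)$ is $\mu$-strongly convex for all $y$ and $\varphi(x,\cdot)$ is $\mu$-strongly concave for all $x$. $M$-Lipschitz ($M>0$): $|\varphi(z)-\varphi(z')|\le M\|z-z'\|_2$ for all $z,z'\in U$. $L$-Lipschitz gradient ($L>0$): $\|\nabla\varphi(z)-\nabla\varphi(z')\|_2\le L\|z-z'\|_2$ for all $z,z'\in U$. A saddle point satisfies $\varphi(x^*,y)\le\varphi(x^*,y^*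 )\le\varphi(x,y^* )$ for all $x\in\mathcal X,y\in\mathcal Y$. Oracle: only noisy values $\tilde\varphi(z,\xi)=\varphi(z)+\xi+\delta(z)$ are available, where $\delta$ is a deterministic measurable function on $U$ with $|\delta|\le\Delta$, and $\xi$ is a real random variable with $\mathbb E\xi=0$, $\mathbb E[\xi^2]\le\sigma^2$ ($\Delta,\sigma>0$), generated independently of the query point. Gradient estimator: for $\mathbf e=(\mathbf e_x,\mathbf e_y)$ uniformly distributed on the Euclidean unit sphere of $\mathbb R^n$, $$g(z,\mathbf e,\tau,\xi^{\pm})=\frac{n\left(\tilde\varphi(z+\tau\mathbf e,\xi^+)-\tilde\varphi(z-\tau\mathbf e,\xi^-)\right)}{2\tau}\begin{pmatrix}\mathbf e_x\\-\mathbf e_y\end{pmatrix}.$$ At each iteration $k$, $\mathbf e_k$ and the noises $\xi_k^+,\xi_k^-$ are generated independently of each other and of the previous iterations. *)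

theory Defs
  imports "HOL-Probability.Probability"
begin

definition strongly_convex_on :: "real \<Rightarrow> 'a::real_inner set \<Rightarrow> ('a \<Rightarrow> real) \<Rightarrow> bool" where
  "strongly_convex_on \<mu> S f \<longleftrightarrow>
     (\<exists>f'. (\<forall>x\<in>S. GDERIV f x :> f' x) \<and> continuous_on S f' \<and>
           (\<forall>x\<in>S. \<forall>y\<in>S. f y \<ge> f x + f' x \<bullet> (y - x) + \<mu> / 2 * (norm (y - x))\<^sup>2))"

definition strongly_concave_on :: "real \<Rightarrow> 'a::real_inner set \<Rightarrow> ('a \<Rightarrow> real) \<Rightarrow> bool" where
  "strongly_concave_on \<mu> S f \<longleftrightarrow> strongly_convex_on \<mu> S (\<lambda>x. - f x)"

definition strongly_convex_concave_on ::
    "real \<Rightarrow> 'a::real_inner set \<Rightarrow> 'b::real_inner set \<Rightarrow> ('a \<times> 'b \<Rightarrow> real) \<Rightarrow> bool" where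
  "strongly_convex_concave_on \<mu> A B \<phi> \<longleftrightarrow>
     (\<forall>y\<in>B. strongly_convex_on \<mu> A (\<lambda>x. \<phi> (x, y))) \<and>
     (\<forall>x\<in>A. strongly_concave_on \<mu> B (\<lambda>y. \<phi> (x, y)))"

definition lipschitz_gradient_on :: "real \<Rightarrow> 'a::real_inner set \<Rightarrow> ('a \<Rightarrow> real) \<Rightarrow> bool" where
  "lipschitz_gradient_on L S f \<longleftrightarrow>
     (\<exists>f'. (\<forall>z\<in>S. GDERIV f z :> f' z) \<and> L-lipschitz_on S f')"

definition saddle_point :: "'a set \<Rightarrow> 'b set \<Rightarrow> ('a \<times> 'b \<Rightarrow> real) \<Rightarrow> 'a \<Rightarrow> 'b \<Rightarrow> bool" where
  "saddle_point X Y \<phi> xs ys \<longleftrightarrow> xs \<in> X \<and> ys \<in> Y \<and>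
     (\<forall>x\<in>X. \<forall>y\<in>Y. \<phi> (xs, y) \<le> \<phi> (xs, ys) \<and> \<phi> (xs, ys) \<le> \<phi> (x, ys))"

(* The normalised surface measure of the Euclidean unit sphere, realised as the law of x / |x| for
   x uniform on the unit ball: a Borel set A of the sphere gets the proportion of the volume of the
   ball that is taken by the cone {r a | 0 < r < 1, a in A}.  It is a measure on the whole space
   concentrated on the sphere; the value sgn 0 = 0 is taken with probability 0. *)
definition uniform_sphere :: "'a::euclidean_space measure" where
  "uniform_sphere = distr (uniform_measure lborel (ball 0 1)) borel sgn"

definition noisy_value :: "('a \<Rightarrow> real) \<Rightarrow> ('a \<Rightarrow> real) \<Rightarrow> 'a \<Rightarrow> real \<Rightarrow> real" where
  "noisy_value \<phi> \<delta> z \<xi> = \<phi> z + \<xi> + \<delta> z"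

definition gradient_estimator ::
    "((real^'nx) \<times> (real^'ny) \<Rightarrow> real) \<Rightarrow> ((real^'nx) \<times> (real^'ny) \<Rightarrow> real) \<Rightarrow>
     (real^'nx) \<times> (real^'ny) \<Rightarrow> (real^'nx) \<times> (real^'ny) \<Rightarrow> real \<Rightarrow> real \<Rightarrow> real \<Rightarrow>
     (real^'nx) \<times> (real^'ny)" where
  "gradient_estimator \<phi> \<delta> z e \<tau> \<xi>p \<xi>m =
     (real (CARD('nx) + CARD('ny)) *
        (noisy_value \<phi> \<delta> (z + \<tau> *\<^sub>R e) \<xi>p - noisy_value \<phi> \<delta> (z - \<tau> *\<^sub>R e) \<xi>m) / (2 * \<tau>))
     *\<^sub>R (fst e, - snd e)"

(* A centred real random variable with second moment at most \<sigma>^2.  Square integrability is stated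
   separately because the Bochner integral of a non-integrable function is 0. *)
definition oracle_noise :: "'w measure \<Rightarrow> real \<Rightarrow> ('w \<Rightarrow> real) \<Rightarrow> bool" where
  "oracle_noise P \<sigma> \<xi> \<longleftrightarrow>
     \<xi> \<in> borel_measurable P \<and> integrable P \<xi> \<and> (\<integral>\<omega>. \<xi> \<omega> \<partial>P) = 0 \<and>
     integrable P (\<lambda>\<omega>. (\<xi> \<omega>)\<^sup>2) \<and> (\<integral>\<omega>. (\<xi> \<omega>)\<^sup>2 \<partial>P) \<le> \<sigma>\<^sup>2"

(* Independence of two random variables.  The library's indep_var requires both variables to have the
   same codomain type, so its unfolding is stated here for two different ones. *)
definition indep_rv ::
    "'w measure \<Rightarrow> ('w \<Rightarrow> 'a::topological_space) \<Rightarrow> ('w \<Rightarrow> 'b::topological_space) \<Rightarrow> bool" where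
  "indep_rv P A B \<longleftrightarrow>
     A \<in> borel_measurable P \<and> B \<in> borel_measurable P \<and>
     prob_space.indep_set P {A -` S \<inter> space P | S. S \<in> sets borel}
                            {B -` S \<inter> space P | S. S \<in> sets borel}"

end

theory Submission
  imports Defs
begin

text \<open>One step of the iteration gives the usual descent inequality for \<open>norm (z k - zs)\<close>, once two moments of the
  estimator are known. The first moment comes from the divergence theorem: \<open>n\<close> times the average of
  \<open>\<psi> e *\<^sub>R e\<close> over the sphere is the average of the gradient of \<open>\<psi>\<close> over the ball, so that, up to the noise
  \<open>\<Delta>\<close>, the estimator averages the gradients at \<open>z + \<tau> x\<close> and \<open>z - \<tau> x\<close>. Strong convexity-concavity is applied
  at these shifted points, and second differences of \<open>\<phi>\<close> cost only \<open>L \<tau>\<^sup>2\<close>. The second moment needs that an odd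
  Lipschitz function on the sphere has variance of order \<open>1 / n\<close>.

  Summing with \<open>\<gamma> k = 1 / (\<mu> (k + 1))\<close> would give the harmonic number of \<open>N + 1\<close>, which exceeds \<open>ln (N + 1)\<close>. The
  sum is therefore started at \<open>k = 1\<close>: strong convexity-concavity and the Lipschitz bound force
  \<open>norm (z - zs) \<le> M / \<mu>\<close> and gap at most \<open>M\<^sup>2 / (2 \<mu>)\<close> on all of \<open>X \<times> Y\<close>. The extra \<open>2 M\<^sup>2\<close> is absorbed because the
  estimator only needs \<open>15 / 2\<close> of the available \<open>9\<close> units of \<open>n M\<^sup>2\<close> and \<open>n \<ge> 2\<close>.\<close>

section \<open>Lebesgue measure in radial coordinates\<close>

text \<open>The constants just fit. \<open>pi\<^sup>2 < 10\<close> bounds the second moment of the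
  increment of \<open>\<phi>\<close> by \<open>20 * \<tau>\<^sup>2 * M\<^sup>2 / n\<close>. The
  error \<open>\<delta>\<close> is arbitrary, so its increment is only bounded by
  \<open>2 * \<Delta>\<close>, without a factor \<open>1 / n\<close>. Splitting it off with weights
  \<open>3 / 2\<close> and \<open>3\<close> and multiplying by the factor
  \<open>n\<^sup>2 / (4 * \<tau>\<^sup>2)\<close> of the estimator gives
  \<open>3 / 2 * 20 / 4 = 15 / 2\<close>. The slack
  \<open>3 / 2 * n * M\<^sup>2 * ln (N + 1)\<close> has to cover \<open>2 * M\<^sup>2\<close>, and
  \<open>n \<ge> 2\<close> with \<open>ln 2 \<ge> 2 / 3\<close> gives exactly that. The shifted
  points may leave \<open>X \<times> Y\<close>, where the saddle property says nothing. Hence the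
  gradient at \<open>z + u\<close> is compared with the equally shifted saddle point
  \<open>zs + u\<close>: the displacement is unchanged, and averaging over \<open>u\<close> and
  \<open>- u\<close> leads back to the unshifted gap.\<close>

lemma ball_borel [measurable]: "ball (c :: 'a::euclidean_space) r \<in> sets borel"
  by simp

lemma emeasure_unit_ball_neq_0: "emeasure lborel (ball (0::'a::euclidean_space) 1) \<noteq> 0"
proof -
  have "unit_ball_vol (real DIM('a)) > 0" by simp
  then have "unit_ball_vol (real DIM('a)) \<noteq> 0" by linarith
  then show ?thesis by (simp add: emeasure_ball)
qed

lemma borel_measurable_sgn_euclidean [measurable]:
  "sgn \<in> borel_measurable (borel :: 'a::euclidean_space measure)"
  unfolding sgn_div_norm by measurable

section \<open>Invariance of Lebesgue measure under translations, scalings and isometries\<close>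

lemma nn_integral_lborel_translate:
  fixes f :: "'a::euclidean_space \<Rightarrow> ennreal"
  assumes [measurable]: "f \<in> borel_measurable borel"
  shows "(\<integral>\<^sup>+x. f (a + x) \<partial>lborel) = (\<integral>\<^sup>+x. f x \<partial>lborel)"
proof -
  have "(\<integral>\<^sup>+x. f x \<partial>lborel) = (\<integral>\<^sup>+x. f x \<partial>(distr lborel borel ((+) a)))"
    by (simp only: lborel_distr_plus)
  also have "\<dots> = (\<integral>\<^sup>+x. f (a + x) \<partial>lborel)"
    by (subst nn_integral_distr) auto
  finally show ?thesis by simp
qed

lemma nn_integral_lborel_scale:
  fixes f :: "'a::euclidean_space \<Rightarrow> ennreal"
  assumes [measurable]: "f \<in> borel_measurable borel" and c: "c > 0"
  shows "(\<integral>\<^sup>+x. f x \<partial>lborel) = ennreal (c ^ DIM('a)) * (\<integral>\<^sup>+x. f (c *\<^sub>R x) \<partial>lborel)"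
proof -
  have "(lborel::'a measure) = density (distr lborel borel (\<lambda>x. 0 + c *\<^sub>R x)) (\<lambda>_. \<bar>c\<bar>^DIM('a))"
    using c by (intro lborel_affine) auto
  then have "(\<integral>\<^sup>+x. f x \<partial>lborel)
      = (\<integral>\<^sup>+x. f x \<partial>density (distr lborel borel (\<lambda>x. 0 + c *\<^sub>R x)) (\<lambda>_. \<bar>c\<bar>^DIM('a)))"
    by simp
  also have "\<dots> = ennreal (c ^ DIM('a)) * (\<integral>\<^sup>+x. f (c *\<^sub>R x) \<partial>lborel)"
    using c by (simp add: nn_integral_density nn_integral_distr nn_integral_cmult)
  finally show ?thesis .
qed

text \<open>Uniqueness of translation-invariant measures by double counting. The image measure is
  translation invariant, and the integral of \<open>indicator A (f x + y) * indicator ?B y\<close>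
  over \<open>x\<close> and \<open>y\<close> is evaluated in both orders. An isometry preserves the
  unit ball, so both measures acquire the same factor \<open>c\<close>, which is finite and nonzero
  and cancels.\<close>

lemma distr_lborel_isometry:
  fixes f :: "'a::euclidean_space \<Rightarrow> 'a"
  assumes f: "linear f" and iso: "\<And>x. norm (f x) = norm x"
  shows "distr lborel borel f = lborel"
proof -
  have meas [measurable]: "f \<in> borel_measurable borel"
    using f by (intro borel_measurable_continuous_onI linear_continuous_on)
      (simp add: linear_conv_bounded_linear)
  have inj: "inj f"
    using f iso by (metis linear_injective_0 norm_eq_zero)
  then have surj: "surj f"
    using f linear_injective_imp_surjective by blast
  let ?B = "ball (0::'a) 1"
  define c where "c = emeasure lborel ?B"
  have c: "c \<noteq> 0" "c \<noteq> \<infinity>"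
    unfolding c_def by (rule emeasure_unit_ball_neq_0) (simp add: emeasure_ball)
  have key: "emeasure lborel A * c = emeasure (distr lborel borel f) A * c"
    if A [measurable]: "A \<in> sets borel" for A
  proof -
    have trans: "(\<integral>\<^sup>+x. indicator A (f x + y) \<partial>lborel) = (\<integral>\<^sup>+x. indicator A (f x) \<partial>lborel)" for y
    proof -
      obtain u where u: "y = f u" using surj by (metis surjD)
      have "(\<integral>\<^sup>+x. indicator A (f x + y) \<partial>lborel) = (\<integral>\<^sup>+x. indicator A (f (u + x)) \<partial>lborel)"
        by (simp add: u linear_add[OF f] add.commute)
      also have "\<dots> = (\<integral>\<^sup>+x. indicator A (f x) \<partial>lborel)"
        by (rule nn_integral_lborel_translate) measurable
      finally show ?thesis .
    qed
    have "emeasure (distr lborel borel f) A * c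
        = (\<integral>\<^sup>+x. indicator A (f x) \<partial>lborel) * (\<integral>\<^sup>+y. indicator ?B y \<partial>lborel)"
    proof -
      have "(\<integral>\<^sup>+x. indicator A (f x) \<partial>lborel) = (\<integral>\<^sup>+x. indicator A x \<partial>distr lborel borel f)"
        by (subst nn_integral_distr) auto
      then show ?thesis by (simp add: c_def)
    qed
    also have "\<dots> = (\<integral>\<^sup>+y. (\<integral>\<^sup>+x. indicator A (f x + y) \<partial>lborel) * indicator ?B y \<partial>lborel)"
      unfolding trans by (subst nn_integral_cmult) (auto intro!: borel_measurable_indicator)
    also have "\<dots> = (\<integral>\<^sup>+y. (\<integral>\<^sup>+x. indicator A (f x + y) * indicator ?B y \<partial>lborel) \<partial>lborel)"
      by (subst nn_integral_multc) auto
    also have "\<dots> = (\<integral>\<^sup>+x. (\<integral>\<^sup>+y. indicator A (f x + y) * indicator ?B y \<partial>lborel) \<partial>lborel)"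
      by (rule lborel_pair.Fubini') measurable
    \<comment> \<open>Translating \<open>y\<close> by \<open>f x\<close> moves the isometry into the
      indicator of the ball. Integration over \<open>x\<close> then sees only the unit ball around a
      preimage of \<open>y\<close>, of volume \<open>c\<close>.\<close>
    also have "\<dots> = (\<integral>\<^sup>+x. (\<integral>\<^sup>+y. indicator A y * indicator ?B (y - f x) \<partial>lborel) \<partial>lborel)"
    proof (rule nn_integral_cong)
      fix x
      show "(\<integral>\<^sup>+y. indicator A (f x + y) * indicator ?B y \<partial>lborel)
          = (\<integral>\<^sup>+y. indicator A y * indicator ?B (y - f x) \<partial>lborel)"
        using nn_integral_lborel_translate[of "\<lambda>y. indicator A y * indicator ?B (y - f x)" "f x"]
        by simp
    qed
    also have "\<dots> = (\<integral>\<^sup>+y. (\<integral>\<^sup>+x. indicator A y * indicator ?B (y - f x) \<partial>lborel) \<partial>lborel)"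
      by (rule lborel_pair.Fubini') measurable
    also have "\<dots> = (\<integral>\<^sup>+y. indicator A y * c \<partial>lborel)"
    proof (rule nn_integral_cong)
      fix y
      obtain u where u: "y = f u" using surj by (metis surjD)
      have "(\<integral>\<^sup>+x. indicator ?B (y - f x) \<partial>lborel) = (\<integral>\<^sup>+x. indicator ?B (x - u) \<partial>lborel)"
        by (intro nn_integral_cong)
          (simp add: u indicator_def norm_minus_commute iso flip: linear_diff[OF f])
      also have "\<dots> = (\<integral>\<^sup>+x. indicator ?B x \<partial>lborel)"
        using nn_integral_lborel_translate[of "\<lambda>x. indicator ?B x" "-u"] by simp
      finally show "(\<integral>\<^sup>+x. indicator A y * indicator ?B (y - f x) \<partial>lborel) = indicator A y * c"
        by (simp add: nn_integral_cmult c_def)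
    qed
    also have "\<dots> = emeasure lborel A * c"
      by (simp add: nn_integral_multc)
    finally show ?thesis by simp
  qed
  show ?thesis
  proof (rule measure_eqI)
    fix A assume "A \<in> sets (distr lborel borel f)"
    then show "emeasure (distr lborel borel f) A = emeasure lborel A"
      using key[of A] c by (simp add: mult.commute[of _ c] ennreal_mult_cancel_left)
  qed simp
qed

lemma nn_integral_lborel_isometry:
  fixes f :: "'a::euclidean_space \<Rightarrow> 'a"
  assumes f: "linear f" "\<And>x. norm (f x) = norm x" and [measurable]: "g \<in> borel_measurable borel"
  shows "(\<integral>\<^sup>+x. g (f x) \<partial>lborel) = (\<integral>\<^sup>+x. g x \<partial>lborel)"
proof -
  have [measurable]: "f \<in> borel_measurable borel"
    using f by (intro borel_measurable_continuous_onI linear_continuous_on)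
      (simp add: linear_conv_bounded_linear)
  have "(\<integral>\<^sup>+x. g x \<partial>lborel) = (\<integral>\<^sup>+x. g x \<partial>(distr lborel borel f))"
    using f by (simp only: distr_lborel_isometry)
  also have "\<dots> = (\<integral>\<^sup>+x. g (f x) \<partial>lborel)"
    by (subst nn_integral_distr) auto
  finally show ?thesis by simp
qed

section \<open>Independence of norm and direction, and the uniform law on the sphere\<close>

lemma AE_lborel_norm_neq: "AE x::'a::euclidean_space in lborel. norm x \<noteq> r"
proof -
  have "sphere (0::'a) r \<in> null_sets lborel"
    using negligible_sphere[of "0::'a" r]
    by (auto simp: null_sets_completion_iff negligible_iff_null_sets)
  then show ?thesis
    by (rule AE_I') auto
qed

text \<open>\<open>sgn\<close> is invariant under positive scaling, so only the volume factor
  appears. The ball on the left is closed to match the sublevel sets of the norm used below; its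
  boundary is a null set.\<close>

lemma nn_integral_ball_sgn:
  fixes G :: "'a::euclidean_space \<Rightarrow> ennreal"
  assumes [measurable]: "G \<in> borel_measurable borel" and r: "r > 0"
  shows "(\<integral>\<^sup>+x. indicator (cball 0 r) x * G (sgn x) \<partial>lborel)
      = ennreal (r ^ DIM('a)) * (\<integral>\<^sup>+x. indicator (ball 0 1) x * G (sgn x) \<partial>lborel)"
proof -
  have "(\<integral>\<^sup>+x. indicator (cball 0 r) x * G (sgn x) \<partial>lborel)
      = ennreal (r ^ DIM('a)) * (\<integral>\<^sup>+x. indicator (cball 0 r) (r *\<^sub>R x) * G (sgn (r *\<^sub>R x)) \<partial>lborel)"
    using r
    by (intro nn_integral_lborel_scale borel_measurable_times_ennreal borel_measurable_indicator)
      (auto intro!: borel_closed)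
  also have "(\<integral>\<^sup>+x. indicator (cball 0 r) (r *\<^sub>R x) * G (sgn (r *\<^sub>R x)) \<partial>lborel)
      = (\<integral>\<^sup>+x. indicator (ball 0 1) x * G (sgn x) \<partial>lborel)"
    using AE_lborel_norm_neq[of 1] r by (intro nn_integral_cong_AE) (auto simp: indicator_def sgn_scaleR)
  finally show ?thesis .
qed

lemma nn_integral_uniform_sphere:
  fixes G :: "'a::euclidean_space \<Rightarrow> ennreal"
  assumes [measurable]: "G \<in> borel_measurable borel"
  shows "(\<integral>\<^sup>+x. G x \<partial>uniform_sphere)
      = (\<integral>\<^sup>+x. indicator (ball 0 1) x * G (sgn x) \<partial>lborel) / emeasure lborel (ball (0::'a) 1)"
  unfolding uniform_sphere_def
  by (subst nn_integral_distr)
    (simp_all add: nn_integral_uniform_measure emeasure_unit_ball_neq_0 emeasure_ball mult.commute)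

lemma integral_uniform_sphere:
  fixes g :: "'a::euclidean_space \<Rightarrow> real"
  assumes [measurable]: "g \<in> borel_measurable borel"
  shows "(\<integral>x. g x \<partial>uniform_sphere)
      = (\<integral>x. indicator (ball 0 1) x * g (sgn x) \<partial>lborel) / measure lborel (ball (0::'a) 1)"
proof -
  let ?B = "ball (0::'a) 1"
  have "emeasure lborel ?B = ennreal (measure lborel ?B)"
    by (simp add: measure_def emeasure_ball)
  then have *: "(indicator ?B x :: ennreal) / emeasure lborel ?B
      = ennreal (indicator ?B x / measure lborel ?B)" for x
    using emeasure_unit_ball_neq_0[where 'a='a]
    by (auto simp: indicator_def divide_ennreal simp flip: ennreal_1)
  have "(\<integral>x. g x \<partial>uniform_sphere) = (\<integral>x. g (sgn x) \<partial>uniform_measure lborel ?B)"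
    unfolding uniform_sphere_def by (subst integral_distr) auto
  also have "\<dots> = (\<integral>x. (indicator ?B x / measure lborel ?B) *\<^sub>R g (sgn x) \<partial>lborel)"
    unfolding uniform_measure_def * by (subst integral_density) (auto intro!: borel_measurable_divide borel_measurable_indicator)
  also have "\<dots> = (\<integral>x. (1 / measure lborel ?B) * (indicator ?B x * g (sgn x)) \<partial>lborel)"
    by simp
  finally show ?thesis by simp
qed

lemma prob_space_uniform_sphere: "prob_space (uniform_sphere :: 'a::euclidean_space measure)"
  unfolding uniform_sphere_def
  by (intro prob_space.prob_space_distr prob_space_uniform_measure)
    (simp_all only: emeasure_unit_ball_neq_0 not_False_eq_True, simp_all add: emeasure_ball)

lemma sets_uniform_sphere [simp, measurable_cong]: "sets uniform_sphere = sets borel"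
  by (simp add: uniform_sphere_def)

lemma space_uniform_sphere [simp]: "space uniform_sphere = UNIV"
  by (simp add: uniform_sphere_def)

lemma AE_uniform_sphere: "AE x::'a::euclidean_space in uniform_sphere. norm x = 1"
proof -
  have "AE x::'a in lborel. x \<noteq> 0" by (rule AE_lborel_singleton)
  then have "AE x::'a in uniform_measure lborel (ball 0 1). norm (sgn x) = 1"
    by (intro AE_uniform_measureI) (auto simp: norm_sgn)
  then show ?thesis
    unfolding uniform_sphere_def by (subst AE_distr_iff) auto
qed

text \<open>The factor in front is the distribution function of \<open>norm x\<close> for
  \<open>x\<close> uniform on the unit ball. That it does not involve \<open>G\<close> is the
  independence of norm and direction.\<close>

lemma nn_integral_ball_norm_le_sgn:
  fixes G :: "'a::euclidean_space \<Rightarrow> ennreal"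
  assumes [measurable]: "G \<in> borel_measurable borel"
  shows "(\<integral>\<^sup>+x. indicator (ball 0 1) x * indicator {..s} (norm x) * G (sgn x) \<partial>lborel)
      = (if s \<le> 0 then 0 else if s < 1 then ennreal (s ^ DIM('a)) else 1)
        * (\<integral>\<^sup>+x. indicator (ball 0 1) x * G (sgn x) \<partial>lborel)"
proof -
  consider "s \<le> 0" | "0 < s" "s < 1" | "1 \<le> s" by linarith
  then show ?thesis
  proof cases
    case 1
    have "AE x::'a in lborel. x \<noteq> 0" by (rule AE_lborel_singleton)
    then have "AE x::'a in lborel. indicator (ball 0 1) x * indicator {..s} (norm x) * G (sgn x) = 0"
      by eventually_elim (use 1 in \<open>auto simp: indicator_def dest: order_trans\<close>)
    then have "(\<integral>\<^sup>+x. indicator (ball 0 1) x * indicator {..s} (norm x) * G (sgn x) \<partial>lborel)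
        = (\<integral>\<^sup>+(x::'a). 0 \<partial>lborel)"
      by (rule nn_integral_cong_AE)
    then show ?thesis using 1 by simp
  next
    case 2
    have "(\<integral>\<^sup>+x. indicator (ball 0 1) x * indicator {..s} (norm x) * G (sgn x) \<partial>lborel)
        = (\<integral>\<^sup>+x. indicator (cball 0 s) x * G (sgn x) \<partial>lborel)"
      using 2 by (intro nn_integral_cong) (auto simp: indicator_def)
    then show ?thesis using 2 by (simp add: nn_integral_ball_sgn)
  next
    case 3
    have "(\<integral>\<^sup>+x. indicator (ball 0 1) x * indicator {..s} (norm x) * G (sgn x) \<partial>lborel)
        = (\<integral>\<^sup>+x. indicator (ball 0 1) x * G (sgn x) \<partial>lborel)"
      using 3 by (intro nn_integral_cong) (auto simp: indicator_def)
    then show ?thesis using 3 by simp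
  qed
qed

text \<open>By the previous lemma, the law \<open>Q G\<close> of the norm under the density
  \<open>G (sgn x)\<close> on the ball depends on \<open>G\<close> only through its total mass. So
  \<open>G\<close> may be replaced by the constant \<open>?E\<close>. Finiteness of the mass allows
  the two laws to be compared through their tails.\<close>

lemma nn_integral_radial_sgn:
  fixes G :: "'a::euclidean_space \<Rightarrow> ennreal"
  assumes [measurable]: "G \<in> borel_measurable borel" "\<rho> \<in> borel_measurable borel"
    and fin: "(\<integral>\<^sup>+x. G x \<partial>uniform_sphere) < \<infinity>"
  shows "(\<integral>\<^sup>+x. indicator (ball 0 1) x * \<rho> (norm x) * G (sgn x) \<partial>lborel)
      = (\<integral>\<^sup>+x. G x \<partial>uniform_sphere) * (\<integral>\<^sup>+(x::'a). indicator (ball 0 1) x * \<rho> (norm x) \<partial>lborel)"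
proof -
  let ?B = "ball (0::'a) 1"
  define c where "c = emeasure lborel ?B"
  have c: "c \<noteq> 0" "c \<noteq> \<infinity>"
    unfolding c_def by (rule emeasure_unit_ball_neq_0) (simp add: emeasure_ball)
  define Q where "Q H = distr (density lborel (\<lambda>x. indicator ?B x * H (sgn x))) borel norm"
    for H :: "'a \<Rightarrow> ennreal"
  have Q: "(\<integral>\<^sup>+r. g r \<partial>Q H) = (\<integral>\<^sup>+x. indicator ?B x * g (norm x) * H (sgn x) \<partial>lborel)"
    if [measurable]: "g \<in> borel_measurable borel" "H \<in> borel_measurable borel" for g H
    unfolding Q_def by (subst nn_integral_distr) (auto simp: nn_integral_density mult_ac)
  let ?J = "\<lambda>H. \<integral>\<^sup>+x. indicator ?B x * H (sgn x) \<partial>lborel"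
  have em: "emeasure (Q H) A = (\<integral>\<^sup>+x. indicator ?B x * indicator A (norm x) * H (sgn x) \<partial>lborel)"
    if [measurable]: "A \<in> sets borel" "H \<in> borel_measurable borel" for A H
    using Q[of "indicator A" H] that by (simp add: Q_def)
  have eq: "Q H = Q H'"
    if [measurable]: "H \<in> borel_measurable borel" "H' \<in> borel_measurable borel"
      and J: "?J H = ?J H'" "?J H < \<infinity>" for H H'
  proof (rule measure_eqI_lessThan)
    have *: "emeasure (Q H) {s<..} = emeasure (Q H) UNIV - emeasure (Q H) {..s}"
      if "H \<in> borel_measurable borel" "?J H < \<infinity>" for H s
    proof -
      have "{s<..} = UNIV - {..s}" by auto
      moreover have "emeasure (Q H) {..s} \<noteq> \<infinity>"
        using that(2) unfolding em[OF _ that(1)] nn_integral_ball_norm_le_sgn[OF that(1)]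
        by (auto simp: em nn_integral_ball_norm_le_sgn that ennreal_mult_eq_top_iff)
      ultimately show ?thesis
        using emeasure_Diff[of "Q H" "{..s}" UNIV] by (simp add: Q_def)
    qed
    fix s
    show "emeasure (Q H) {s<..} = emeasure (Q H') {s<..}"
      using J unfolding *[OF that(1) J(2)] *[OF that(2) J(2)[unfolded J(1)]]
      by (simp add: em nn_integral_ball_norm_le_sgn)
    have "emeasure (Q H) {s<..} \<le> emeasure (Q H) UNIV"
      by (intro emeasure_mono) (auto simp: Q_def)
    also have "\<dots> < \<infinity>" using J by (simp add: em)
    finally show "emeasure (Q H) {s<..} < \<infinity>" .
  qed (simp_all add: Q_def)
  let ?E = "\<integral>\<^sup>+x. G x \<partial>uniform_sphere"
  have JE: "?J G = ?E * c"
    using c unfolding nn_integral_uniform_sphere[OF assms(1)] c_def[symmetric]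
    by (simp add: ennreal_divide_times less_top)
  have "Q G = Q (\<lambda>_. ?E)"
  proof (rule eq)
    have "?J (\<lambda>_. ?E) = c * ?E" unfolding c_def by (subst nn_integral_multc) auto
    then show "?J G = ?J (\<lambda>_. ?E)" using JE by (simp add: mult.commute)
    show "?J G < \<infinity>" using fin c by (simp add: JE ennreal_mult_less_top less_top)
  qed simp_all
  then have "(\<integral>\<^sup>+r. \<rho> r \<partial>Q G) = (\<integral>\<^sup>+r. \<rho> r \<partial>Q (\<lambda>_. ?E))" by simp
  then have "(\<integral>\<^sup>+x. indicator ?B x * \<rho> (norm x) * G (sgn x) \<partial>lborel)
      = (\<integral>\<^sup>+x. indicator ?B x * \<rho> (norm x) * ?E \<partial>lborel)"
    by (simp add: Q)
  also have "\<dots> = (\<integral>\<^sup>+x. indicator ?B x * \<rho> (norm x) \<partial>lborel) * ?E"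
    by (rule nn_integral_multc) measurable
  finally show ?thesis by (simp add: mult.commute)
qed

text \<open>The Householder reflection along \<open>a - b\<close>, which is self-adjoint and sends
  \<open>a\<close> to \<open>b\<close>.\<close>

lemma reflection_exchanging_unit_vectors:
  fixes a b :: "'a::euclidean_space"
  assumes "norm a = 1" "norm b = 1"
  obtains f where "linear f" "\<And>x. norm (f x) = norm x" "\<And>x. a \<bullet> f x = b \<bullet> x"
proof (cases "a = b")
  case True
  show ?thesis by (rule that[of id]) (auto simp: True linear_iff)
next
  case False
  define u where "u = a - b"
  define f where "f x = x - (2 * (u \<bullet> x) / (u \<bullet> u)) *\<^sub>R u" for x
  have u: "u \<bullet> u \<noteq> 0" using False by (simp add: u_def)
  have ab: "a \<bullet> a = 1" "b \<bullet> b = 1" using assms by (auto simp: dot_square_norm)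
  have uu: "u \<bullet> u = 2 - 2 * (a \<bullet> b)" "a \<bullet> u = 1 - a \<bullet> b"
    by (simp_all add: u_def inner_diff inner_commute ab)
  show ?thesis
  proof (rule that)
    show "linear f"
      unfolding f_def
      by (intro linearI)
        (simp_all add: inner_add_right add_divide_distrib distrib_left scaleR_add_left scaleR_diff_right)
    show "norm (f x) = norm x" for x
    proof -
      have "f x \<bullet> f x = x \<bullet> x"
        using u by (simp add: f_def inner_diff inner_commute field_simps power2_eq_square)
      then show ?thesis by (simp add: norm_eq)
    qed
    show "a \<bullet> f x = b \<bullet> x" for x
    proof -
      have "2 * (a \<bullet> u) = u \<bullet> u" by (simp add: uu)
      then have "2 * (u \<bullet> x) / (u \<bullet> u) * (a \<bullet> u) = u \<bullet> x"
        using u by (simp add: field_simps)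
      then have "a \<bullet> f x = a \<bullet> x - u \<bullet> x"
        by (simp add: f_def inner_diff_right)
      then show ?thesis by (simp add: u_def inner_diff_left)
    qed
  qed
qed

text \<open>Isotropy: by reflections every unit vector gives the same integral, and the
  contributions of an orthonormal basis add up to the integral of the squared norm, so each
  direction carries the share \<open>1 / DIM('a)\<close>.\<close>

lemma nn_integral_radial_inner_square:
  fixes w :: "'a::euclidean_space"
  assumes [measurable]: "\<rho> \<in> borel_measurable borel"
  shows "of_nat DIM('a) * (\<integral>\<^sup>+y. \<rho> (norm y) * ennreal ((w \<bullet> y)\<^sup>2) \<partial>lborel)
      = ennreal ((norm w)\<^sup>2) * (\<integral>\<^sup>+(y::'a). \<rho> (norm y) * ennreal ((norm y)\<^sup>2) \<partial>lborel)"
proof (cases "w = 0")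
  case True
  then show ?thesis by simp
next
  case False
  define a where "a = w /\<^sub>R norm w"
  have a: "norm a = 1" "w = norm w *\<^sub>R a" using False by (simp_all add: a_def)
  define T where "T v = (\<integral>\<^sup>+y. \<rho> (norm y) * ennreal ((v \<bullet> y)\<^sup>2) \<partial>lborel)" for v :: 'a
  have T: "T b = T a" if b: "b \<in> Basis" for b
  proof -
    obtain f where f: "linear f" "\<And>x. norm (f x) = norm x" "\<And>x. a \<bullet> f x = b \<bullet> x"
      using reflection_exchanging_unit_vectors[of a b] a(1) norm_Basis[OF b] by blast
    have "T a = (\<integral>\<^sup>+y. \<rho> (norm (f y)) * ennreal ((a \<bullet> f y)\<^sup>2) \<partial>lborel)"
      unfolding T_def
      by (rule nn_integral_lborel_isometry[OF f(1,2), symmetric]) measurable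
    then show ?thesis by (simp add: T_def f)
  qed
  have "(\<integral>\<^sup>+(y::'a). \<rho> (norm y) * ennreal ((norm y)\<^sup>2) \<partial>lborel)
      = (\<integral>\<^sup>+(y::'a). (\<Sum>b\<in>Basis. \<rho> (norm y) * ennreal ((b \<bullet> y)\<^sup>2)) \<partial>lborel)"
  proof (rule nn_integral_cong)
    fix y :: 'a
    have "(norm y)\<^sup>2 = (\<Sum>b\<in>Basis. (b \<bullet> y)\<^sup>2)"
      unfolding power2_norm_eq_inner
      by (subst euclidean_inner) (simp add: power2_eq_square inner_commute)
    then show "\<rho> (norm y) * ennreal ((norm y)\<^sup>2)
        = (\<Sum>b\<in>Basis. \<rho> (norm y) * ennreal ((b \<bullet> y)\<^sup>2))"
      by (simp add: sum_ennreal flip: sum_distrib_left)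
  qed
  also have "\<dots> = (\<Sum>b\<in>Basis. T b)"
    unfolding T_def by (rule nn_integral_sum) measurable
  also have "\<dots> = of_nat DIM('a) * T a"
    by (simp add: T)
  finally have *: "(\<integral>\<^sup>+(y::'a). \<rho> (norm y) * ennreal ((norm y)\<^sup>2) \<partial>lborel) = of_nat DIM('a) * T a" .
  have "T w = (\<integral>\<^sup>+y. ennreal ((norm w)\<^sup>2) * (\<rho> (norm y) * ennreal ((a \<bullet> y)\<^sup>2)) \<partial>lborel)"
    unfolding T_def
    by (intro nn_integral_cong) (subst a(2), simp add: power_mult_distrib ennreal_mult mult_ac)
  also have "\<dots> = ennreal ((norm w)\<^sup>2) * T a"
    unfolding T_def by (rule nn_integral_cmult) measurable
  finally show ?thesis by (simp add: * T_def[symmetric] mult_ac)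
qed

section \<open>Second moment of an odd function on the sphere\<close>

lemma borel_measurable_fst_snd [measurable]:
  "fst \<in> borel_measurable (borel :: ('a::euclidean_space \<times> 'b::euclidean_space) measure)"
  "snd \<in> borel_measurable (borel :: ('a::euclidean_space \<times> 'b::euclidean_space) measure)"
  by (intro borel_measurable_continuous_onI continuous_on_fst continuous_on_snd continuous_on_id)+

text \<open>The extension has degree one rather than zero because its gradient then depends on the
  direction only and stays bounded near the origin.\<close>

definition homogeneous_ext :: "('a::real_normed_vector \<Rightarrow> real) \<Rightarrow> 'a \<Rightarrow> real" where
  "homogeneous_ext h x = norm x * h (sgn x)"

text \<open>A radial part plus the tangential part of \<open>w\<close>: the factor
  \<open>norm x\<close> cancels the factor \<open>1 / norm x\<close> in the derivative of
  \<open>sgn\<close>.\<close>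

lemma homogeneous_ext_gderiv:
  fixes h :: "'a::euclidean_space \<Rightarrow> real"
  assumes x: "x \<noteq> 0" and h: "GDERIV h (sgn x) :> w"
  shows "GDERIV (homogeneous_ext h) x :> h (sgn x) *\<^sub>R sgn x + (w - (w \<bullet> sgn x) *\<^sub>R sgn x)"
proof -
  have sgn: "(sgn has_derivative (\<lambda>v. (v - (sgn x \<bullet> v) *\<^sub>R sgn x) /\<^sub>R norm x)) (at x)"
    unfolding sgn_div_norm[abs_def]
    using x
    by (auto intro!: has_derivative_eq_rhs[OF has_derivative_scaleR[OF Deriv.has_derivative_inverse[OF _
          has_derivative_norm[OF x]] has_derivative_ident]]
        simp: sgn_div_norm fun_eq_iff scaleR_diff_right inner_commute)
  have "((\<lambda>x. h (sgn x)) has_derivative (\<lambda>v. ((v - (sgn x \<bullet> v) *\<^sub>R sgn x) /\<^sub>R norm x) \<bullet> w)) (at x)"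
    using has_derivative_compose[OF sgn, of h "\<lambda>v. v \<bullet> w"] h by (simp add: gderiv_def)
  from has_derivative_mult[OF has_derivative_norm[OF x] this]
  have "(homogeneous_ext h has_derivative
      (\<lambda>v. norm x * (((v - (sgn x \<bullet> v) *\<^sub>R sgn x) /\<^sub>R norm x) \<bullet> w) + (sgn x \<bullet> v) * h (sgn x))) (at x)"
    by (simp add: homogeneous_ext_def[abs_def] inner_commute)
  moreover have "norm x * (((v - (sgn x \<bullet> v) *\<^sub>R sgn x) /\<^sub>R norm x) \<bullet> w) + (sgn x \<bullet> v) * h (sgn x)
      = v \<bullet> (h (sgn x) *\<^sub>R sgn x + (w - (w \<bullet> sgn x) *\<^sub>R sgn x))" for v
  proof -
    have "norm x * (((v - (sgn x \<bullet> v) *\<^sub>R sgn x) /\<^sub>R norm x) \<bullet> w) = (v - (sgn x \<bullet> v) *\<^sub>R sgn x) \<bullet> w"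
      using x by simp
    then show ?thesis by (simp add: inner_diff inner_add inner_commute algebra_simps)
  qed
  ultimately show ?thesis by (simp add: gderiv_def)
qed

text \<open>Pythagoras for the radial and the tangential part. The value and the gradient of the
  function on the sphere are both bounded by \<open>K\<close>, which is the origin of the factor
  2.\<close>

lemma norm_homogeneous_ext_gderiv:
  fixes w e :: "'a::euclidean_space"
  assumes "norm e = 1" "\<bar>c\<bar> \<le> K" "norm w \<le> K"
  shows "(norm (c *\<^sub>R e + (w - (w \<bullet> e) *\<^sub>R e)))\<^sup>2 \<le> 2 * K\<^sup>2"
proof -
  have e: "e \<bullet> e = 1" using assms by (simp add: dot_square_norm)
  have "(norm (c *\<^sub>R e + (w - (w \<bullet> e) *\<^sub>R e)))\<^sup>2 = c\<^sup>2 + (norm w)\<^sup>2 - (w \<bullet> e)\<^sup>2"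
    unfolding power2_norm_eq_inner
    by (simp add: inner_diff inner_add e inner_commute power2_eq_square algebra_simps)
  also have "\<dots> \<le> c\<^sup>2 + (norm w)\<^sup>2" by simp
  also have "\<dots> \<le> K\<^sup>2 + K\<^sup>2"
    using assms(2,3) power_mono[of "norm w" K 2] power2_abs[of c] power_mono[of "\<bar>c\<bar>" K 2]
    by (intro add_mono) auto
  finally show ?thesis by simp
qed

lemma norm_scaled_sgn_diff:
  fixes x y :: "'a::real_normed_vector"
  assumes "x \<noteq> 0" "y \<noteq> 0"
  shows "norm y * norm (sgn x - sgn y) \<le> 2 * norm (x - y)"
proof -
  have "norm y *\<^sub>R (sgn x - sgn y) = (norm y - norm x) *\<^sub>R sgn x + (x - y)"
    using assms by (simp add: sgn_div_norm algebra_simps)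
  then have "norm y * norm (sgn x - sgn y) = norm ((norm y - norm x) *\<^sub>R sgn x + (x - y))"
    by (metis norm_scaleR abs_norm_cancel)
  also have "\<dots> \<le> \<bar>norm y - norm x\<bar> + norm (x - y)"
    using norm_triangle_ineq[of "(norm y - norm x) *\<^sub>R sgn x" "x - y"] assms by (simp add: norm_sgn)
  also have "\<dots> \<le> 2 * norm (x - y)"
    using norm_triangle_ineq3[of y x] by (simp add: norm_minus_commute)
  finally show ?thesis .
qed

text \<open>A change of radius costs \<open>K\<close> and a change of direction
  \<open>2 * K\<close>. The constant does not reach the final variance bound; it supplies the
  dominating function in \<open>pair_integral_odd_derivative\<close>.\<close>

lemma homogeneous_ext_lipschitz:
  fixes h :: "'a::real_normed_vector \<Rightarrow> real"
  assumes lip: "\<And>x y. norm x = 1 \<Longrightarrow> norm y = 1 \<Longrightarrow> \<bar>h x - h y\<bar> \<le> K * norm (x - y)"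
    and bd: "\<And>x. norm x = 1 \<Longrightarrow> \<bar>h x\<bar> \<le> K" and K: "K \<ge> 0"
  shows "\<bar>homogeneous_ext h x - homogeneous_ext h y\<bar> \<le> 3 * K * norm (x - y)"
proof -
  have bound: "\<bar>homogeneous_ext h x\<bar> \<le> K * norm x" for x
    using bd[of "sgn x"] K
    by (cases "x = 0")
      (auto simp: homogeneous_ext_def abs_mult norm_sgn mult.commute intro: mult_left_mono)
  show ?thesis
  proof (cases "x = 0 \<or> y = 0")
    case True
    have "K * norm (x - y) \<le> 3 * K * norm (x - y)" using K by (intro mult_right_mono) auto
    with True bound[of x] bound[of y] show ?thesis
      by (auto simp: homogeneous_ext_def)
  next
    case False
    have "homogeneous_ext h x - homogeneous_ext h y
        = (norm x - norm y) * h (sgn x) + norm y * (h (sgn x) - h (sgn y))"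
      by (simp add: homogeneous_ext_def algebra_simps)
    also have "\<bar>\<dots>\<bar> \<le> \<bar>norm x - norm y\<bar> * \<bar>h (sgn x)\<bar> + norm y * \<bar>h (sgn x) - h (sgn y)\<bar>"
      by (rule order_trans[OF abs_triangle_ineq]) (simp add: abs_mult)
    also have "\<dots> \<le> norm (x - y) * K + norm y * (K * norm (sgn x - sgn y))"
      using False K by (intro add_mono mult_mono mult_left_mono bd lip norm_triangle_ineq3)
        (auto simp: norm_sgn)
    also have "\<dots> \<le> norm (x - y) * K + K * (2 * norm (x - y))"
      using mult_left_mono[OF norm_scaled_sgn_diff K, of x y] False by (simp add: mult_ac)
    finally show ?thesis by (simp add: algebra_simps)
  qed
qed

text \<open>For \<open>(x, y)\<close> uniform in the unit ball of the product space, the path of rotations below leads from \<open>x\<close> to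
  \<open>- x\<close> within a fixed law, its velocity is isotropic given its position, and \<open>sgn x\<close> is uniform on the
  sphere and independent of \<open>norm x\<close>. This replaces the spectral gap of the Laplacian of the sphere.\<close>

definition pair_rotation :: "real \<Rightarrow> 'a::real_vector \<times> 'a \<Rightarrow> 'a \<times> 'a" where
  "pair_rotation t p = (cos t *\<^sub>R fst p + sin t *\<^sub>R snd p, cos t *\<^sub>R snd p - sin t *\<^sub>R fst p)"

lemma pair_rotation_add: "pair_rotation s (pair_rotation t p) = pair_rotation (s + t) p"
  by (simp add: pair_rotation_def sin_add cos_add algebra_simps)

lemma linear_pair_rotation: "linear (pair_rotation t)"
  by (rule linearI) (auto simp: pair_rotation_def algebra_simps)

lemma norm_pair_rotation:
  fixes p :: "'a::real_inner \<times> 'a"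
  shows "norm (pair_rotation t p) = norm p"
proof -
  have "(c *\<^sub>R x + s *\<^sub>R y) \<bullet> (c *\<^sub>R x + s *\<^sub>R y) + (c *\<^sub>R y - s *\<^sub>R x) \<bullet> (c *\<^sub>R y - s *\<^sub>R x)
      = (c\<^sup>2 + s\<^sup>2) * (x \<bullet> x + y \<bullet> y)" for c s and x y :: 'a
    by (simp add: inner_diff inner_add inner_commute[of y x] power2_eq_square algebra_simps)
  from this[of "cos t" "fst p" "sin t" "snd p"]
  have "pair_rotation t p \<bullet> pair_rotation t p = fst p \<bullet> fst p + snd p \<bullet> snd p"
    by (simp add: pair_rotation_def)
  then show ?thesis by (simp add: norm_eq_sqrt_inner inner_prod_def)
qed

lemma pair_rotation_measurable [measurable]:
  "pair_rotation t \<in> borel_measurable (borel :: ('a::euclidean_space \<times> 'a) measure)"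
  by (intro borel_measurable_continuous_onI linear_continuous_on
      linear_conv_bounded_linear[THEN iffD1] linear_pair_rotation)

text \<open>An unnormalised expectation, with values in \<open>ennreal\<close> so that iterated
  integrals need only measurability. The normalisation drops out, since both sides of the final
  comparison are multiples of the same second moment. It is applied to nonnegative integrands
  only.\<close>

definition pair_integral :: "('a::euclidean_space \<times> 'a \<Rightarrow> real) \<Rightarrow> ennreal" where
  "pair_integral f = (\<integral>\<^sup>+p. indicator (ball 0 1) p * ennreal (f p) \<partial>lborel)"

lemma pair_integral_rotate:
  assumes [measurable]: "f \<in> borel_measurable borel"
  shows "pair_integral (\<lambda>p. f (pair_rotation t p)) = pair_integral f"
proof -
  have "pair_integral (\<lambda>p. f (pair_rotation t p))
      = (\<integral>\<^sup>+p. indicator (ball 0 1) (pair_rotation t p) * ennreal (f (pair_rotation t p)) \<partial>lborel)"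
    unfolding pair_integral_def
    by (intro nn_integral_cong) (simp add: indicator_def norm_pair_rotation)
  also have "\<dots> = pair_integral f"
    unfolding pair_integral_def
    by (rule nn_integral_lborel_isometry[OF linear_pair_rotation norm_pair_rotation]) measurable
  finally show ?thesis .
qed

text \<open>The first form freezes the position \<open>x\<close> and exposes the isotropy of the
  velocity \<open>y\<close>; the second freezes \<open>y\<close> and exposes the independence of
  norm and direction of \<open>x\<close>. The indicator is radial in each variable.\<close>

lemma pair_integral_iterated:
  fixes f :: "'a::euclidean_space \<times> 'a \<Rightarrow> real"
  assumes [measurable]: "f \<in> borel_measurable borel"
  shows "pair_integral f
      = (\<integral>\<^sup>+x. \<integral>\<^sup>+y. indicator {..<1} ((norm x)\<^sup>2 + (norm y)\<^sup>2) * ennreal (f (x, y)) \<partial>lborel \<partial>lborel)"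
    and "pair_integral f
      = (\<integral>\<^sup>+y. \<integral>\<^sup>+x. indicator {..<1} ((norm x)\<^sup>2 + (norm y)\<^sup>2) * ennreal (f (x, y)) \<partial>lborel \<partial>lborel)"
proof -
  have [measurable]: "f \<in> borel_measurable (borel \<Otimes>\<^sub>M borel)" by (simp add: borel_prod)
  have "indicator (ball 0 1) p = (indicator {..<1} ((norm (fst p))\<^sup>2 + (norm (snd p))\<^sup>2) :: ennreal)"
    for p :: "'a \<times> 'a"
    by (simp add: indicator_def norm_prod_def)
  then have *: "pair_integral f = (\<integral>\<^sup>+p. indicator {..<1} ((norm (fst p))\<^sup>2 + (norm (snd p))\<^sup>2)
      * ennreal (f (fst p, snd p)) \<partial>(lborel \<Otimes>\<^sub>M lborel))"
    by (simp add: pair_integral_def lborel_prod)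
  show "pair_integral f
      = (\<integral>\<^sup>+x. \<integral>\<^sup>+y. indicator {..<1} ((norm x)\<^sup>2 + (norm y)\<^sup>2) * ennreal (f (x, y)) \<partial>lborel \<partial>lborel)"
    unfolding * by (subst lborel.nn_integral_fst[symmetric]) auto
  show "pair_integral f
      = (\<integral>\<^sup>+y. \<integral>\<^sup>+x. indicator {..<1} ((norm x)\<^sup>2 + (norm y)\<^sup>2) * ennreal (f (x, y)) \<partial>lborel \<partial>lborel)"
    unfolding * by (subst lborel_pair.nn_integral_snd[symmetric]) (auto simp: case_prod_unfold)
qed

lemma AE_lborel_fst_neq_0: "AE p :: 'a::euclidean_space \<times> 'a in lborel. fst p \<noteq> 0"
proof -
  have "emeasure (lborel \<Otimes>\<^sub>M lborel) ({0::'a} \<times> (UNIV::'a set)) = 0"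
    by (subst lborel.emeasure_pair_measure_Times) auto
  then have "{0::'a} \<times> (UNIV::'a set) \<in> null_sets lborel"
    unfolding lborel_prod by (intro null_setsI) (auto intro!: borel_closed closed_Times)
  then show ?thesis
    by (rule AE_I') auto
qed

lemma pair_integral_mono:
  "(\<And>p. norm p < 1 \<Longrightarrow> f p \<le> g p) \<Longrightarrow> pair_integral f \<le> pair_integral g"
  unfolding pair_integral_def
  by (intro nn_integral_mono) (auto simp: indicator_def intro: ennreal_leI)

lemma pair_integral_cmult:
  assumes "c \<ge> 0" "f \<in> borel_measurable borel"
  shows "pair_integral (\<lambda>p. c * f p) = ennreal c * pair_integral f"
proof -
  have "pair_integral (\<lambda>p. c * f p)
      = (\<integral>\<^sup>+p. ennreal c * (indicator (ball 0 1) p * ennreal (f p)) \<partial>lborel)"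
    unfolding pair_integral_def using assms
    by (intro nn_integral_cong) (simp add: ennreal_mult' mult_ac)
  also have "\<dots> = ennreal c * pair_integral f"
    unfolding pair_integral_def using assms
    by (intro nn_integral_cmult borel_measurable_times_ennreal borel_measurable_indicator) auto
  finally show ?thesis .
qed

lemma pair_integral_sum:
  assumes "\<And>i p. i \<in> I \<Longrightarrow> f i p \<ge> 0" "\<And>i. i \<in> I \<Longrightarrow> f i \<in> borel_measurable borel"
  shows "pair_integral (\<lambda>p. \<Sum>i\<in>I. f i p) = (\<Sum>i\<in>I. pair_integral (f i))"
proof -
  have "pair_integral (\<lambda>p. \<Sum>i\<in>I. f i p)
      = (\<integral>\<^sup>+p. (\<Sum>i\<in>I. indicator (ball 0 1) p * ennreal (f i p)) \<partial>lborel)"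
    unfolding pair_integral_def using assms
    by (intro nn_integral_cong) (simp add: sum_ennreal flip: sum_distrib_left)
  also have "\<dots> = (\<Sum>i\<in>I. pair_integral (f i))"
    unfolding pair_integral_def using assms
    by (intro nn_integral_sum borel_measurable_times_ennreal borel_measurable_indicator) auto
  finally show ?thesis .
qed

text \<open>A rotation by \<open>pi\<close> takes \<open>fst p\<close> to \<open>- fst p\<close>, so
  for odd \<open>F\<close> the increments over \<open>m\<close> steps add up to
  \<open>- 2 * F (fst p)\<close>. Cauchy-Schwarz over the steps gives the factor
  \<open>m / 4\<close>.\<close>

lemma odd_increment_telescope:
  fixes F :: "'a::euclidean_space \<Rightarrow> real"
  assumes F: "\<And>x. F (- x) = - F x" and m: "m > 0"
  shows "(F (fst p))\<^sup>2 \<le> real m / 4 * (\<Sum>j<m. (F (fst (pair_rotation (pi / real m) (pair_rotation (real j * (pi / real m)) p)))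
      - F (fst (pair_rotation (real j * (pi / real m)) p)))\<^sup>2)"
proof -
  define u where "u j = F (fst (pair_rotation (real j * (pi / real m)) p))" for j
  have "fst (pair_rotation pi p) = - fst p" "fst (pair_rotation 0 p) = fst p"
    by (simp_all add: pair_rotation_def)
  then have u0m: "u 0 = F (fst p)" "u m = - F (fst p)" using m F by (simp_all add: u_def)
  have *: "F (fst (pair_rotation (pi / real m) (pair_rotation (real j * (pi / real m)) p))) = u (Suc j)" for j
    by (simp add: u_def pair_rotation_add algebra_simps add_divide_distrib)
  have "(2 * F (fst p))\<^sup>2 = (\<Sum>j<m. u (Suc j) - u j)\<^sup>2"
    by (simp add: sum_lessThan_telescope u0m power2_eq_square)
  moreover have "(\<Sum>j<m. u (Suc j) - u j)\<^sup>2 \<le> (\<Sum>j<m. (u (Suc j) - u j)\<^sup>2) * real m"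
    using sum_squared_le_sum_of_squares[of "\<lambda>j. u (Suc j) - u j" "{..<m}"] by simp
  ultimately show ?thesis unfolding * u_def[symmetric] by (simp add: power_mult_distrib mult.commute)
qed

text \<open>Rotation invariance makes the integrals of all \<open>m\<close> squared increments
  equal, so the factor becomes \<open>m / 4 * m\<close>, the square of \<open>m / 2\<close>.\<close>

lemma pair_integral_odd_increment:
  fixes F :: "'a::euclidean_space \<Rightarrow> real"
  assumes F: "\<And>x. F (- x) = - F x" and m: "m > 0" and [measurable]: "F \<in> borel_measurable borel"
  shows "pair_integral (\<lambda>p. (F (fst p))\<^sup>2)
    \<le> pair_integral (\<lambda>p. (real m / 2 * (F (fst (pair_rotation (pi / real m) p)) - F (fst p)))\<^sup>2)"
proof -
  let ?t = "pi / real m"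
  define g where "g p = (F (fst (pair_rotation ?t p)) - F (fst p))\<^sup>2" for p
  have [measurable]: "g \<in> borel_measurable borel"
    unfolding g_def by measurable
  have "pair_integral (\<lambda>p. (F (fst p))\<^sup>2)
      \<le> pair_integral (\<lambda>p. real m / 4 * (\<Sum>j<m. g (pair_rotation (real j * ?t) p)))"
    unfolding g_def by (intro pair_integral_mono odd_increment_telescope F m)
  also have "\<dots> = ennreal (real m / 4) * (\<Sum>j<m. pair_integral (\<lambda>p. g (pair_rotation (real j * ?t) p)))"
    by (subst pair_integral_cmult) (auto simp: pair_integral_sum g_def)
  also have "\<dots> = ennreal (real m / 4) * (of_nat m * pair_integral g)"
    by (simp add: pair_integral_rotate)
  also have "\<dots> = ennreal ((real m / 2)\<^sup>2) * pair_integral g"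
    by (simp add: ennreal_of_nat_eq_real_of_nat power2_eq_square flip: mult.assoc ennreal_mult')
  also have "\<dots> = pair_integral (\<lambda>p. (real m / 2)\<^sup>2 * g p)"
    by (subst pair_integral_cmult) auto
  finally show ?thesis by (simp only: g_def power_mult_distrib)
qed

text \<open>An integrated inequality of Wirtinger type, the limit of the preceding lemma for ever
  finer steps. At angle 0 the velocity of the first component is \<open>snd p\<close>, and
  \<open>m / 2\<close> times an increment over the angle \<open>pi / m\<close> tends to
  \<open>pi / 2\<close> times the derivative. The Lipschitz bound dominates the quotients.\<close>

lemma pair_integral_odd_derivative:
  fixes F :: "'a::euclidean_space \<Rightarrow> real"
  assumes F: "\<And>x. F (- x) = - F x"
    and lip: "\<And>x y. \<bar>F x - F y\<bar> \<le> C * norm (x - y)"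
    and deriv: "\<And>x. x \<noteq> 0 \<Longrightarrow> GDERIV F x :> G x"
    and [measurable]: "F \<in> borel_measurable borel" "G \<in> borel_measurable borel"
  shows "pair_integral (\<lambda>p. (F (fst p))\<^sup>2)
    \<le> pair_integral (\<lambda>p. (pi / 2 * (G (fst p) \<bullet> snd p))\<^sup>2)"
proof -
  define t where "t i = pi / real (Suc i)" for i
  define s where "s i p = (real (Suc i) / 2 * (F (fst (pair_rotation (t i) p)) - F (fst p)))\<^sup>2" for i p
  have C: "C \<ge> 0"
  proof -
    obtain b :: 'a where "b \<in> Basis" using nonempty_Basis by blast
    then show ?thesis using lip[of b 0] by (simp add: norm_Basis)
  qed
  have t0: "t \<longlonglongrightarrow> 0"
    unfolding t_def using LIMSEQ_Suc[OF tendsto_divide_0[OF tendsto_const filterlim_real_at_infinity_sequentially]]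
    by simp
  have lim: "(\<lambda>i. s i p) \<longlonglongrightarrow> (pi / 2 * (G (fst p) \<bullet> snd p))\<^sup>2" if p: "fst p \<noteq> 0" for p
  proof -
    have "((\<lambda>u. cos u *\<^sub>R fst p + sin u *\<^sub>R snd p) has_derivative (\<lambda>u. u *\<^sub>R snd p)) (at 0)"
      by (auto intro!: derivative_eq_intros)
    moreover have "(F has_derivative (\<lambda>v. v \<bullet> G (fst p))) (at (cos 0 *\<^sub>R fst p + sin 0 *\<^sub>R snd p))"
      using deriv[OF p] by (simp add: gderiv_def)
    ultimately have *: "((\<lambda>u. F (fst (pair_rotation u p))) has_derivative (\<lambda>u. (u *\<^sub>R snd p) \<bullet> G (fst p))) (at 0)"
      unfolding pair_rotation_def fst_conv by (rule has_derivative_compose)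
    have "((\<lambda>u. F (fst (pair_rotation u p))) has_real_derivative (G (fst p) \<bullet> snd p)) (at 0)"
    proof -
      have "(\<lambda>u. (u *\<^sub>R snd p) \<bullet> G (fst p)) = (*) (G (fst p) \<bullet> snd p)"
        by (auto simp: fun_eq_iff inner_commute)
      then show ?thesis using * by (simp add: has_field_derivative_def)
    qed
    then have "((\<lambda>h. (F (fst (pair_rotation h p)) - F (fst p)) / h) \<longlongrightarrow> G (fst p) \<bullet> snd p) (at 0)"
      by (simp add: DERIV_def pair_rotation_def)
    moreover have "filterlim t (at 0) sequentially"
      using t0 by (auto simp: filterlim_at t_def)
    ultimately have "(\<lambda>i. (F (fst (pair_rotation (t i) p)) - F (fst p)) / t i) \<longlonglongrightarrow> G (fst p) \<bullet> snd p"
      by (rule filterlim_compose)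
    then have "(\<lambda>i. (pi / 2 * ((F (fst (pair_rotation (t i) p)) - F (fst p)) / t i))\<^sup>2)
        \<longlonglongrightarrow> (pi / 2 * (G (fst p) \<bullet> snd p))\<^sup>2"
      by (intro tendsto_intros)
    moreover have "pi / 2 * (D / t i) = real (Suc i) / 2 * D" for D i
      by (simp add: t_def)
    ultimately show ?thesis unfolding s_def by (simp only:)
  qed
  have bound: "s i p \<le> (C * pi)\<^sup>2" if p: "norm p < 1" for i p
  proof -
    have t: "t i \<ge> 0" by (simp add: t_def)
    have n: "norm (fst p) \<le> 1" "norm (snd p) \<le> 1"
      using p norm_fst_le[of "fst p" "snd p"] norm_snd_le[of "snd p" "fst p"] by auto
    have "\<bar>cos (t i) - 1\<bar> = 2 * (\<bar>sin (t i / 2)\<bar> * \<bar>sin (t i / 2)\<bar>)"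
      using cos_double_sin[of "t i / 2"] by (simp add: power2_eq_square)
    also have "\<dots> \<le> 2 * (\<bar>sin (t i / 2)\<bar> * 1)"
      by (intro mult_left_mono) auto
    also have "\<dots> \<le> t i"
      using abs_sin_x_le_abs_x[of "t i / 2"] t by simp
    finally have c: "\<bar>cos (t i) - 1\<bar> \<le> t i" .
    have s: "\<bar>sin (t i)\<bar> \<le> t i" using abs_sin_x_le_abs_x[of "t i"] t by simp
    have "fst (pair_rotation (t i) p) - fst p = (cos (t i) - 1) *\<^sub>R fst p + sin (t i) *\<^sub>R snd p"
      by (simp add: pair_rotation_def algebra_simps)
    also have "norm \<dots> \<le> \<bar>cos (t i) - 1\<bar> * norm (fst p) + \<bar>sin (t i)\<bar> * norm (snd p)"
      by (metis norm_triangle_ineq norm_scaleR)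
    also have "\<dots> \<le> t i * 1 + t i * 1"
      using n t c s by (intro add_mono mult_mono) auto
    finally have "norm (fst (pair_rotation (t i) p) - fst p) \<le> t i * 1 + t i * 1" .
    then have "\<bar>F (fst (pair_rotation (t i) p)) - F (fst p)\<bar> \<le> C * (2 * t i)"
      by (intro order_trans[OF lip] mult_left_mono C) simp
    then have "real (Suc i) / 2 * \<bar>F (fst (pair_rotation (t i) p)) - F (fst p)\<bar> \<le> real (Suc i) / 2 * (C * (2 * t i))"
      by (intro mult_left_mono) auto
    also have "\<dots> = C * pi" by (simp add: t_def)
    finally have "\<bar>real (Suc i) / 2 * (F (fst (pair_rotation (t i) p)) - F (fst p))\<bar> \<le> C * pi"
      by (simp add: abs_mult)
    then show ?thesis
      unfolding s_def using power_mono[of _ "C * pi" 2] by (metis abs_ge_zero power2_abs)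
  qed
  have "(\<lambda>i. pair_integral (s i)) \<longlonglongrightarrow> pair_integral (\<lambda>p. (pi / 2 * (G (fst p) \<bullet> snd p))\<^sup>2)"
    unfolding pair_integral_def
  proof (rule nn_integral_dominated_convergence[where w="\<lambda>p. ennreal ((C * pi)\<^sup>2) * indicator (ball 0 1) p"])
    show "AE p in lborel. indicator (ball 0 1) p * ennreal (s i p) \<le> ennreal ((C * pi)\<^sup>2) * indicator (ball 0 1) p" for i
      using bound by (intro AE_I2) (auto simp: indicator_def intro: ennreal_leI)
    show "AE p in lborel. (\<lambda>i. indicator (ball 0 1) p * ennreal (s i p))
        \<longlonglongrightarrow> indicator (ball 0 1) p * ennreal ((pi / 2 * (G (fst p) \<bullet> snd p))\<^sup>2)"
      using AE_lborel_fst_neq_0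
    proof eventually_elim
      case (elim p)
      have "(\<lambda>i. ennreal (s i p)) \<longlonglongrightarrow> ennreal ((pi / 2 * (G (fst p) \<bullet> snd p))\<^sup>2)"
        by (intro tendsto_ennrealI lim elim)
      then show ?case
        by (cases "p \<in> ball 0 1") (simp_all only: indicator_eq_1_iff[THEN iffD2] indicator_eq_0_iff[THEN iffD2] mult_1 mult_zero_left
              tendsto_const not_False_eq_True)
    qed
    show "(\<integral>\<^sup>+p. ennreal ((C * pi)\<^sup>2) * indicator (ball 0 1) (p::'a\<times>'a) \<partial>lborel) < \<infinity>"
      by (subst nn_integral_cmult) (auto simp: emeasure_ball ennreal_mult_less_top)
  qed (unfold s_def, measurable)
  moreover have "pair_integral (\<lambda>p. (F (fst p))\<^sup>2) \<le> pair_integral (s i)" for i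
    unfolding s_def t_def by (intro pair_integral_odd_increment F) auto
  ultimately show ?thesis
    by (intro LIMSEQ_le_const) auto
qed

text \<open>This is where the factor \<open>1 / DIM('a)\<close> is gained: given the position, the
  velocity has a rotation-invariant law, so its component along the fixed vector \<open>G x\<close>
  carries only one share of its second moment.\<close>

lemma pair_integral_inner_le:
  fixes G :: "'a::euclidean_space \<Rightarrow> 'a"
  assumes [measurable]: "G \<in> borel_measurable borel" and G: "\<And>x. x \<noteq> 0 \<Longrightarrow> (norm (G x))\<^sup>2 \<le> c" and c: "c \<ge> 0"
  shows "of_nat DIM('a) * pair_integral (\<lambda>p. (G (fst p) \<bullet> snd p)\<^sup>2)
    \<le> ennreal c * pair_integral (\<lambda>p. (norm (snd p :: 'a))\<^sup>2)"
proof -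
  let ?R = "\<lambda>(x::'a) r. indicator {..<1} ((norm x)\<^sup>2 + r\<^sup>2) :: ennreal"
  have AE0: "AE x::'a in lborel. x \<noteq> 0" by (rule AE_lborel_singleton)
  have "of_nat DIM('a) * pair_integral (\<lambda>p. (G (fst p) \<bullet> snd p)\<^sup>2)
      = (\<integral>\<^sup>+x. of_nat DIM('a) * (\<integral>\<^sup>+y. ?R x (norm y) * ennreal ((G x \<bullet> y)\<^sup>2) \<partial>lborel) \<partial>lborel)"
    by (subst pair_integral_iterated(1)) (auto simp: nn_integral_cmult)
  also have "\<dots> = (\<integral>\<^sup>+x. ennreal ((norm (G x))\<^sup>2) * (\<integral>\<^sup>+y. ?R x (norm y) * ennreal ((norm (y::'a))\<^sup>2) \<partial>lborel) \<partial>lborel)"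
    by (intro nn_integral_cong nn_integral_radial_inner_square) measurable
  also have "\<dots> \<le> (\<integral>\<^sup>+x. ennreal c * (\<integral>\<^sup>+y. ?R x (norm y) * ennreal ((norm (y::'a))\<^sup>2) \<partial>lborel) \<partial>lborel)"
    using AE0 by (intro nn_integral_mono_AE, eventually_elim) (intro mult_right_mono ennreal_leI G, auto)
  also have "\<dots> = ennreal c * pair_integral (\<lambda>p. (norm (snd p :: 'a))\<^sup>2)"
    by (subst pair_integral_iterated(1)) (auto simp: nn_integral_cmult)
  finally show ?thesis .
qed

lemma pair_integral_homogeneous:
  fixes h :: "'a::euclidean_space \<Rightarrow> real"
  assumes [measurable]: "h \<in> borel_measurable borel"
    and fin: "(\<integral>\<^sup>+x. ennreal ((h x)\<^sup>2) \<partial>uniform_sphere) < \<infinity>"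
  shows "pair_integral (\<lambda>p. (homogeneous_ext h (fst p))\<^sup>2)
    = (\<integral>\<^sup>+x. ennreal ((h x)\<^sup>2) \<partial>uniform_sphere) * pair_integral (\<lambda>p. (norm (fst p :: 'a))\<^sup>2)"
proof -
  let ?R = "\<lambda>(y::'a) r. indicator {..<1} (r\<^sup>2 + (norm y)\<^sup>2) :: ennreal"
  let ?E = "\<integral>\<^sup>+x. ennreal ((h x)\<^sup>2) \<partial>uniform_sphere"
  \<comment> \<open>The constraint on the pair already forces \<open>norm x < 1\<close>; the extra
    indicator only brings the integrand into the form required by
    \<open>nn_integral_radial_sgn\<close>.\<close>
  have R: "?R y (norm x) = indicator (ball 0 1) x * ?R y (norm x)" for x y :: 'a
  proof -
    have "norm x < 1" if "(norm x)\<^sup>2 + (norm y)\<^sup>2 < 1"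
    proof -
      have "(norm x)\<^sup>2 < 1\<^sup>2"
        using le_less_trans[OF _ that, of "(norm x)\<^sup>2"] by simp
      then show ?thesis by (rule power2_less_imp_less) simp
    qed
    then show ?thesis by (auto simp: indicator_def)
  qed
  have eq: "?R y (norm x) * ennreal ((norm x * h (sgn x))\<^sup>2)
      = indicator (ball 0 1) x * (?R y (norm x) * ennreal ((norm x)\<^sup>2)) * ennreal ((h (sgn x))\<^sup>2)"
    for x y :: 'a
    by (subst R) (simp add: power_mult_distrib ennreal_mult mult.assoc)
  have "pair_integral (\<lambda>p. (homogeneous_ext h (fst p))\<^sup>2)
      = (\<integral>\<^sup>+y. \<integral>\<^sup>+x. indicator (ball 0 1) x * (?R y (norm x) * ennreal ((norm x)\<^sup>2))
            * ennreal ((h (sgn x))\<^sup>2) \<partial>lborel \<partial>lborel)"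
    unfolding homogeneous_ext_def
    by (subst pair_integral_iterated(2)) (simp_all only: eq fst_conv, measurable)
  also have "\<dots> = (\<integral>\<^sup>+y. ?E * (\<integral>\<^sup>+(x::'a). indicator (ball 0 1) x * (?R y (norm x) * ennreal ((norm x)\<^sup>2)) \<partial>lborel) \<partial>lborel)"
    by (intro nn_integral_cong nn_integral_radial_sgn[where G="\<lambda>x. ennreal ((h x)\<^sup>2)"
          and \<rho>="\<lambda>r. ?R y r * ennreal (r\<^sup>2)" for y] fin) measurable
  also have "\<dots> = ?E * (\<integral>\<^sup>+y. \<integral>\<^sup>+(x::'a). ?R y (norm x) * ennreal ((norm x)\<^sup>2) \<partial>lborel \<partial>lborel)"
    by (subst nn_integral_cmult) (simp_all add: mult.assoc[symmetric] R[symmetric])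
  also have "(\<integral>\<^sup>+y. \<integral>\<^sup>+(x::'a). ?R y (norm x) * ennreal ((norm x)\<^sup>2) \<partial>lborel \<partial>lborel)
      = pair_integral (\<lambda>p. (norm (fst p :: 'a))\<^sup>2)"
    by (subst pair_integral_iterated(2)) auto
  finally show ?thesis .
qed

lemma pair_integral_norm_square:
  "pair_integral (\<lambda>p. (norm (fst p :: 'a::euclidean_space))\<^sup>2) \<noteq> 0" (is ?nonzero)
  "pair_integral (\<lambda>p. (norm (fst p :: 'a::euclidean_space))\<^sup>2) \<noteq> \<infinity>" (is ?finite)
  "pair_integral (\<lambda>p. (norm (snd p :: 'a::euclidean_space))\<^sup>2)
    = pair_integral (\<lambda>p. (norm (fst p :: 'a))\<^sup>2)" (is ?swap)
proof -
  \<comment> \<open>A quarter turn puts \<open>snd p\<close> into the first component.\<close>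
  show ?swap
    using pair_integral_rotate[of "\<lambda>p. (norm (fst p :: 'a))\<^sup>2" "pi / 2"]
    by (simp add: pair_rotation_def)
  have "pair_integral (\<lambda>p. (norm (fst p :: 'a))\<^sup>2) \<le> (\<integral>\<^sup>+p. indicator (ball (0::'a\<times>'a) 1) p \<partial>lborel)"
    unfolding pair_integral_def
  proof (rule nn_integral_mono)
    fix p :: "'a \<times> 'a"
    have "(norm (fst p))\<^sup>2 \<le> 1\<^sup>2" if "norm p < 1"
      using that norm_fst_le[of "fst p" "snd p"] by (intro power_mono) auto
    then have "ennreal ((norm (fst p))\<^sup>2) \<le> 1" if "norm p < 1"
      using that by (metis ennreal_1 ennreal_leI power_one)
    then show "indicator (ball 0 1) p * ennreal ((norm (fst p))\<^sup>2) \<le> indicator (ball 0 1) p"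
      by (auto simp: indicator_def)
  qed
  also have "\<dots> < \<infinity>" by (simp add: emeasure_ball)
  finally show ?finite by simp
  show ?nonzero
  proof
    assume "pair_integral (\<lambda>p. (norm (fst p :: 'a))\<^sup>2) = 0"
    then have "AE p::'a\<times>'a in lborel. indicator (ball 0 1) p * ennreal ((norm (fst p))\<^sup>2) = 0"
      unfolding pair_integral_def by (subst (asm) nn_integral_0_iff_AE) auto
    then have "AE p::'a\<times>'a in lborel. p \<notin> ball 0 1"
      using AE_lborel_fst_neq_0 by eventually_elim (auto simp: indicator_def split: if_splits)
    then have "emeasure lborel (ball (0::'a\<times>'a) 1) = 0"
      by (subst (asm) AE_iff_measurable[of "ball 0 1"]) auto
    then show False using emeasure_unit_ball_neq_0 by blast
  qed
qed

text \<open>A Poincare inequality for odd functions. The factor \<open>pi\<^sup>2 / 2\<close> is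
  \<open>(pi / 2)\<^sup>2\<close> from the rotation path times 2 from the gradient of the
  homogeneous extension. The second moment \<open>?J\<close> of one component occurs on both sides
  and cancels.\<close>

lemma sphere_odd_second_moment:
  fixes h :: "'a::euclidean_space \<Rightarrow> real"
  assumes [measurable]: "h \<in> borel_measurable borel" "h' \<in> borel_measurable borel"
    and odd: "\<And>x. h (- x) = - h x"
    and lip: "\<And>x y. norm x = 1 \<Longrightarrow> norm y = 1 \<Longrightarrow> \<bar>h x - h y\<bar> \<le> K * norm (x - y)"
    and deriv: "\<And>x. norm x = 1 \<Longrightarrow> GDERIV h x :> h' x"
    and grad: "\<And>x. norm x = 1 \<Longrightarrow> norm (h' x) \<le> K"
  shows "(\<integral>x. (h x)\<^sup>2 \<partial>uniform_sphere) \<le> pi\<^sup>2 / 2 * K\<^sup>2 / real DIM('a)"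
proof -
  interpret U: prob_space "uniform_sphere :: 'a measure" by (rule prob_space_uniform_sphere)
  have K: "K \<ge> 0"
  proof -
    obtain b :: 'a where "b \<in> Basis" using nonempty_Basis by blast
    then show ?thesis using grad[of b] norm_ge_zero[of "h' b"] by (simp add: norm_Basis del: norm_ge_zero)
  qed
  \<comment> \<open>Oddness turns the Lipschitz bound into a bound on values: antipodal points have
    distance 2 and opposite values.\<close>
  have bd: "\<bar>h x\<bar> \<le> K" if "norm x = 1" for x
    using lip[of x "- x"] that by (simp add: odd abs_mult flip: mult_2 scaleR_2)
  define F where "F = homogeneous_ext h"
  define G where "G x = h (sgn x) *\<^sub>R sgn x + (h' (sgn x) - (h' (sgn x) \<bullet> sgn x) *\<^sub>R sgn x)" for x
  have [measurable]: "F \<in> borel_measurable borel" "G \<in> borel_measurable borel"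
    unfolding F_def G_def homogeneous_ext_def by measurable
  have AE_h: "AE x in uniform_sphere. norm ((h x)\<^sup>2) \<le> K\<^sup>2"
    using AE_uniform_sphere
    by eventually_elim (use bd K in \<open>simp add: abs_le_square_iff[symmetric]\<close>)
  have int: "integrable uniform_sphere (\<lambda>x. (h x)\<^sup>2)"
    by (rule U.integrable_const_bound[OF AE_h]) simp
  then have E: "(\<integral>\<^sup>+x. ennreal ((h x)\<^sup>2) \<partial>uniform_sphere) = ennreal (\<integral>x. (h x)\<^sup>2 \<partial>uniform_sphere)"
    by (intro nn_integral_eq_integral) auto
  let ?J = "pair_integral (\<lambda>p. (norm (fst p :: 'a))\<^sup>2)"
  obtain j where j: "?J = ennreal j" "j > 0"
    using pair_integral_norm_square(1,2)[where 'a='a]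
    by (cases ?J) (auto simp: less_le)
  have "of_nat DIM('a) * (ennreal (\<integral>x. (h x)\<^sup>2 \<partial>uniform_sphere) * ?J)
      = of_nat DIM('a) * pair_integral (\<lambda>p. (F (fst p))\<^sup>2)"
    unfolding F_def by (subst pair_integral_homogeneous) (simp_all add: E)
  also have "pair_integral (\<lambda>p. (F (fst p))\<^sup>2)
      \<le> pair_integral (\<lambda>p. (pi / 2 * (G (fst p) \<bullet> snd p))\<^sup>2)"
  proof (rule pair_integral_odd_derivative)
    show "F (- x) = - F x" for x
      by (simp add: F_def homogeneous_ext_def odd sgn_minus)
    show "\<bar>F x - F y\<bar> \<le> 3 * K * norm (x - y)" for x y
      unfolding F_def by (rule homogeneous_ext_lipschitz[OF lip bd K])
    show "GDERIV F x :> G x" if "x \<noteq> 0" for x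
      unfolding F_def G_def using that by (intro homogeneous_ext_gderiv deriv) (auto simp: norm_sgn)
  qed simp_all
  also have "pair_integral (\<lambda>p. (pi / 2 * (G (fst p) \<bullet> snd p))\<^sup>2)
      = ennreal ((pi / 2)\<^sup>2) * pair_integral (\<lambda>p. (G (fst p) \<bullet> snd p)\<^sup>2)"
    by (subst pair_integral_cmult[symmetric]) (simp_all only: power_mult_distrib, auto)
  also have "of_nat DIM('a) * (ennreal ((pi / 2)\<^sup>2) * pair_integral (\<lambda>p. (G (fst p) \<bullet> snd p)\<^sup>2))
      = ennreal ((pi / 2)\<^sup>2) * (of_nat DIM('a) * pair_integral (\<lambda>p. (G (fst p) \<bullet> snd p)\<^sup>2))"
    by (simp add: mult_ac)
  also have "of_nat DIM('a) * pair_integral (\<lambda>p. (G (fst p) \<bullet> snd p)\<^sup>2)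
      \<le> ennreal (2 * K\<^sup>2) * pair_integral (\<lambda>p. (norm (snd p :: 'a))\<^sup>2)"
    unfolding G_def
    by (intro pair_integral_inner_le norm_homogeneous_ext_gderiv bd grad)
      (auto simp: norm_sgn)
  finally have "of_nat DIM('a) * (ennreal (\<integral>x. (h x)\<^sup>2 \<partial>uniform_sphere) * ?J)
      \<le> ennreal ((pi / 2)\<^sup>2) * (ennreal (2 * K\<^sup>2) * ?J)"
    by (simp add: pair_integral_norm_square(3) mult_left_mono)
  then have "real DIM('a) * ((\<integral>x. (h x)\<^sup>2 \<partial>uniform_sphere) * j) \<le> (pi / 2)\<^sup>2 * (2 * K\<^sup>2 * j)"
    using j by (simp add: ennreal_of_nat_eq_real_of_nat flip: ennreal_mult')
  then have "real DIM('a) * (\<integral>x. (h x)\<^sup>2 \<partial>uniform_sphere) * j \<le> (pi\<^sup>2 / 2 * K\<^sup>2) * j"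
    by (simp add: power2_eq_square algebra_simps)
  then have "real DIM('a) * (\<integral>x. (h x)\<^sup>2 \<partial>uniform_sphere) \<le> pi\<^sup>2 / 2 * K\<^sup>2"
    using j by simp
  then show ?thesis by (simp add: field_simps)
qed

section \<open>The divergence theorem on the unit ball\<close>

lemma integral_lborel_translate:
  fixes f :: "'a::euclidean_space \<Rightarrow> real"
  assumes [measurable]: "f \<in> borel_measurable borel"
  shows "(\<integral>x. f (x + a) \<partial>lborel) = (\<integral>x. f x \<partial>lborel)"
proof -
  have "(\<integral>x. f x \<partial>lborel) = (\<integral>x. f x \<partial>(distr lborel borel ((+) a)))"
    by (simp only: lborel_distr_plus)
  also have "\<dots> = (\<integral>x. f (a + x) \<partial>lborel)"
    by (subst integral_distr) auto
  finally show ?thesis by (simp add: add.commute)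
qed

lemma integral_ball_sgn:
  fixes g :: "'a::euclidean_space \<Rightarrow> real"
  assumes [measurable]: "g \<in> borel_measurable borel" and r: "r > 0"
  shows "(\<integral>x. indicator (ball 0 r) x * g (sgn x) \<partial>lborel)
      = r ^ DIM('a) * (\<integral>x. indicator (ball 0 1) x * g (sgn x) \<partial>lborel)"
proof -
  have "(lborel::'a measure) = density (distr lborel borel (\<lambda>x. 0 + r *\<^sub>R x)) (\<lambda>_. ennreal (\<bar>r\<bar>^DIM('a)))"
    using r by (intro lborel_affine) auto
  then have "(\<integral>x. indicator (ball 0 r) x * g (sgn x) \<partial>lborel)
      = (\<integral>x. indicator (ball 0 r) x * g (sgn x)
          \<partial>density (distr lborel borel (\<lambda>x. 0 + r *\<^sub>R x)) (\<lambda>_. ennreal (\<bar>r\<bar>^DIM('a))))"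
    by simp
  also have "\<dots> = r ^ DIM('a) * (\<integral>x. indicator (ball 0 r) (r *\<^sub>R x) * g (sgn (r *\<^sub>R x)) \<partial>lborel)"
    using r by (subst integral_density, simp_all) (subst integral_distr, simp_all)
  also have "(\<lambda>x::'a. indicator (ball 0 r) (r *\<^sub>R x) * g (sgn (r *\<^sub>R x))) = (\<lambda>x. indicator (ball 0 1) x * g (sgn x))"
    using r by (auto simp: fun_eq_iff indicator_def sgn_scaleR)
  finally show ?thesis .
qed

lemma integrable_on_ball:
  fixes f :: "'a::euclidean_space \<Rightarrow> real"
  assumes [measurable]: "f \<in> borel_measurable borel" and bd: "\<And>x. norm x < 1 \<Longrightarrow> \<bar>f x\<bar> \<le> b"
  shows "integrable lborel (\<lambda>x. indicator (ball 0 1) x * f x)"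
proof (rule Bochner_Integration.integrable_bound[where f="\<lambda>x. indicator (ball 0 1) x * b"])
  show "integrable lborel (\<lambda>x. indicator (ball 0 1) (x::'a) * b)"
    by (intro integrable_mult_left integrable_real_indicator) (auto simp: emeasure_ball)
  show "(\<lambda>x. indicator (ball 0 1) x * f x) \<in> borel_measurable lborel"
    by (intro borel_measurable_times borel_measurable_indicator) auto
  show "AE x in lborel. norm (indicator (ball 0 1) x * f x) \<le> norm (indicator (ball 0 1) x * b)"
  proof (rule AE_I2)
    fix x :: 'a
    have "\<bar>f x\<bar> \<le> \<bar>b\<bar>" if "norm x < 1" using bd[OF that] by linarith
    then show "norm (indicator (ball 0 1) x * f x) \<le> norm (indicator (ball 0 1) x * b)"
      by (auto simp: indicator_def)
  qed
qed

section \<open>Integration by parts with a radial cutoff\<close>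

lemma abs_sgn_inner_le: "\<bar>sgn x \<bullet> v\<bar> \<le> norm v" for x v :: "'a::real_inner"
  by (rule order_trans[OF Cauchy_Schwarz_ineq2]) (simp add: norm_sgn)

text \<open>For \<open>0 < \<epsilon> < 1\<close> it equals 1 up to radius
  \<open>1 - \<epsilon>\<close> and falls linearly to 0 at the unit sphere. Multiplication by it
  yields a compactly supported Lipschitz function, so no boundary term arises; the boundary
  reappears through the slope \<open>1 / \<epsilon>\<close> in the shell.\<close>

definition radial_cutoff :: "real \<Rightarrow> 'a::real_normed_vector \<Rightarrow> real" where
  "radial_cutoff \<epsilon> x = max 0 (min 1 ((1 - norm x) / \<epsilon>))"

lemma radial_cutoff_lipschitz:
  assumes "\<epsilon> > 0"
  shows "\<bar>radial_cutoff \<epsilon> x - radial_cutoff \<epsilon> y\<bar> \<le> norm (x - y) / \<epsilon>"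
proof -
  have "\<bar>radial_cutoff \<epsilon> x - radial_cutoff \<epsilon> y\<bar> \<le> \<bar>(1 - norm x) / \<epsilon> - (1 - norm y) / \<epsilon>\<bar>"
    unfolding radial_cutoff_def by linarith
  also have "\<dots> = \<bar>norm y - norm x\<bar> / \<epsilon>"
    using assms by (simp flip: diff_divide_distrib)
  also have "\<dots> \<le> norm (x - y) / \<epsilon>"
    using assms norm_triangle_ineq3[of y x] by (intro divide_right_mono) (auto simp: norm_minus_commute)
  finally show ?thesis .
qed

lemma radial_cutoff_bounds: "0 \<le> radial_cutoff \<epsilon> x" "radial_cutoff \<epsilon> x \<le> 1"
  by (auto simp: radial_cutoff_def)

lemma radial_cutoff_outside: "\<epsilon> > 0 \<Longrightarrow> norm x \<ge> 1 \<Longrightarrow> radial_cutoff \<epsilon> x = 0"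
  by (auto simp: radial_cutoff_def field_simps max_def min_def)

lemma radial_cutoff_measurable [measurable]:
  "radial_cutoff \<epsilon> \<in> borel_measurable (borel :: 'a::euclidean_space measure)"
  unfolding radial_cutoff_def[abs_def] by measurable

text \<open>Smoothness is required on the closed ball, measurability everywhere: the intended
  \<open>\<psi>\<close> is a difference of shifted functions that are extended by 0 outside an open
  set.\<close>

locale smooth_on_unit_ball =
  fixes \<psi> :: "'a::euclidean_space \<Rightarrow> real" and \<psi>' :: "'a \<Rightarrow> 'a" and K :: real
  assumes meas [measurable]: "\<psi> \<in> borel_measurable borel" "\<psi>' \<in> borel_measurable borel"
    and deriv: "norm x \<le> 1 \<Longrightarrow> GDERIV \<psi> x :> \<psi>' x"
    and grad: "norm x \<le> 1 \<Longrightarrow> norm (\<psi>' x) \<le> K"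
begin

lemma K_nonneg: "K \<ge> 0"
  using grad[of 0] norm_ge_zero[of "\<psi>' 0"] by (simp del: norm_ge_zero)

lemma lipschitz: "norm x \<le> 1 \<Longrightarrow> norm y \<le> 1 \<Longrightarrow> \<bar>\<psi> x - \<psi> y\<bar> \<le> K * norm (x - y)"
proof -
  assume xy: "norm x \<le> 1" "norm y \<le> 1"
  have "norm (\<psi> x - \<psi> y) \<le> K * norm (x - y)"
  proof (rule differentiable_bound[of "cball 0 1" _ "\<lambda>x v. v \<bullet> \<psi>' x"])
    show "(\<psi> has_derivative (\<lambda>v. v \<bullet> \<psi>' u)) (at u within cball 0 1)" if "u \<in> cball 0 1" for u
      using deriv[of u] that by (auto simp: gderiv_def intro: has_derivative_at_withinI)
    show "onorm (\<lambda>v. v \<bullet> \<psi>' u) \<le> K" if "u \<in> cball 0 1" for u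
    proof (rule onorm_le)
      fix v
      have "norm (v \<bullet> \<psi>' u) \<le> norm v * norm (\<psi>' u)" by (simp add: Cauchy_Schwarz_ineq2)
      also have "\<dots> \<le> norm v * K" using that by (intro mult_left_mono grad) auto
      finally show "norm (v \<bullet> \<psi>' u) \<le> K * norm v" by (simp add: mult.commute)
    qed
  qed (use xy in auto)
  then show ?thesis by simp
qed

definition bnd :: real where "bnd = \<bar>\<psi> 0\<bar> + K"

lemma bounded: "norm x \<le> 1 \<Longrightarrow> \<bar>\<psi> x\<bar> \<le> bnd"
  using lipschitz[of x 0] mult_left_mono[OF _ K_nonneg, of "norm x" 1] by (simp add: bnd_def)

lemma bnd_nonneg: "bnd \<ge> 0"
  using K_nonneg by (simp add: bnd_def)

text \<open>Outside the ball nothing is known about the size of \<open>\<psi>\<close>, but the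
  cutoff vanishes there. If at least one point lies in the ball, the product rule is arranged so
  that \<open>\<psi>\<close> is evaluated inside only.\<close>

lemma cutoff_lipschitz:
  assumes e: "\<epsilon> > 0"
  shows "\<bar>radial_cutoff \<epsilon> x * \<psi> x - radial_cutoff \<epsilon> y * \<psi> y\<bar> \<le> (K + bnd / \<epsilon>) * norm (x - y)"
proof -
  have one: "\<bar>radial_cutoff \<epsilon> x * \<psi> x - radial_cutoff \<epsilon> y * \<psi> y\<bar> \<le> (K + bnd / \<epsilon>) * norm (x - y)"
    if x: "norm x \<le> 1" for x y
  proof -
    have c: "\<bar>radial_cutoff \<epsilon> x - radial_cutoff \<epsilon> y\<bar> * b \<le> norm (x - y) / \<epsilon> * bnd"
      if "0 \<le> b" "b \<le> bnd" for b
      using that radial_cutoff_lipschitz[OF e, of x y] by (intro mult_mono) auto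
    show ?thesis
    proof (cases "norm y \<le> 1")
      case True
      have "radial_cutoff \<epsilon> x * \<psi> x - radial_cutoff \<epsilon> y * \<psi> y
          = radial_cutoff \<epsilon> y * (\<psi> x - \<psi> y) + (radial_cutoff \<epsilon> x - radial_cutoff \<epsilon> y) * \<psi> x"
        by (simp add: algebra_simps)
      also have "\<bar>\<dots>\<bar> \<le> radial_cutoff \<epsilon> y * \<bar>\<psi> x - \<psi> y\<bar> + \<bar>radial_cutoff \<epsilon> x - radial_cutoff \<epsilon> y\<bar> * \<bar>\<psi> x\<bar>"
        by (rule order_trans[OF abs_triangle_ineq]) (simp add: abs_mult radial_cutoff_bounds)
      also have "\<dots> \<le> 1 * (K * norm (x - y)) + norm (x - y) / \<epsilon> * bnd"
        using x True K_nonneg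
        by (intro add_mono mult_mono c lipschitz bounded) (auto simp: radial_cutoff_bounds)
      finally show ?thesis by (simp add: algebra_simps)
    next
      case False
      have "\<bar>radial_cutoff \<epsilon> x * \<psi> x - radial_cutoff \<epsilon> y * \<psi> y\<bar> = \<bar>radial_cutoff \<epsilon> x - radial_cutoff \<epsilon> y\<bar> * \<bar>\<psi> x\<bar>"
        using False by (simp add: radial_cutoff_outside[OF e] abs_mult)
      also have "\<dots> \<le> norm (x - y) / \<epsilon> * bnd" using x by (intro c bounded) auto
      also have "\<dots> \<le> K * norm (x - y) + norm (x - y) / \<epsilon> * bnd" using K_nonneg by simp
      finally show ?thesis by (simp add: algebra_simps)
    qed
  qed
  show ?thesis
  proof (cases "norm x \<le> 1 \<or> norm y \<le> 1")
    case True
    then show ?thesis using one[of x y] one[of y x] by (auto simp: abs_minus_commute norm_minus_commute)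
  next
    case False
    then show ?thesis
      using K_nonneg bnd_nonneg e by (simp add: radial_cutoff_outside[OF e])
  qed
qed

text \<open>The second term lives on the shell, where the cutoff has gradient
  \<open>- sgn x / \<epsilon>\<close>. The excluded points, two spheres and the origin, form a null
  set.\<close>

lemma cutoff_deriv:
  assumes e: "0 < \<epsilon>" "\<epsilon> < 1" and x: "norm x \<noteq> 1" "norm x \<noteq> 1 - \<epsilon>" "x \<noteq> 0"
  shows "((\<lambda>x. radial_cutoff \<epsilon> x * \<psi> x) has_derivative
    (\<lambda>v. indicator (ball 0 1) x * (radial_cutoff \<epsilon> x * (\<psi>' x \<bullet> v))
       - indicator (ball 0 1 - ball 0 (1 - \<epsilon>)) x * ((sgn x \<bullet> v) * \<psi> x) / \<epsilon>)) (at x)"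
proof -
  consider "norm x < 1 - \<epsilon>" | "1 - \<epsilon> < norm x" "norm x < 1" | "1 < norm x" using x by linarith
  then show ?thesis
  proof cases
    case 1
    have "(\<psi> has_derivative (\<lambda>v. v \<bullet> \<psi>' x)) (at x)"
      using deriv[of x] 1 e by (simp add: gderiv_def)
    then have "((\<lambda>x. radial_cutoff \<epsilon> x * \<psi> x) has_derivative (\<lambda>v. v \<bullet> \<psi>' x)) (at x)"
      by (rule has_derivative_transform_within_open[of _ _ _ _ "ball 0 (1 - \<epsilon>)"])
        (use 1 e in \<open>auto simp: radial_cutoff_def field_simps min_def max_def\<close>)
    moreover have "radial_cutoff \<epsilon> x = 1"
      using 1 e by (auto simp: radial_cutoff_def field_simps min_def max_def)
    ultimately show ?thesis using 1 e by (simp add: inner_commute)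
  next
    case 2
    have "(\<psi> has_derivative (\<lambda>v. v \<bullet> \<psi>' x)) (at x)"
      using deriv[of x] 2 by (simp add: gderiv_def)
    then have "((\<lambda>x. (1 - norm x) / \<epsilon> * \<psi> x) has_derivative
        (\<lambda>v. (1 - norm x) / \<epsilon> * (v \<bullet> \<psi>' x) + (0 - v \<bullet> sgn x) / \<epsilon> * \<psi> x)) (at x)"
      by (intro has_derivative_mult bounded_linear.has_derivative[OF bounded_linear_divide]
          has_derivative_diff has_derivative_const has_derivative_norm x)
    then have "((\<lambda>x. radial_cutoff \<epsilon> x * \<psi> x) has_derivative
        (\<lambda>v. (1 - norm x) / \<epsilon> * (v \<bullet> \<psi>' x) + (0 - v \<bullet> sgn x) / \<epsilon> * \<psi> x)) (at x)"
      by (rule has_derivative_transform_within_open[of _ _ _ _ "ball 0 1 - cball 0 (1 - \<epsilon>)"])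
        (use 2 e in \<open>auto simp: radial_cutoff_def field_simps min_def max_def\<close>)
    moreover have "radial_cutoff \<epsilon> x = (1 - norm x) / \<epsilon>"
      using 2 e by (auto simp: radial_cutoff_def field_simps min_def max_def)
    ultimately show ?thesis using 2 e by (simp add: inner_commute)
  next
    case 3
    have "((\<lambda>x. 0) has_derivative (\<lambda>v::'a. 0::real)) (at x)" by simp
    then have "((\<lambda>x. radial_cutoff \<epsilon> x * \<psi> x) has_derivative (\<lambda>v. 0)) (at x)"
      by (rule has_derivative_transform_within_open[of _ _ _ _ "- cball 0 1"])
        (use 3 e in \<open>auto simp: radial_cutoff_outside\<close>)
    then show ?thesis using 3 by simp
  qed
qed

lemma shell_integrable:
  assumes [measurable]: "j \<in> borel_measurable borel" and j: "\<And>x. norm x < 1 \<Longrightarrow> norm (j x) \<le> 1"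
  shows "integrable lborel (\<lambda>x. indicator (ball 0 1 - ball 0 r) x * ((sgn x \<bullet> v) * \<psi> (j x)))"
proof -
  have "integrable lborel (\<lambda>x. indicator (ball 0 1) x * (indicator (- ball 0 r) x * ((sgn x \<bullet> v) * \<psi> (j x))))"
  proof (rule integrable_on_ball)
    have "\<bar>(sgn x \<bullet> v) * \<psi> (j x)\<bar> \<le> norm v * bnd" if "norm x < 1" for x
      unfolding abs_mult using that by (intro mult_mono abs_sgn_inner_le bounded j) auto
    then show "\<bar>indicator (- ball 0 r) x * ((sgn x \<bullet> v) * \<psi> (j x))\<bar> \<le> norm v * bnd"
      if "norm x < 1" for x
      using that bnd_nonneg by (auto simp: indicator_def)
  qed measurable
  also have "(\<lambda>x. indicator (ball 0 1) x * (indicator (- ball 0 r) x * ((sgn x \<bullet> v) * \<psi> (j x))))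
      = (\<lambda>x. indicator (ball 0 1 - ball 0 r) x * ((sgn x \<bullet> v) * \<psi> (j x)))"
    by (auto simp: fun_eq_iff indicator_def)
  finally show ?thesis .
qed

text \<open>By translation invariance every difference quotient of the cut-off function integrates
  to 0. The step tends to 0 under a common bound, so the directional derivative integrates to 0 as
  well, and its two terms balance.\<close>

lemma cutoff_integral_eq_shell_integral:
  assumes e: "0 < \<epsilon>" "\<epsilon> < 1"
  shows "(\<integral>x. indicator (ball 0 1) x * (radial_cutoff \<epsilon> x * (\<psi>' x \<bullet> v)) \<partial>lborel)
    = (\<integral>x. indicator (ball 0 1 - ball 0 (1 - \<epsilon>)) x * ((sgn x \<bullet> v) * \<psi> x) \<partial>lborel) / \<epsilon>"
proof -
  define f where "f x = radial_cutoff \<epsilon> x * \<psi> x" for x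
  have [measurable]: "f \<in> borel_measurable borel" unfolding f_def by measurable
  have f0: "f x = 0" if "norm x \<ge> 1" for x
    using that e by (simp add: f_def radial_cutoff_outside)
  have fb: "\<bar>f x\<bar> \<le> bnd" if "norm x < 1" for x
  proof -
    have "\<bar>f x\<bar> \<le> 1 * bnd"
      unfolding f_def abs_mult using that by (intro mult_mono bounded) (auto simp: radial_cutoff_bounds)
    then show ?thesis by simp
  qed
  have f_int: "integrable lborel f"
  proof -
    have "integrable lborel (\<lambda>x. indicator (ball 0 1) x * f x)"
      by (rule integrable_on_ball[OF _ fb]) simp_all
    also have "(\<lambda>x. indicator (ball 0 1) x * f x) = f"
      by (auto simp: fun_eq_iff indicator_def f0)
    finally show ?thesis .
  qed
  define t where "t i = 1 / real (Suc i)" for i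
  have t: "t i > 0" "t i \<le> 1" for i by (auto simp: t_def)
  have t0: "filterlim t (at 0) sequentially"
  proof -
    have "t \<longlonglongrightarrow> 0" unfolding t_def using LIMSEQ_inverse_real_of_nat by (simp add: inverse_eq_divide)
    then show ?thesis using t(1) by (auto simp: filterlim_at less_imp_neq[symmetric])
  qed
  define q where "q i x = (f (x + t i *\<^sub>R v) - f x) / t i" for i x
  define C where "C = (K + bnd / \<epsilon>) * norm v"
  have C: "C \<ge> 0" using K_nonneg bnd_nonneg e by (simp add: C_def)
  define A where "A x = indicator (ball 0 1) x * (radial_cutoff \<epsilon> x * (\<psi>' x \<bullet> v))" for x
  define S where "S x = indicator (ball 0 1 - ball 0 (1 - \<epsilon>)) x * ((sgn x \<bullet> v) * \<psi> x)" for x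
  have [measurable]: "A \<in> borel_measurable borel" "S \<in> borel_measurable borel"
    unfolding A_def S_def by measurable
  have lim: "(\<lambda>i. q i x) \<longlonglongrightarrow> A x - S x / \<epsilon>"
    if x: "norm x \<noteq> 1" "norm x \<noteq> 1 - \<epsilon>" "x \<noteq> 0" for x
  proof -
    have "((\<lambda>u. x + u *\<^sub>R v) has_derivative (\<lambda>u. u *\<^sub>R v)) (at 0)"
      by (auto intro!: derivative_eq_intros)
    moreover have "(f has_derivative
      (\<lambda>v. indicator (ball 0 1) x * (radial_cutoff \<epsilon> x * (\<psi>' x \<bullet> v))
       - indicator (ball 0 1 - ball 0 (1 - \<epsilon>)) x * ((sgn x \<bullet> v) * \<psi> x) / \<epsilon>)) (at (x + 0 *\<^sub>R v))"
      unfolding f_def using cutoff_deriv[OF e x] by simp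
    ultimately have *: "((\<lambda>u. f (x + u *\<^sub>R v)) has_derivative
      (\<lambda>u. indicator (ball 0 1) x * (radial_cutoff \<epsilon> x * (\<psi>' x \<bullet> (u *\<^sub>R v)))
       - indicator (ball 0 1 - ball 0 (1 - \<epsilon>)) x * ((sgn x \<bullet> (u *\<^sub>R v)) * \<psi> x) / \<epsilon>)) (at 0)"
      by (rule has_derivative_compose)
    have "((\<lambda>u. f (x + u *\<^sub>R v)) has_real_derivative (A x - S x / \<epsilon>)) (at 0)"
      unfolding has_field_derivative_def
      by (rule has_derivative_eq_rhs[OF *]) (simp add: A_def S_def fun_eq_iff algebra_simps)
    then have "((\<lambda>h. (f (x + h *\<^sub>R v) - f x) / h) \<longlongrightarrow> A x - S x / \<epsilon>) (at 0)"
      by (simp add: DERIV_def)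
    from filterlim_compose[OF this t0] show ?thesis by (simp add: q_def)
  qed
  \<comment> \<open>Steps are at most 1, so the quotient vanishes once both points are outside the
    unit ball, in particular for \<open>norm x > 1 + norm v\<close>.\<close>
  have qb: "norm (q i x) \<le> indicator (cball 0 (1 + norm v)) x * C" for i x
  proof -
    have "\<bar>f (x + t i *\<^sub>R v) - f x\<bar> \<le> (K + bnd / \<epsilon>) * norm (t i *\<^sub>R v)"
      unfolding f_def using cutoff_lipschitz[OF e(1), of "x + t i *\<^sub>R v" x] by simp
    also have "\<dots> = C * t i" using t[of i] by (simp add: C_def)
    finally have 1: "norm (q i x) \<le> C" using t[of i] by (simp add: q_def field_simps)
    have 2: "q i x = 0" if x: "norm x > 1 + norm v"
    proof -
      have "norm x \<le> norm (x + t i *\<^sub>R v) + norm (t i *\<^sub>R v)"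
        using norm_triangle_ineq4[of "x + t i *\<^sub>R v" "t i *\<^sub>R v"] by simp
      moreover have "norm (t i *\<^sub>R v) \<le> 1 * norm v"
        unfolding norm_scaleR using t[of i] by (intro mult_right_mono) auto
      ultimately have "norm (x + t i *\<^sub>R v) \<ge> 1" using x by simp
      moreover have "norm x \<ge> 1" using x norm_ge_zero[of v] by linarith
      ultimately show ?thesis by (simp add: q_def f0)
    qed
    show ?thesis using 1 2 C by (cases "norm x > 1 + norm v") (auto simp: indicator_def)
  qed
  have "(\<lambda>i. \<integral>x. q i x \<partial>lborel) \<longlonglongrightarrow> (\<integral>x. A x - S x / \<epsilon> \<partial>lborel)"
  proof (rule integral_dominated_convergence)
    show "integrable lborel (\<lambda>x. indicator (cball 0 (1 + norm v)) (x::'a) * C)"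
      by (intro integrable_mult_left integrable_real_indicator) (auto simp: emeasure_cball borel_closed)
    show "AE x in lborel. (\<lambda>i. q i x) \<longlonglongrightarrow> A x - S x / \<epsilon>"
      using AE_lborel_norm_neq[of 1] AE_lborel_norm_neq[of "1 - \<epsilon>"] AE_lborel_norm_neq[of 0]
      by eventually_elim (simp add: lim)
    show "AE x in lborel. norm (q i x) \<le> indicator (cball 0 (1 + norm v)) x * C" for i
      using qb by simp
  qed (unfold q_def, measurable)
  moreover have "(\<integral>x. q i x \<partial>lborel) = 0" for i
  proof -
    have "integrable lborel (\<lambda>x. f (x + t i *\<^sub>R v))"
    proof -
      have "integrable (distr lborel borel ((+) (t i *\<^sub>R v))) f"
        using f_int by (simp only: lborel_distr_plus)
      then show ?thesis by (subst (asm) integrable_distr_eq) (auto simp: add.commute)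
    qed
    then show ?thesis
      using f_int by (simp add: q_def integral_lborel_translate)
  qed
  ultimately have "(\<integral>x. A x - S x / \<epsilon> \<partial>lborel) = 0"
    by (simp add: LIMSEQ_const_iff)
  moreover have "integrable lborel A"
    unfolding A_def
  proof (rule integrable_on_ball)
    show "\<bar>radial_cutoff \<epsilon> x * (\<psi>' x \<bullet> v)\<bar> \<le> 1 * (K * norm v)" if "norm x < 1" for x
      unfolding abs_mult using that K_nonneg
      by (intro mult_mono order_trans[OF Cauchy_Schwarz_ineq2] grad) (auto simp: radial_cutoff_bounds)
  qed measurable
  moreover have "integrable lborel S"
    unfolding S_def by (rule shell_integrable) auto
  ultimately have "(\<integral>x. A x \<partial>lborel) = (\<integral>x. S x \<partial>lborel) / \<epsilon>"
    by simp
  then show ?thesis by (simp only: A_def S_def)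
qed

end

section \<open>From thin shells to the sphere\<close>

lemma integral_shell_sgn:
  fixes g :: "'a::euclidean_space \<Rightarrow> real"
  assumes [measurable]: "g \<in> borel_measurable borel" and bd: "\<And>x. \<bar>g (sgn x)\<bar> \<le> b" and e: "0 < \<epsilon>" "\<epsilon> < 1"
  shows "(\<integral>x. indicator (ball 0 1 - ball 0 (1 - \<epsilon>)) x * g (sgn x) \<partial>lborel)
    = (1 - (1 - \<epsilon>) ^ DIM('a)) * (\<integral>x. indicator (ball 0 1) x * g (sgn x) \<partial>lborel)"
proof -
  have 1: "integrable lborel (\<lambda>x. indicator (ball 0 1) x * g (sgn x))"
    by (rule integrable_on_ball[OF _ bd]) simp
  have "integrable lborel (\<lambda>x. indicator (ball 0 1) x * (indicator (ball 0 (1 - \<epsilon>)) x * g (sgn x)))"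
    using bd order_trans[OF abs_ge_zero bd] by (intro integrable_on_ball[where b=b]) (auto simp: indicator_def)
  also have "(\<lambda>x. indicator (ball 0 1) x * (indicator (ball 0 (1 - \<epsilon>)) x * g (sgn x)))
      = (\<lambda>x. indicator (ball 0 (1 - \<epsilon>)) x * g (sgn x))"
    using e by (auto simp: fun_eq_iff indicator_def)
  finally have 2: "integrable lborel (\<lambda>x. indicator (ball 0 (1 - \<epsilon>)) x * g (sgn x))" .
  have "(\<integral>x. indicator (ball 0 1 - ball 0 (1 - \<epsilon>)) x * g (sgn x) \<partial>lborel)
      = (\<integral>x. indicator (ball 0 1) x * g (sgn x) - indicator (ball 0 (1 - \<epsilon>)) x * g (sgn x) \<partial>lborel)"
    using e by (intro Bochner_Integration.integral_cong) (auto simp: indicator_def)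
  also have "\<dots> = (1 - (1 - \<epsilon>) ^ DIM('a)) * (\<integral>x. indicator (ball 0 1) x * g (sgn x) \<partial>lborel)"
    using e unfolding Bochner_Integration.integral_diff[OF 1 2]
    by (subst integral_ball_sgn) (simp_all add: left_diff_distrib)
  finally show ?thesis .
qed

lemma tendsto_one_minus_power_quotient:
  assumes "filterlim e (at (0::real)) F"
  shows "((\<lambda>k. (1 - (1 - e k) ^ n) / e k) \<longlongrightarrow> real n) F"
proof -
  have "((\<lambda>u::real. 1 - (1 - u) ^ n) has_real_derivative real n) (at 0)"
    by (auto intro!: derivative_eq_intros)
  then have "((\<lambda>h::real. (1 - (1 - h) ^ n) / h) \<longlongrightarrow> real n) (at 0)"
    by (simp add: DERIV_def)
  from filterlim_compose[OF this assms] show ?thesis .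
qed

context smooth_on_unit_ball
begin

text \<open>In the shell \<open>x\<close> is within \<open>\<epsilon>\<close> of
  \<open>sgn x\<close>, so replacing \<open>\<psi> x\<close> by \<open>\<psi> (sgn x)\<close> costs
  at most \<open>K * \<epsilon>\<close>. What remains depends on the direction only, and the shell
  contributes its share of the volume of the ball.\<close>

lemma shell_integral_approx:
  assumes e: "0 < \<epsilon>" "\<epsilon> < 1"
  shows "\<bar>(\<integral>x. indicator (ball 0 1 - ball 0 (1 - \<epsilon>)) x * ((sgn x \<bullet> v) * \<psi> x) \<partial>lborel)
      - (1 - (1 - \<epsilon>) ^ DIM('a)) * (\<integral>x. indicator (ball 0 1) x * ((sgn x \<bullet> v) * \<psi> (sgn x)) \<partial>lborel)\<bar>
    \<le> norm v * K * \<epsilon> * ((1 - (1 - \<epsilon>) ^ DIM('a)) * measure lborel (ball (0::'a) 1))"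
proof -
  let ?S = "ball 0 1 - ball (0::'a) (1 - \<epsilon>)"
  have s1: "norm (sgn x) \<le> 1" for x :: 'a by (simp add: norm_sgn)
  have i1: "integrable lborel (\<lambda>x. indicator ?S x * ((sgn x \<bullet> v) * \<psi> x))"
    by (rule shell_integrable) auto
  have i2: "integrable lborel (\<lambda>x. indicator ?S x * ((sgn x \<bullet> v) * \<psi> (sgn x)))"
    by (rule shell_integrable) (auto simp: s1)
  define g where "g y = (if norm y \<le> 1 then (y \<bullet> v) * \<psi> y else 0)" for y
  have [measurable]: "g \<in> borel_measurable borel" unfolding g_def by measurable
  have g: "g (sgn x) = (sgn x \<bullet> v) * \<psi> (sgn x)" for x by (simp add: g_def s1)
  have gb: "\<bar>g (sgn x)\<bar> \<le> norm v * bnd" for x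
    unfolding g abs_mult by (intro mult_mono abs_sgn_inner_le bounded s1) auto
  have eq: "(1 - (1 - \<epsilon>) ^ DIM('a)) * (\<integral>x. indicator (ball 0 1) x * ((sgn x \<bullet> v) * \<psi> (sgn x)) \<partial>lborel)
      = (\<integral>x. indicator ?S x * ((sgn x \<bullet> v) * \<psi> (sgn x)) \<partial>lborel)"
    using integral_shell_sgn[of g, OF _ gb e] by (simp add: g)
  have iS: "integrable lborel (indicator ?S :: 'a \<Rightarrow> real)"
  proof (rule integrable_real_indicator)
    have "emeasure lborel ?S \<le> emeasure lborel (ball (0::'a) 1)" by (intro emeasure_mono) auto
    also have "\<dots> < \<infinity>" by (simp add: emeasure_ball)
    finally show "emeasure lborel ?S < \<infinity>" .
  qed simp
  have pw: "\<bar>indicator ?S x * ((sgn x \<bullet> v) * \<psi> x) - indicator ?S x * ((sgn x \<bullet> v) * \<psi> (sgn x))\<bar>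
      \<le> norm v * K * \<epsilon> * indicator ?S x" for x
  proof (cases "x \<in> ?S")
    case True
    then have x: "norm x < 1" "1 - \<epsilon> \<le> norm x" "x \<noteq> 0" using e by auto
    have "x - sgn x = (norm x - 1) *\<^sub>R sgn x"
      using x by (simp add: sgn_div_norm algebra_simps)
    then have "norm (x - sgn x) \<le> \<epsilon>" using x by (simp add: norm_sgn)
    then have "\<bar>\<psi> x - \<psi> (sgn x)\<bar> \<le> K * \<epsilon>"
      using x by (intro order_trans[OF lipschitz] mult_left_mono K_nonneg) (auto simp: s1)
    then have "\<bar>sgn x \<bullet> v\<bar> * \<bar>\<psi> x - \<psi> (sgn x)\<bar> \<le> norm v * (K * \<epsilon>)"
      by (intro mult_mono abs_sgn_inner_le) auto
    then show ?thesis using True by (simp add: abs_mult mult.assoc flip: right_diff_distrib)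
  qed simp
  have "\<bar>(\<integral>x. indicator ?S x * ((sgn x \<bullet> v) * \<psi> x) \<partial>lborel)
      - (\<integral>x. indicator ?S x * ((sgn x \<bullet> v) * \<psi> (sgn x)) \<partial>lborel)\<bar>
      = \<bar>\<integral>x. indicator ?S x * ((sgn x \<bullet> v) * \<psi> x) - indicator ?S x * ((sgn x \<bullet> v) * \<psi> (sgn x)) \<partial>lborel\<bar>"
    by (simp only: Bochner_Integration.integral_diff[OF i1 i2])
  also have "\<dots> \<le> (\<integral>x. \<bar>indicator ?S x * ((sgn x \<bullet> v) * \<psi> x) - indicator ?S x * ((sgn x \<bullet> v) * \<psi> (sgn x))\<bar> \<partial>lborel)"
    by (rule integral_abs_bound)
  also have "\<dots> \<le> (\<integral>x. norm v * K * \<epsilon> * indicator ?S x \<partial>lborel)"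
    by (intro integral_mono pw integrable_abs integrable_mult_right Bochner_Integration.integrable_diff i1 i2 iS)
  also have "\<dots> = norm v * K * \<epsilon> * (\<integral>x. indicator ?S x \<partial>lborel)" by simp
  also have "(\<integral>x. indicator ?S x \<partial>lborel) = (1 - (1 - \<epsilon>) ^ DIM('a)) * measure lborel (ball (0::'a) 1)"
    using integral_shell_sgn[of "\<lambda>_::'a. 1" 1, OF _ _ e] by simp
  finally show ?thesis unfolding eq .
qed

text \<open>The shell integral divided by its thickness has two limits: the integral of the
  gradient, as the cutoff tends to 1, and a directional integral times the derivative of
  \<open>1 - (1 - \<epsilon>) ^ n\<close> at 0, which is \<open>n\<close>.\<close>

lemma divergence_unit_ball:
  "real DIM('a) * (\<integral>x. indicator (ball 0 1) x * ((sgn x \<bullet> v) * \<psi> (sgn x)) \<partial>lborel)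
    = (\<integral>x. indicator (ball 0 1) x * (\<psi>' x \<bullet> v) \<partial>lborel)"
proof -
  let ?n = "DIM('a)"
  \<comment> \<open>The double successor keeps the thickness strictly between 0 and 1 for every
    \<open>k\<close>.\<close>
  define e where "e k = 1 / real (Suc (Suc k))" for k
  have e: "0 < e k" "e k < 1" for k by (auto simp: e_def)
  have e_lim: "e \<longlonglongrightarrow> 0"
    unfolding e_def using LIMSEQ_Suc[OF LIMSEQ_inverse_real_of_nat] by (simp add: inverse_eq_divide)
  have e0: "filterlim e (at 0) sequentially"
    using e_lim e(1) by (auto simp: filterlim_at less_imp_neq[symmetric])
  let ?A = "\<integral>x. indicator (ball 0 1) x * ((sgn x \<bullet> v) * \<psi> (sgn x)) \<partial>lborel"
  let ?T = "\<integral>x. indicator (ball 0 1) x * (\<psi>' x \<bullet> v) \<partial>lborel"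
  let ?B = "measure lborel (ball (0::'a) 1)"
  define s where "s k = (\<integral>x. indicator (ball 0 1 - ball 0 (1 - e k)) x * ((sgn x \<bullet> v) * \<psi> x) \<partial>lborel) / e k" for k
  define p where "p k = (1 - (1 - e k) ^ ?n) / e k" for k
  have p: "p \<longlonglongrightarrow> real ?n" unfolding p_def by (rule tendsto_one_minus_power_quotient[OF e0])
  have "s \<longlonglongrightarrow> ?T"
  proof -
    have gb: "\<bar>\<psi>' x \<bullet> v\<bar> \<le> K * norm v" if "norm x < 1" for x
      using that by (intro order_trans[OF Cauchy_Schwarz_ineq2] mult_right_mono grad) auto
    have "(\<lambda>k. \<integral>x. indicator (ball 0 1) x * (radial_cutoff (e k) x * (\<psi>' x \<bullet> v)) \<partial>lborel) \<longlonglongrightarrow> ?T"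
    proof (rule integral_dominated_convergence)
      show "integrable lborel (\<lambda>x. \<bar>indicator (ball 0 1) x * (\<psi>' x \<bullet> v)\<bar>)"
        by (intro integrable_abs integrable_on_ball[OF _ gb]) auto
      show "AE x in lborel. (\<lambda>k. indicator (ball 0 1) x * (radial_cutoff (e k) x * (\<psi>' x \<bullet> v)))
          \<longlonglongrightarrow> indicator (ball 0 1) x * (\<psi>' x \<bullet> v)"
      proof (rule AE_I2)
        fix x :: 'a
        show "(\<lambda>k. indicator (ball 0 1) x * (radial_cutoff (e k) x * (\<psi>' x \<bullet> v)))
            \<longlonglongrightarrow> indicator (ball 0 1) x * (\<psi>' x \<bullet> v)"
        proof (cases "norm x < 1")
          case True
          have "\<forall>\<^sub>F k in sequentially. e k < 1 - norm x"
            using True by (intro order_tendstoD(2)[OF e_lim]) simp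
          then have "\<forall>\<^sub>F k in sequentially. radial_cutoff (e k) x = 1"
            by eventually_elim (use e in \<open>auto simp: radial_cutoff_def field_simps min_def max_def\<close>)
          then have "(\<lambda>k. radial_cutoff (e k) x) \<longlonglongrightarrow> 1" by (rule tendsto_eventually)
          from tendsto_mult[OF tendsto_const tendsto_mult[OF this tendsto_const]]
          show ?thesis by simp
        qed simp
      qed
      show "AE x in lborel. norm (indicator (ball 0 1) x * (radial_cutoff (e k) x * (\<psi>' x \<bullet> v)))
          \<le> \<bar>indicator (ball 0 1) x * (\<psi>' x \<bullet> v)\<bar>" for k
      proof (rule AE_I2)
        fix x :: 'a
        have "radial_cutoff (e k) x * \<bar>indicator (ball 0 1) x * (\<psi>' x \<bullet> v)\<bar> \<le> 1 * \<bar>indicator (ball 0 1) x * (\<psi>' x \<bullet> v)\<bar>"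
          by (intro mult_right_mono radial_cutoff_bounds) auto
        then show "norm (indicator (ball 0 1) x * (radial_cutoff (e k) x * (\<psi>' x \<bullet> v)))
          \<le> \<bar>indicator (ball 0 1) x * (\<psi>' x \<bullet> v)\<bar>"
          by (simp add: abs_mult radial_cutoff_bounds mult_ac)
      qed
    qed measurable
    then show ?thesis unfolding s_def cutoff_integral_eq_shell_integral[OF e] .
  qed
  moreover have "s \<longlonglongrightarrow> real ?n * ?A"
  proof -
    have "\<bar>s k - p k * ?A\<bar> \<le> norm v * K * (p k * e k * ?B)" for k
    proof -
      have "s k - p k * ?A = ((\<integral>x. indicator (ball 0 1 - ball 0 (1 - e k)) x * ((sgn x \<bullet> v) * \<psi> x) \<partial>lborel)
          - (1 - (1 - e k) ^ ?n) * ?A) / e k"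
        by (simp only: s_def p_def diff_divide_distrib[of _ "_ * ?A"] times_divide_eq_left)
      also have "\<bar>\<dots>\<bar> \<le> norm v * K * e k * ((1 - (1 - e k) ^ ?n) * ?B) / e k"
        unfolding abs_divide abs_of_pos[OF e(1)]
        by (intro divide_right_mono shell_integral_approx e less_imp_le[OF e(1)])
      also have "\<dots> = norm v * K * (p k * e k * ?B)" using e(1)[of k] by (simp add: p_def)
      finally show ?thesis .
    qed
    moreover have "(\<lambda>k. norm v * K * (p k * e k * ?B)) \<longlonglongrightarrow> norm v * K * (real ?n * 0 * ?B)"
      by (intro tendsto_intros p e_lim)
    ultimately have "(\<lambda>k. s k - p k * ?A) \<longlonglongrightarrow> 0"
      by (intro Lim_null_comparison[of "\<lambda>k. s k - p k * ?A"]) auto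
    moreover have "(\<lambda>k. p k * ?A) \<longlonglongrightarrow> real ?n * ?A"
      by (intro tendsto_intros p)
    ultimately have "(\<lambda>k. (s k - p k * ?A) + p k * ?A) \<longlonglongrightarrow> 0 + real ?n * ?A"
      by (rule tendsto_add)
    then show ?thesis by simp
  qed
  ultimately show ?thesis by (metis LIMSEQ_unique)
qed

corollary sphere_first_moment:
  "real DIM('a) * (\<integral>e. \<psi> e * (e \<bullet> v) \<partial>uniform_sphere)
    = (\<integral>x. indicator (ball 0 1) x * (\<psi>' x \<bullet> v) \<partial>lborel) / measure lborel (ball (0::'a) 1)"
proof -
  have "(\<integral>e. \<psi> e * (e \<bullet> v) \<partial>uniform_sphere)
      = (\<integral>x. indicator (ball 0 1) x * ((sgn x \<bullet> v) * \<psi> (sgn x)) \<partial>lborel) / measure lborel (ball (0::'a) 1)"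
    by (subst integral_uniform_sphere) (simp_all add: mult_ac)
  then show ?thesis by (simp add: divergence_unit_ball[symmetric])
qed

corollary sphere_first_moment_ge:
  assumes lower: "\<And>x. norm x < 1 \<Longrightarrow> c \<le> \<psi>' x \<bullet> v"
  shows "c \<le> real DIM('a) * (\<integral>e. \<psi> e * (e \<bullet> v) \<partial>uniform_sphere)"
proof -
  let ?B = "ball (0::'a) 1"
  have "emeasure lborel ?B = ennreal (measure lborel ?B)"
    by (simp add: measure_def emeasure_ball)
  then have B: "measure lborel ?B > 0"
    using emeasure_unit_ball_neq_0[where 'a='a] by (metis ennreal_0 measure_nonneg less_le)
  have gb: "\<bar>\<psi>' x \<bullet> v\<bar> \<le> K * norm v" if "norm x < 1" for x
    using that by (intro order_trans[OF Cauchy_Schwarz_ineq2] mult_right_mono grad) auto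
  have "c * measure lborel ?B = (\<integral>x. indicator ?B x * c \<partial>lborel)" by simp
  also have "\<dots> \<le> (\<integral>x. indicator ?B x * (\<psi>' x \<bullet> v) \<partial>lborel)"
    using lower by (intro integral_mono integrable_on_ball[OF _ gb] integrable_on_ball[of "\<lambda>_. c" "\<bar>c\<bar>"])
      (auto simp: indicator_def)
  finally show ?thesis using B by (simp add: sphere_first_moment field_simps)
qed

end

section \<open>Strongly convex-concave saddle problems\<close>

text \<open>The Basel series with its tail majorised by the telescoping series of
  \<open>1 / ((n + 1)\<^sup>2 - 1 / 4)\<close>. The first two terms are kept exact: the sum is then
  at most \<open>1 + 1 / 4 + 2 / 5\<close>, below \<open>10 / 6\<close>, while a single exact term
  would only give \<open>10 / 6\<close> itself.\<close>

lemma pi_square_less_10: "pi\<^sup>2 < 10"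
proof -
  define s where "s = (\<lambda>n. 1 / (real n + 1)\<^sup>2)"
  have sums: "s sums (pi\<^sup>2 / 6)"
    using inverse_squares_sums by (simp add: s_def add.commute)
  define t where "t n = (if n < 2 then s n else 1 / (real n + 1 / 2) - 1 / (real (Suc n) + 1 / 2))" for n
  have "(\<lambda>n. 1 / (real (n + 2) + 1 / 2) - 1 / (real (Suc n + 2) + 1 / 2)) sums (1 / (real (0 + 2) + 1 / 2) - 0)"
  proof (rule telescope_sums')
    show "(\<lambda>n. 1 / (real (n + 2) + 1 / 2)) \<longlonglongrightarrow> 0"
      by real_asymp
  qed
  then have "(\<lambda>n. t (n + 2)) sums (2 / 5)" by (simp add: t_def)
  then have "t sums (2 / 5 + (\<Sum>i<2. t i))"
    by (subst (asm) sums_iff_shift) simp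
  moreover have "s n \<le> t n" for n
  proof (cases "n < 2")
    case False
    have "1 / (real n + 1 / 2) - 1 / (real (Suc n) + 1 / 2) = 1 / ((real n + 1)\<^sup>2 - 1 / 4)"
      by (simp add: field_simps power2_eq_square)
    moreover have "1 / (real n + 1)\<^sup>2 \<le> 1 / ((real n + 1)\<^sup>2 - 1 / 4)"
    proof (rule divide_left_mono)
      have "(real n + 1)\<^sup>2 \<ge> 1" by simp
      then show "0 < (real n + 1)\<^sup>2 * ((real n + 1)\<^sup>2 - 1 / 4)" by (intro mult_pos_pos) linarith+
    qed auto
    ultimately show ?thesis using False by (simp add: t_def s_def)
  qed (simp add: t_def)
  ultimately have "pi\<^sup>2 / 6 \<le> 2 / 5 + (\<Sum>i<2. t i)"
    using sums sums_le by blast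
  then show ?thesis by (simp add: t_def s_def numeral_2_eq_2)
qed

section \<open>Gradients, second differences and constrained minima\<close>

lemma gderiv_unique: "GDERIV f x :> a \<Longrightarrow> GDERIV f x :> b \<Longrightarrow> a = b"
proof -
  assume "GDERIV f x :> a" "GDERIV f x :> b"
  then have "(\<lambda>h. h \<bullet> a) = (\<lambda>h. h \<bullet> b)"
    unfolding gderiv_def by (rule has_derivative_unique)
  then have "(a - b) \<bullet> a = (a - b) \<bullet> b" by meson
  then have "(a - b) \<bullet> (a - b) = 0" by (simp add: inner_diff_right)
  then show ?thesis by simp
qed

text \<open>Difference quotients in the direction of the gradient \<open>D\<close> itself tend to
  \<open>D \<bullet> D\<close> and are bounded by \<open>M * norm D\<close>.\<close>

lemma gderiv_norm_le_lipschitz: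
  fixes f :: "'a::real_inner \<Rightarrow> real"
  assumes lip: "M-lipschitz_on U f" and U: "open U" "z \<in> U" and d: "GDERIV f z :> D"
  shows "norm D \<le> M"
proof (cases "D = 0")
  case True
  then show ?thesis using lipschitz_on_nonneg[OF lip] by simp
next
  case False
  have "((\<lambda>t. z + t *\<^sub>R D) has_derivative (\<lambda>t. t *\<^sub>R D)) (at (0::real))"
    by (auto intro!: derivative_eq_intros)
  moreover have "(f has_derivative (\<lambda>h. h \<bullet> D)) (at (z + 0 *\<^sub>R D))"
    using d by (simp add: gderiv_def)
  ultimately have *: "((\<lambda>t. f (z + t *\<^sub>R D)) has_derivative (\<lambda>t. (t *\<^sub>R D) \<bullet> D)) (at 0)"
    by (rule has_derivative_compose)
  have "((\<lambda>t. f (z + t *\<^sub>R D)) has_real_derivative (D \<bullet> D)) (at 0)"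
    unfolding has_field_derivative_def
    by (rule has_derivative_eq_rhs[OF *]) (auto simp: fun_eq_iff)
  then have lim: "((\<lambda>h. \<bar>(f (z + h *\<^sub>R D) - f z) / h\<bar>) \<longlongrightarrow> \<bar>D \<bullet> D\<bar>) (at 0)"
    unfolding DERIV_def by (intro tendsto_rabs) simp
  have ev: "\<forall>\<^sub>F h in at (0::real). z + h *\<^sub>R D \<in> U"
  proof (rule topological_tendstoD)
    show "((\<lambda>h. z + h *\<^sub>R D) \<longlongrightarrow> z) (at 0)" by (auto intro!: tendsto_eq_intros)
  qed (use U in auto)
  have "\<forall>\<^sub>F h in at (0::real). \<bar>(f (z + h *\<^sub>R D) - f z) / h\<bar> \<le> M * norm D"
    using ev eventually_at_ball'[of 1 0 UNIV, OF zero_less_one]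
  proof eventually_elim
    case (elim h)
    have "\<bar>f (z + h *\<^sub>R D) - f z\<bar> \<le> M * (\<bar>h\<bar> * norm D)"
      using lipschitz_onD[OF lip elim(1) U(2)] by (simp add: dist_norm)
    then show ?case using elim by (simp add: field_simps abs_divide)
  qed
  then have "\<bar>D \<bullet> D\<bar> \<le> M * norm D"
    by (intro tendsto_upperbound[OF lim]) auto
  then have "norm D * norm D \<le> M * norm D"
    by (simp add: power2_norm_eq_inner[symmetric] power2_eq_square)
  then show ?thesis using False by simp
qed

lemma gderiv_fst:
  assumes "GDERIV f (x, y) :> D"
  shows "GDERIV (\<lambda>x. f (x, y)) x :> fst D"
proof -
  have "((\<lambda>x. (x, y)) has_derivative (\<lambda>h. (h, 0))) (at x)"
    by (auto intro!: derivative_eq_intros)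
  from has_derivative_compose[OF this assms[unfolded gderiv_def]]
  show ?thesis by (simp add: gderiv_def inner_prod_def)
qed

lemma gderiv_snd:
  assumes "GDERIV f (x, y) :> D"
  shows "GDERIV (\<lambda>y. f (x, y)) y :> snd D"
proof -
  have "((\<lambda>y. (x, y)) has_derivative (\<lambda>h. (0, h))) (at y)"
    by (auto intro!: derivative_eq_intros)
  from has_derivative_compose[OF this assms[unfolded gderiv_def]]
  show ?thesis by (simp add: gderiv_def inner_prod_def)
qed

text \<open>The derivative of \<open>f (w + s *\<^sub>R u) + f (w - s *\<^sub>R u)\<close> in
  \<open>s\<close> is at most \<open>2 * L * s * (norm u)\<^sup>2\<close> in absolute value;
  integration from 0 to 1 removes the 2. The sign \<open>c\<close> treats both inequalities at
  once.\<close>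

lemma second_difference_le:
  fixes f :: "'a::real_inner \<Rightarrow> real"
  assumes d: "\<And>z. z \<in> U \<Longrightarrow> GDERIV f z :> f' z" and lip: "L-lipschitz_on U f'"
    and U: "\<And>s. 0 \<le> s \<Longrightarrow> s \<le> 1 \<Longrightarrow> w + s *\<^sub>R u \<in> U" "\<And>s. 0 \<le> s \<Longrightarrow> s \<le> 1 \<Longrightarrow> w - s *\<^sub>R u \<in> U"
  shows "\<bar>f (w + u) + f (w - u) - 2 * f w\<bar> \<le> L * (norm u)\<^sup>2"
proof -
  have der: "((\<lambda>s. f (w + s *\<^sub>R u) + f (w - s *\<^sub>R u)) has_real_derivative
      ((f' (w + s *\<^sub>R u) - f' (w - s *\<^sub>R u)) \<bullet> u)) (at s)" if s: "0 \<le> s" "s \<le> 1" for s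
  proof -
    have "((\<lambda>s. w + s *\<^sub>R u) has_derivative (\<lambda>t. t *\<^sub>R u)) (at s)"
      by (auto intro!: derivative_eq_intros)
    from has_derivative_compose[OF this d[OF U(1)[OF s], unfolded gderiv_def]]
    have 1: "((\<lambda>s. f (w + s *\<^sub>R u)) has_derivative (\<lambda>t. (t *\<^sub>R u) \<bullet> f' (w + s *\<^sub>R u))) (at s)" .
    have "((\<lambda>s. w - s *\<^sub>R u) has_derivative (\<lambda>t. - (t *\<^sub>R u))) (at s)"
      by (auto intro!: derivative_eq_intros)
    from has_derivative_compose[OF this d[OF U(2)[OF s], unfolded gderiv_def]]
    have 2: "((\<lambda>s. f (w - s *\<^sub>R u)) has_derivative (\<lambda>t. (- (t *\<^sub>R u)) \<bullet> f' (w - s *\<^sub>R u))) (at s)" .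
    show ?thesis
      unfolding has_field_derivative_def
      by (rule has_derivative_eq_rhs[OF has_derivative_add[OF 1 2]])
        (auto simp: fun_eq_iff inner_diff_left inner_commute algebra_simps)
  qed
  have bd: "\<bar>(f' (w + s *\<^sub>R u) - f' (w - s *\<^sub>R u)) \<bullet> u\<bar> \<le> 2 * L * s * (norm u)\<^sup>2" if s: "0 \<le> s" "s \<le> 1" for s
  proof -
    have "norm (f' (w + s *\<^sub>R u) - f' (w - s *\<^sub>R u)) \<le> L * norm ((w + s *\<^sub>R u) - (w - s *\<^sub>R u))"
      using lipschitz_onD[OF lip U(1)[OF s] U(2)[OF s]] by (simp add: dist_norm)
    also have "(w + s *\<^sub>R u) - (w - s *\<^sub>R u) = (2 * s) *\<^sub>R u"
      by (simp add: scaleR_2 flip: scaleR_scaleR)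
    finally have "norm (f' (w + s *\<^sub>R u) - f' (w - s *\<^sub>R u)) * norm u \<le> L * (2 * s * norm u) * norm u"
      using s by (intro mult_right_mono) auto
    then show ?thesis
      using Cauchy_Schwarz_ineq2[of "f' (w + s *\<^sub>R u) - f' (w - s *\<^sub>R u)" u]
      by (simp add: power2_eq_square algebra_simps)
  qed
  have main: "c * (f (w + u) + f (w - u) - 2 * f w) \<le> L * (norm u)\<^sup>2" if c: "\<bar>c\<bar> = 1" for c
  proof -
    let ?g = "\<lambda>s. c * (f (w + s *\<^sub>R u) + f (w - s *\<^sub>R u)) - L * s\<^sup>2 * (norm u)\<^sup>2"
    have "?g 1 \<le> ?g 0"
    proof (rule DERIV_nonpos_imp_nonincreasing[of 0 1 ?g])
      fix s :: real assume s: "0 \<le> s" "s \<le> 1"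
      let ?d = "c * ((f' (w + s *\<^sub>R u) - f' (w - s *\<^sub>R u)) \<bullet> u) - 2 * L * s * (norm u)\<^sup>2"
      have "(?g has_real_derivative ?d) (at s)"
        by (rule derivative_eq_intros der s refl | simp)+
      moreover have "c * ((f' (w + s *\<^sub>R u) - f' (w - s *\<^sub>R u)) \<bullet> u)
          \<le> \<bar>c\<bar> * \<bar>(f' (w + s *\<^sub>R u) - f' (w - s *\<^sub>R u)) \<bullet> u\<bar>"
        by (simp flip: abs_mult)
      ultimately show "\<exists>y. (?g has_real_derivative y) (at s) \<and> y \<le> 0"
        using bd[OF s] c by (intro exI[of _ ?d]) auto
    qed simp
    then show ?thesis by (simp add: algebra_simps)
  qed
  show ?thesis using main[of 1] main[of "-1"] by (simp add: abs_le_iff)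
qed

text \<open>This turns a gradient into the descent-ascent field. It is self-adjoint and isometric,
  so it can be moved from the random direction onto \<open>z - zs\<close>.\<close>

definition flip_snd :: "'a \<times> 'b::uminus \<Rightarrow> 'a \<times> 'b" where
  "flip_snd p = (fst p, - snd p)"

lemma inner_flip_snd: "flip_snd a \<bullet> b = a \<bullet> flip_snd b" for a b :: "'a::real_inner \<times> 'b::real_inner"
  by (simp add: flip_snd_def inner_prod_def)

lemma norm_flip_snd [simp]: "norm (flip_snd a) = norm a" for a :: "'a::real_normed_vector \<times> 'b::real_normed_vector"
  by (simp add: flip_snd_def norm_prod_def)

text \<open>Strong convexity at a constrained minimiser \<open>xs\<close> without first-order conditions: compare \<open>x\<close> with
  the point \<open>xs + t (x - xs)\<close> and let \<open>t\<close> tend to \<open>0\<close>.\<close>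

lemma strong_minimum:
  fixes f :: "'c::real_inner \<Rightarrow> real"
  assumes ineq: "\<And>u v. u \<in> S \<Longrightarrow> v \<in> S \<Longrightarrow> f v \<ge> f u + f' u \<bullet> (v - u) + \<mu> / 2 * (norm (v - u))\<^sup>2"
    and \<mu>: "\<mu> \<ge> 0" and S: "convex S" "a \<in> S" "b \<in> S" and min: "\<And>u. u \<in> S \<Longrightarrow> f a \<le> f u"
  shows "f a + \<mu> / 2 * (norm (b - a))\<^sup>2 \<le> f b"
proof -
  have *: "f a + \<mu> / 2 * ((1 - t)\<^sup>2 * (norm (b - a))\<^sup>2) \<le> f b" if t: "0 < t" "t < 1" for t
  proof -
    define u where "u = a + t *\<^sub>R (b - a)"
    have u: "u \<in> S"
    proof -
      have "u = (1 - t) *\<^sub>R a + t *\<^sub>R b" by (simp add: u_def algebra_simps)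
      then show ?thesis using S t by (auto intro: convexD)
    qed
    have ba: "b - u = (1 - t) *\<^sub>R (b - a)" and aa: "a - u = - (t *\<^sub>R (b - a))"
      by (simp_all add: u_def algebra_simps)
    have "f u + f' u \<bullet> (a - u) \<le> f a"
      using ineq[OF u S(2)] mult_nonneg_nonneg[OF \<mu> zero_le_power2[of "norm (a - u)"]] by simp
    \<comment> \<open>The vectors \<open>a - u\<close> and \<open>b - u\<close> are opposite
      multiples of \<open>b - a\<close>, so a nonpositive slope towards the minimiser is a
      nonnegative slope towards \<open>b\<close>.\<close>
    then have "f' u \<bullet> (a - u) \<le> 0" using min[OF u] by linarith
    then have "0 \<le> t * (f' u \<bullet> (b - a))" by (simp add: aa)
    then have "0 \<le> f' u \<bullet> (b - a)" using t by (simp add: zero_le_mult_iff)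
    then have "0 \<le> f' u \<bullet> (b - u)" using t by (simp add: ba)
    moreover have "(norm (b - u))\<^sup>2 = (1 - t)\<^sup>2 * (norm (b - a))\<^sup>2"
      by (simp add: ba power_mult_distrib)
    ultimately show ?thesis using ineq[OF u S(3)] min[OF u] by simp
  qed
  have "((\<lambda>t. f a + \<mu> / 2 * ((1 - t)\<^sup>2 * (norm (b - a))\<^sup>2)) \<longlongrightarrow> f a + \<mu> / 2 * ((1 - 0)\<^sup>2 * (norm (b - a))\<^sup>2)) (at_right 0)"
    by (intro tendsto_intros)
  moreover have "\<forall>\<^sub>F t in at_right 0. f a + \<mu> / 2 * ((1 - t)\<^sup>2 * (norm (b - a))\<^sup>2) \<le> f b"
    using eventually_at_right_real[OF zero_less_one] by eventually_elim (intro *, auto)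
  ultimately have "f a + \<mu> / 2 * ((1 - 0)\<^sup>2 * (norm (b - a))\<^sup>2) \<le> f b"
    by (rule tendsto_upperbound) simp
  then show ?thesis by simp
qed

text \<open>The gradient \<open>\<phi>'\<close> is a parameter, so that Lipschitz continuity,
  convexity and the moments of the estimator all refer to one and the same function.\<close>

locale saddle_problem =
  fixes X :: "'a::euclidean_space set" and Y :: "'b::euclidean_space set"
    and UX :: "'a set" and UY :: "'b set"
    and \<phi> :: "'a \<times> 'b \<Rightarrow> real" and \<phi>' :: "'a \<times> 'b \<Rightarrow> 'a \<times> 'b"
    and \<tau> \<mu> M L :: real and xs :: 'a and ys :: 'b
  assumes pos: "\<tau> > 0" "\<mu> > 0" "M > 0" "L > 0"
    and X: "X \<noteq> {}" "compact X" "convex X"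
    and Y: "Y \<noteq> {}" "compact Y" "convex Y"
    and UX: "open UX" and UY: "open UY"
    and nbhd: "\<And>w v. w \<in> X \<times> Y \<Longrightarrow> norm v \<le> 1 \<Longrightarrow> w + \<tau> *\<^sub>R v \<in> UX \<times> UY"
    and scsc: "strongly_convex_concave_on \<mu> UX UY \<phi>"
    and lip: "M-lipschitz_on (UX \<times> UY) \<phi>"
    and gderiv: "\<And>z. z \<in> UX \<times> UY \<Longrightarrow> GDERIV \<phi> z :> \<phi>' z"
    and grad_lip: "L-lipschitz_on (UX \<times> UY) \<phi>'"
    and saddle: "saddle_point X Y \<phi> xs ys"
begin

abbreviation U where "U \<equiv> UX \<times> UY"
abbreviation Z where "Z \<equiv> X \<times> Y"
abbreviation zs where "zs \<equiv> (xs, ys)"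

lemma open_U: "open U"
  by (intro open_Times UX UY)

lemma nbhd_minus: "w \<in> Z \<Longrightarrow> norm v \<le> 1 \<Longrightarrow> w - \<tau> *\<^sub>R v \<in> U"
  using nbhd[of w "- v"] by simp

lemma Z_subset_U: "w \<in> Z \<Longrightarrow> w \<in> U"
  using nbhd[of w 0] by simp

lemma zs_in_Z: "zs \<in> Z"
  using saddle by (simp add: saddle_point_def)

lemma norm_gradient_le: "z \<in> U \<Longrightarrow> norm (\<phi>' z) \<le> M"
  by (rule gderiv_norm_le_lipschitz[OF lip open_U _ gderiv])

lemma strongly_convex_ineq:
  assumes "(x, y) \<in> U" "x' \<in> UX"
  shows "\<phi> (x', y) \<ge> \<phi> (x, y) + fst (\<phi>' (x, y)) \<bullet> (x' - x) + \<mu> / 2 * (norm (x' - x))\<^sup>2"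
proof -
  obtain f' where f': "\<And>x. x \<in> UX \<Longrightarrow> GDERIV (\<lambda>x. \<phi> (x, y)) x :> f' x"
    "\<And>x x'. x \<in> UX \<Longrightarrow> x' \<in> UX \<Longrightarrow> \<phi> (x', y) \<ge> \<phi> (x, y) + f' x \<bullet> (x' - x) + \<mu> / 2 * (norm (x' - x))\<^sup>2"
  proof -
    have "y \<in> UY" using assms by simp
    then have "strongly_convex_on \<mu> UX (\<lambda>x. \<phi> (x, y))"
      using scsc by (auto simp: strongly_convex_concave_on_def)
    then show ?thesis unfolding strongly_convex_on_def using that by blast
  qed
  \<comment> \<open>Strong convexity asserts some partial gradient \<open>f'\<close>; uniqueness
    identifies it with the component of \<open>\<phi>'\<close>.\<close>
  have "f' x = fst (\<phi>' (x, y))"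
    using f'(1)[of x] gderiv_fst[OF gderiv[OF assms(1)]] assms by (intro gderiv_unique) auto
  then show ?thesis using f'(2)[of x x'] assms by auto
qed

lemma strongly_concave_ineq:
  assumes "(x, y) \<in> U" "y' \<in> UY"
  shows "\<phi> (x, y') \<le> \<phi> (x, y) + snd (\<phi>' (x, y)) \<bullet> (y' - y) - \<mu> / 2 * (norm (y' - y))\<^sup>2"
proof -
  obtain f' where f': "\<And>y. y \<in> UY \<Longrightarrow> GDERIV (\<lambda>y. - \<phi> (x, y)) y :> f' y"
    "\<And>y y'. y \<in> UY \<Longrightarrow> y' \<in> UY \<Longrightarrow> - \<phi> (x, y') \<ge> - \<phi> (x, y) + f' y \<bullet> (y' - y) + \<mu> / 2 * (norm (y' - y))\<^sup>2"
  proof -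
    have "x \<in> UX" using assms by simp
    then have "strongly_convex_on \<mu> UY (\<lambda>y. - \<phi> (x, y))"
      using scsc by (auto simp: strongly_convex_concave_on_def strongly_concave_on_def)
    then show ?thesis unfolding strongly_convex_on_def using that by blast
  qed
  have "f' y = - snd (\<phi>' (x, y))"
    using f'(1)[of y] GDERIV_minus[OF gderiv_snd[OF gderiv[OF assms(1)]]] assms
    by (intro gderiv_unique) auto
  then show ?thesis using f'(2)[of y y'] assms by (auto simp: inner_minus_left)
qed

text \<open>Convexity in the first and concavity in the second variable are both linearised at
  \<open>z\<close>, so that \<open>\<phi> z\<close> cancels. The second point \<open>w\<close> is an
  arbitrary point of \<open>U\<close>, which later permits shifted saddle points.\<close>

lemma gradient_monotonicity:
  assumes "z \<in> U" "w \<in> U"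
  shows "\<phi> (fst z, snd w) - \<phi> (fst w, snd z) + \<mu> / 2 * (norm (z - w))\<^sup>2 \<le> \<phi>' z \<bullet> flip_snd (z - w)"
proof -
  obtain x y x' y' where z: "z = (x, y)" and w: "w = (x', y')" by (metis surj_pair)
  have "\<phi> (x', y) \<ge> \<phi> (x, y) + fst (\<phi>' (x, y)) \<bullet> (x' - x) + \<mu> / 2 * (norm (x' - x))\<^sup>2"
    using assms by (intro strongly_convex_ineq) (auto simp: z w)
  moreover have "\<phi> (x, y') \<le> \<phi> (x, y) + snd (\<phi>' (x, y)) \<bullet> (y' - y) - \<mu> / 2 * (norm (y' - y))\<^sup>2"
    using assms by (intro strongly_concave_ineq) (auto simp: z w)
  moreover have "(norm (z - w))\<^sup>2 = (norm (x' - x))\<^sup>2 + (norm (y' - y))\<^sup>2"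
    by (simp add: z w norm_prod_def norm_minus_commute)
  moreover have "\<phi>' z \<bullet> flip_snd (z - w) = - (fst (\<phi>' (x, y)) \<bullet> (x' - x)) + snd (\<phi>' (x, y)) \<bullet> (y' - y)"
    by (simp add: z w flip_snd_def inner_prod_def inner_diff_right)
  ultimately show ?thesis by (simp add: z w algebra_simps)
qed

lemma second_difference:
  assumes w: "w \<in> Z" and v: "norm v \<le> 1"
  shows "\<bar>\<phi> (w + \<tau> *\<^sub>R v) + \<phi> (w - \<tau> *\<^sub>R v) - 2 * \<phi> w\<bar> \<le> L * \<tau>\<^sup>2"
proof -
  have n: "norm (s *\<^sub>R v) \<le> 1" if "0 \<le> s" "s \<le> 1" for s
    using that v mult_mono[of s 1 "norm v" 1] by simp
  have "\<bar>\<phi> (w + \<tau> *\<^sub>R v) + \<phi> (w - \<tau> *\<^sub>R v) - 2 * \<phi> w\<bar> \<le> L * (norm (\<tau> *\<^sub>R v))\<^sup>2"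
  proof (rule second_difference_le[OF gderiv grad_lip])
    show "w + s *\<^sub>R \<tau> *\<^sub>R v \<in> U" "w - s *\<^sub>R \<tau> *\<^sub>R v \<in> U" if "0 \<le> s" "s \<le> 1" for s
      using nbhd[OF w n[OF that]] nbhd_minus[OF w n[OF that]] by (simp_all only: scaleR_left_commute)
  qed
  also have "\<dots> \<le> L * (\<tau> * 1)\<^sup>2"
    using pos v by (intro mult_left_mono power_mono) auto
  finally show ?thesis by simp
qed

section \<open>The gap with respect to the saddle point\<close>

definition gap :: "'a \<times> 'b \<Rightarrow> real" where
  "gap z = \<phi> (fst z, ys) - \<phi> (xs, snd z)"

lemma gap_add_le: "z \<in> Z \<Longrightarrow> gap z + \<mu> / 2 * (norm (z - zs))\<^sup>2 \<le> M * norm (z - zs)"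
proof -
  assume z: "z \<in> Z"
  have "gap z + \<mu> / 2 * (norm (z - zs))\<^sup>2 \<le> \<phi>' z \<bullet> flip_snd (z - zs)"
    using gradient_monotonicity[of z zs] z zs_in_Z Z_subset_U by (auto simp: gap_def)
  also have "\<dots> \<le> norm (\<phi>' z) * norm (z - zs)"
    using norm_cauchy_schwarz[of "\<phi>' z" "flip_snd (z - zs)"] by simp
  also have "\<dots> \<le> M * norm (z - zs)"
    using z by (intro mult_right_mono norm_gradient_le Z_subset_U) auto
  finally show ?thesis .
qed

lemma gap_ge: "z \<in> Z \<Longrightarrow> \<mu> / 2 * (norm (z - zs))\<^sup>2 \<le> gap z"
proof -
  assume z: "z \<in> Z"
  obtain x y where xy: "z = (x, y)" "x \<in> X" "y \<in> Y" using z by auto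
  have XU: "u \<in> X \<Longrightarrow> v \<in> Y \<Longrightarrow> u \<in> UX \<and> v \<in> UY" for u v using Z_subset_U[of "(u, v)"] by auto
  have xsys: "xs \<in> X" "ys \<in> Y" using zs_in_Z by auto
  have "\<phi> (xs, ys) + \<mu> / 2 * (norm (x - xs))\<^sup>2 \<le> \<phi> (x, ys)"
  proof (rule strong_minimum[where S=X and f'="\<lambda>x. fst (\<phi>' (x, ys))"])
    show "\<phi> (v, ys) \<ge> \<phi> (u, ys) + fst (\<phi>' (u, ys)) \<bullet> (v - u) + \<mu> / 2 * (norm (v - u))\<^sup>2"
      if "u \<in> X" "v \<in> X" for u v
      using that XU xsys by (intro strongly_convex_ineq) auto
    show "\<phi> (xs, ys) \<le> \<phi> (u, ys)" if "u \<in> X" for u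
      using saddle that xsys unfolding saddle_point_def by blast
  qed (use X xsys xy pos in auto)
  moreover have "- \<phi> (xs, ys) + \<mu> / 2 * (norm (y - ys))\<^sup>2 \<le> - \<phi> (xs, y)"
  proof (rule strong_minimum[where S=Y and f="\<lambda>y. - \<phi> (xs, y)" and f'="\<lambda>y. - snd (\<phi>' (xs, y))"])
    show "- \<phi> (xs, v) \<ge> - \<phi> (xs, u) + - snd (\<phi>' (xs, u)) \<bullet> (v - u) + \<mu> / 2 * (norm (v - u))\<^sup>2"
      if "u \<in> Y" "v \<in> Y" for u v
      using strongly_concave_ineq[of xs u v] that XU xsys by (auto simp: inner_minus_left)
    show "- \<phi> (xs, ys) \<le> - \<phi> (xs, u)" if "u \<in> Y" for u
      using saddle that xsys unfolding saddle_point_def by auto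
  qed (use Y xsys xy pos in auto)
  ultimately show ?thesis
    by (simp add: gap_def xy norm_prod_def algebra_simps)
qed

text \<open>A strongly convex-concave function that is Lipschitz cannot live on a large set:
  \<open>gap_add_le\<close> and \<open>gap_ge\<close> each contribute \<open>\<mu> / 2\<close>, so
  \<open>\<mu> * r\<^sup>2 \<le> M * r\<close> for the distance \<open>r\<close> to the saddle
  point.\<close>

lemma dist_saddle_le: "z \<in> Z \<Longrightarrow> norm (z - zs) \<le> M / \<mu>"
proof -
  assume z: "z \<in> Z"
  have "\<mu> * norm (z - zs) * norm (z - zs) \<le> M * norm (z - zs)"
    using gap_add_le[OF z] gap_ge[OF z] by (simp add: power2_eq_square)
  then have "\<mu> * norm (z - zs) \<le> M"
    using pos by (cases "norm (z - zs) = 0") auto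
  then show ?thesis using pos by (simp add: field_simps)
qed

text \<open>The right-hand side is the maximum of \<open>M * r - \<mu> / 2 * r\<^sup>2\<close> over
  all \<open>r\<close>, found by completing the square.\<close>

lemma gap_le: "z \<in> Z \<Longrightarrow> gap z \<le> M\<^sup>2 / (2 * \<mu>)"
proof -
  assume z: "z \<in> Z"
  let ?r = "norm (z - zs)"
  have "0 \<le> (M - \<mu> * ?r)\<^sup>2 / (2 * \<mu>)" using pos by simp
  also have "\<dots> = M\<^sup>2 / (2 * \<mu>) - (M * ?r - \<mu> / 2 * ?r\<^sup>2)"
    using pos by (simp add: power2_eq_square field_simps)
  finally show ?thesis using gap_add_le[OF z] by linarith
qed

text \<open>Jensen's inequality from tangents: both terms of the gap are linearised at the average
  \<open>zb\<close>, and the linear terms add up to 0 over \<open>I\<close>.\<close>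

lemma gap_average_le:
  assumes fin: "finite I" "I \<noteq> {}" and z: "\<And>i. i \<in> I \<Longrightarrow> z i \<in> Z"
  shows "gap ((1 / real (card I)) *\<^sub>R (\<Sum>i\<in>I. z i)) \<le> (\<Sum>i\<in>I. gap (z i)) / real (card I)"
    and "(1 / real (card I)) *\<^sub>R (\<Sum>i\<in>I. z i) \<in> Z"
proof -
  let ?c = "real (card I)"
  define zb where "zb = (1 / ?c) *\<^sub>R (\<Sum>i\<in>I. z i)"
  have c: "?c > 0" using fin by (simp add: card_gt_0_iff)
  have zb: "zb \<in> Z"
  proof -
    have "(\<Sum>i\<in>I. (1 / ?c) *\<^sub>R z i) \<in> Z"
      using fin z c by (intro convex_sum convex_Times X Y) auto
    then show ?thesis by (simp add: zb_def scaleR_sum_right)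
  qed
  show "(1 / ?c) *\<^sub>R (\<Sum>i\<in>I. z i) \<in> Z" using zb by (simp add: zb_def)
  have zU: "fst w \<in> UX" "snd w \<in> UY" if "w \<in> Z" for w using Z_subset_U[OF that] by auto
  have zsU: "xs \<in> UX" "ys \<in> UY" using zU[OF zs_in_Z] by auto
  define a where "a = fst (\<phi>' (fst zb, ys))"
  define b where "b = snd (\<phi>' (xs, snd zb))"
  have each: "gap zb + (a \<bullet> fst (z i - zb) - b \<bullet> snd (z i - zb)) \<le> gap (z i)" if i: "i \<in> I" for i
  proof -
    have "\<phi> (fst (z i), ys) \<ge> \<phi> (fst zb, ys) + a \<bullet> (fst (z i) - fst zb) + \<mu> / 2 * (norm (fst (z i) - fst zb))\<^sup>2"
      unfolding a_def using zU[OF zb] zU[OF z[OF i]] zsU by (intro strongly_convex_ineq) auto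
    moreover have "\<phi> (xs, snd (z i)) \<le> \<phi> (xs, snd zb) + b \<bullet> (snd (z i) - snd zb) - \<mu> / 2 * (norm (snd (z i) - snd zb))\<^sup>2"
      unfolding b_def using zU[OF zb] zU[OF z[OF i]] zsU by (intro strongly_concave_ineq) auto
    moreover have "\<mu> / 2 * (norm (fst (z i) - fst zb))\<^sup>2 \<ge> 0" "\<mu> / 2 * (norm (snd (z i) - snd zb))\<^sup>2 \<ge> 0"
      using pos by auto
    ultimately show ?thesis unfolding gap_def fst_diff snd_diff by linarith
  qed
  have "(\<Sum>i\<in>I. z i - zb) = 0"
    using c by (simp add: sum_subtractf zb_def sum_constant_scaleR)
  then have "(\<Sum>i\<in>I. a \<bullet> fst (z i - zb)) = 0" "(\<Sum>i\<in>I. b \<bullet> snd (z i - zb)) = 0"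
    by (simp_all only: fst_zero snd_zero inner_zero_right flip: inner_sum_right fst_sum snd_sum)
  then have "?c * gap zb = (\<Sum>i\<in>I. gap zb + (a \<bullet> fst (z i - zb) - b \<bullet> snd (z i - zb)))"
    by (simp add: sum.distrib sum_subtractf)
  also have "\<dots> \<le> (\<Sum>i\<in>I. gap (z i))" by (intro sum_mono each)
  finally have "gap zb \<le> (\<Sum>i\<in>I. gap (z i)) / ?c" using c by (simp add: field_simps)
  then show "gap ((1 / ?c) *\<^sub>R (\<Sum>i\<in>I. z i)) \<le> (\<Sum>i\<in>I. gap (z i)) / ?c"
    by (simp only: zb_def)
qed

end

section \<open>Moments of the gradient estimator\<close>

lemma indep_rv_distr_Pair:
  fixes A :: "'w \<Rightarrow> 'a::second_countable_topology" and B :: "'w \<Rightarrow> 'b::second_countable_topology"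
  assumes P: "prob_space P" and indep: "indep_rv P A B"
  shows "distr P borel (\<lambda>\<omega>. (A \<omega>, B \<omega>)) = distr P borel A \<Otimes>\<^sub>M distr P borel B"
proof -
  interpret prob_space P by fact
  have [measurable]: "A \<in> borel_measurable P" "B \<in> borel_measurable P"
    and ind: "indep_set {A -` S \<inter> space P | S. S \<in> sets borel} {B -` S \<inter> space P | S. S \<in> sets borel}"
    using indep by (auto simp: indep_rv_def)
  interpret A: prob_space "distr P borel A" by (rule prob_space_distr) simp
  interpret B: prob_space "distr P borel B" by (rule prob_space_distr) simp
  have AB [measurable]: "(\<lambda>\<omega>. (A \<omega>, B \<omega>)) \<in> borel_measurable P" by measurable
  have "distr P borel A \<Otimes>\<^sub>M distr P borel B = distr P borel (\<lambda>\<omega>. (A \<omega>, B \<omega>))"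
  proof (rule pair_measure_eqI)
    show "sigma_finite_measure (distr P borel A)" "sigma_finite_measure (distr P borel B)"
      by unfold_locales
    have "sets (distr P borel A \<Otimes>\<^sub>M distr P borel B) = sets (borel \<Otimes>\<^sub>M borel)"
      by (intro sets_pair_measure_cong) auto
    then show "sets (distr P borel A \<Otimes>\<^sub>M distr P borel B) = sets (distr P borel (\<lambda>\<omega>. (A \<omega>, B \<omega>)))"
      by (simp only: borel_prod sets_distr)
    fix S T assume "S \<in> sets (distr P borel A)" "T \<in> sets (distr P borel B)"
    then have S [measurable]: "S \<in> sets borel" and T [measurable]: "T \<in> sets borel" by auto
    have "S \<times> T \<in> sets (borel \<Otimes>\<^sub>M borel)" by measurable
    then have ST: "S \<times> T \<in> sets borel" by (simp only: borel_prod)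
    have "prob ((A -` S \<inter> space P) \<inter> (B -` T \<inter> space P)) = prob (A -` S \<inter> space P) * prob (B -` T \<inter> space P)"
      using S T by (intro indep_setD[OF ind]) auto
    moreover have "(\<lambda>\<omega>. (A \<omega>, B \<omega>)) -` (S \<times> T) \<inter> space P = (A -` S \<inter> space P) \<inter> (B -` T \<inter> space P)"
      by auto
    ultimately show "emeasure (distr P borel A) S * emeasure (distr P borel B) T
        = emeasure (distr P borel (\<lambda>\<omega>. (A \<omega>, B \<omega>))) (S \<times> T)"
      using ST by (simp add: emeasure_distr emeasure_eq_measure ennreal_mult')
  qed
  then show ?thesis by simp
qed

text \<open>Freezing: given \<open>A\<close>, an independent \<open>B\<close> is integrated with its
  own law. It is applied with the current iterate as \<open>A\<close> and the fresh sample as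
  \<open>B\<close>, or with direction and noise.\<close>

lemma indep_rv_expectation:
  fixes A :: "'w \<Rightarrow> 'a::second_countable_topology" and B :: "'w \<Rightarrow> 'b::second_countable_topology"
    and f :: "'a \<times> 'b \<Rightarrow> real"
  assumes P: "prob_space P" and indep: "indep_rv P A B" and f: "f \<in> borel_measurable borel"
    and int: "integrable P (\<lambda>\<omega>. f (A \<omega>, B \<omega>))"
  shows "(\<integral>\<omega>. f (A \<omega>, B \<omega>) \<partial>P) = (\<integral>\<omega>. (\<integral>\<omega>'. f (A \<omega>, B \<omega>') \<partial>P) \<partial>P)"
    and "integrable P (\<lambda>\<omega>. \<integral>\<omega>'. f (A \<omega>, B \<omega>') \<partial>P)"
proof -
  interpret prob_space P by fact
  have AB [measurable]: "A \<in> borel_measurable P" "B \<in> borel_measurable P"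
    using indep by (auto simp: indep_rv_def)
  interpret A: prob_space "distr P borel A" by (rule prob_space_distr) simp
  interpret B: prob_space "distr P borel B" by (rule prob_space_distr) simp
  interpret AxB: pair_sigma_finite "distr P borel A" "distr P borel B" ..
  have f' [measurable]: "f \<in> borel_measurable (borel \<Otimes>\<^sub>M borel)" using f by (simp add: borel_prod)
  have 1: "integrable (distr P borel A \<Otimes>\<^sub>M distr P borel B) f"
    using int f unfolding indep_rv_distr_Pair[OF P indep, symmetric] by (subst integrable_distr_eq) auto
  have inner: "(\<integral>b. f (a, b) \<partial>distr P borel B) = (\<integral>\<omega>'. f (a, B \<omega>') \<partial>P)" for a
    by (subst integral_distr) auto
  have "(\<lambda>(a, b). f (a, b)) \<in> borel_measurable (borel \<Otimes>\<^sub>M distr P borel B)"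
    by simp
  then have [measurable]: "(\<lambda>a. \<integral>b. f (a, b) \<partial>distr P borel B) \<in> borel_measurable borel"
    by (rule B.borel_measurable_lebesgue_integral)
  have "(\<integral>\<omega>. f (A \<omega>, B \<omega>) \<partial>P) = (\<integral>x. f x \<partial>distr P borel (\<lambda>\<omega>. (A \<omega>, B \<omega>)))"
    using f by (subst integral_distr) auto
  also have "\<dots> = (\<integral>a. \<integral>b. f (a, b) \<partial>distr P borel B \<partial>distr P borel A)"
    unfolding indep_rv_distr_Pair[OF P indep] by (rule AxB.integral_fst'[symmetric, OF 1])
  also have "\<dots> = (\<integral>\<omega>. \<integral>b. f (A \<omega>, b) \<partial>distr P borel B \<partial>P)"
    by (subst integral_distr) auto
  finally show "(\<integral>\<omega>. f (A \<omega>, B \<omega>) \<partial>P) = (\<integral>\<omega>. (\<integral>\<omega>'. f (A \<omega>, B \<omega>') \<partial>P) \<partial>P)"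
    by (simp only: inner)
  have "integrable (distr P borel A) (\<lambda>a. \<integral>b. f (a, b) \<partial>distr P borel B)"
    by (rule AxB.integrable_fst'[OF 1])
  then show "integrable P (\<lambda>\<omega>. \<integral>\<omega>'. f (A \<omega>, B \<omega>') \<partial>P)"
    by (subst (asm) integrable_distr_eq) (auto simp: inner)
qed

section \<open>Symmetric increments and their averages over the sphere\<close>

context saddle_problem
begin

text \<open>The data are controlled on \<open>U\<close> only. Since \<open>U\<close> is open,
  extension by 0 makes them Borel functions on the whole space without changing derivatives in
  \<open>U\<close>.\<close>

definition zero_ext :: "('a \<times> 'b \<Rightarrow> 'c::real_vector) \<Rightarrow> 'a \<times> 'b \<Rightarrow> 'c" where
  "zero_ext f z = indicator U z *\<^sub>R f z"

lemma zero_ext_in_U [simp]: "z \<in> U \<Longrightarrow> zero_ext f z = f z"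
  by (simp add: zero_ext_def)

lemma zero_ext_measurable:
  fixes f :: "'a \<times> 'b \<Rightarrow> 'c::real_normed_vector"
  assumes "f \<in> borel_measurable (restrict_space borel U)"
  shows "zero_ext f \<in> borel_measurable borel"
proof -
  have "U \<in> sets borel" using open_U by simp
  then show ?thesis
    using assms unfolding zero_ext_def[abs_def]
    by (subst (asm) borel_measurable_restrict_space_iff) auto
qed

lemma zero_ext_continuous_measurable:
  fixes f :: "'a \<times> 'b \<Rightarrow> 'c::real_normed_vector"
  assumes "continuous_on U f"
  shows "zero_ext f \<in> borel_measurable borel"
  using assms by (intro zero_ext_measurable borel_measurable_continuous_on_restrict)

lemma zero_ext_gderiv: "z \<in> U \<Longrightarrow> GDERIV (zero_ext \<phi>) z :> \<phi>' z"
  unfolding gderiv_def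
  by (rule has_derivative_transform_within_open[OF gderiv[unfolded gderiv_def] open_U]) auto

definition increment :: "('a \<times> 'b \<Rightarrow> real) \<Rightarrow> 'a \<times> 'b \<Rightarrow> 'a \<times> 'b \<Rightarrow> real" where
  "increment f z e = zero_ext f (z + \<tau> *\<^sub>R e) - zero_ext f (z - \<tau> *\<^sub>R e)"

lemma increment_measurable:
  assumes [measurable]: "zero_ext f \<in> borel_measurable borel"
  shows "increment f z \<in> borel_measurable borel"
  unfolding increment_def by measurable

lemma phi_measurable: "zero_ext \<phi> \<in> borel_measurable borel"
  by (rule zero_ext_continuous_measurable[OF lipschitz_on_continuous_on[OF lip]])

lemma phi'_measurable: "zero_ext \<phi>' \<in> borel_measurable borel"
  by (rule zero_ext_continuous_measurable[OF lipschitz_on_continuous_on[OF grad_lip]])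

definition increment_gradient :: "'a \<times> 'b \<Rightarrow> 'a \<times> 'b \<Rightarrow> 'a \<times> 'b" where
  "increment_gradient z e = \<tau> *\<^sub>R (zero_ext \<phi>' (z + \<tau> *\<^sub>R e) + zero_ext \<phi>' (z - \<tau> *\<^sub>R e))"

lemma increment_smooth:
  assumes z: "z \<in> Z"
  shows "smooth_on_unit_ball (increment \<phi> z) (increment_gradient z) (2 * \<tau> * M)"
proof
  note [measurable] = phi'_measurable phi_measurable
  show "increment \<phi> z \<in> borel_measurable borel" "increment_gradient z \<in> borel_measurable borel"
    unfolding increment_gradient_def increment_def by measurable
  fix x :: "'a \<times> 'b" assume x: "norm x \<le> 1"
  note U = nbhd[OF z x] nbhd_minus[OF z x]
  have 1: "((\<lambda>x. z + \<tau> *\<^sub>R x) has_derivative (\<lambda>h. \<tau> *\<^sub>R h)) (at x)"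
    "((\<lambda>x. z - \<tau> *\<^sub>R x) has_derivative (\<lambda>h. - (\<tau> *\<^sub>R h))) (at x)"
    by (auto intro!: derivative_eq_intros)
  show "GDERIV (increment \<phi> z) x :> increment_gradient z x"
    unfolding gderiv_def increment_def[abs_def]
    by (rule has_derivative_eq_rhs[OF has_derivative_diff[OF
          has_derivative_compose[OF 1(1) zero_ext_gderiv[OF U(1), unfolded gderiv_def]]
          has_derivative_compose[OF 1(2) zero_ext_gderiv[OF U(2), unfolded gderiv_def]]]])
      (use U in \<open>simp add: increment_gradient_def inner_add_right fun_eq_iff algebra_simps\<close>)
  have "norm (increment_gradient z x) \<le> \<tau> * (norm (\<phi>' (z + \<tau> *\<^sub>R x)) + norm (\<phi>' (z - \<tau> *\<^sub>R x)))"
    unfolding increment_gradient_def using U pos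
    by (simp add: norm_triangle_ineq)
  also have "\<dots> \<le> \<tau> * (M + M)"
    using U pos by (intro mult_left_mono add_mono norm_gradient_le) auto
  finally show "norm (increment_gradient z x) \<le> 2 * \<tau> * M" by simp
qed

text \<open>The bound holds pointwise before averaging. Monotonicity is applied to \<open>z\<close>
  and \<open>zs\<close> shifted by the same vector, for both signs of the shift. The sum contains
  the second differences of \<open>\<phi>\<close> at the two mixed points of the gap; each costs
  \<open>L * \<tau>\<^sup>2\<close>, and halving leaves one of them.\<close>

lemma increment_first_moment:
  assumes z: "z \<in> Z"
  shows "gap z + \<mu> / 2 * (norm (z - zs))\<^sup>2 - L * \<tau>\<^sup>2
    \<le> real DIM('a \<times> 'b) / (2 * \<tau>) * (\<integral>e. increment \<phi> z e * (e \<bullet> flip_snd (z - zs)) \<partial>uniform_sphere)"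
proof -
  interpret smooth_on_unit_ball "increment \<phi> z" "increment_gradient z" "2 * \<tau> * M"
    by (rule increment_smooth[OF z])
  have "2 * \<tau> * (gap z + \<mu> / 2 * (norm (z - zs))\<^sup>2 - L * \<tau>\<^sup>2)
      \<le> real DIM('a \<times> 'b) * (\<integral>e. increment \<phi> z e * (e \<bullet> flip_snd (z - zs)) \<partial>uniform_sphere)"
  proof (rule sphere_first_moment_ge)
    fix x :: "'a \<times> 'b" assume "norm x < 1"
    then have x: "norm x \<le> 1" by simp
    define w1 where "w1 = (fst z, ys)"
    define w2 where "w2 = (xs, snd z)"
    have w: "w1 \<in> Z" "w2 \<in> Z" using z zs_in_Z by (auto simp: w1_def w2_def)
    have step: "\<phi> (w1 + u) - \<phi> (w2 + u) + \<mu> / 2 * (norm (z - zs))\<^sup>2 \<le> \<phi>' (z + u) \<bullet> flip_snd (z - zs)"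
      if "z + u \<in> U" "zs + u \<in> U" for u
      using gradient_monotonicity[OF that] unfolding add_diff_cancel_right
      by (cases u) (simp add: w1_def w2_def)
    have 1: "\<phi> (w1 + \<tau> *\<^sub>R x) - \<phi> (w2 + \<tau> *\<^sub>R x) + \<mu> / 2 * (norm (z - zs))\<^sup>2
        \<le> \<phi>' (z + \<tau> *\<^sub>R x) \<bullet> flip_snd (z - zs)"
      by (intro step nbhd z zs_in_Z x)
    have 2: "\<phi> (w1 - \<tau> *\<^sub>R x) - \<phi> (w2 - \<tau> *\<^sub>R x) + \<mu> / 2 * (norm (z - zs))\<^sup>2
        \<le> \<phi>' (z - \<tau> *\<^sub>R x) \<bullet> flip_snd (z - zs)"
      using step[of "- (\<tau> *\<^sub>R x)"] nbhd_minus[OF z x] nbhd_minus[OF zs_in_Z x] by simp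
    have "\<phi> w1 - \<phi> w2 = gap z" by (simp add: gap_def w1_def w2_def)
    then have "2 * gap z + \<mu> * (norm (z - zs))\<^sup>2 - 2 * (L * \<tau>\<^sup>2)
        \<le> \<phi>' (z + \<tau> *\<^sub>R x) \<bullet> flip_snd (z - zs) + \<phi>' (z - \<tau> *\<^sub>R x) \<bullet> flip_snd (z - zs)"
      using 1 2 second_difference[OF w(1) x] second_difference[OF w(2) x] by (simp add: abs_le_iff)
    then have "\<tau> * (2 * gap z + \<mu> * (norm (z - zs))\<^sup>2 - 2 * (L * \<tau>\<^sup>2))
        \<le> \<tau> * (\<phi>' (z + \<tau> *\<^sub>R x) \<bullet> flip_snd (z - zs) + \<phi>' (z - \<tau> *\<^sub>R x) \<bullet> flip_snd (z - zs))"
      using pos by (intro mult_left_mono) auto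
    also have "\<dots> = increment_gradient z x \<bullet> flip_snd (z - zs)"
      using nbhd[OF z x] nbhd_minus[OF z x] by (simp add: increment_gradient_def inner_add_left)
    finally show "2 * \<tau> * (gap z + \<mu> / 2 * (norm (z - zs))\<^sup>2 - L * \<tau>\<^sup>2)
        \<le> increment_gradient z x \<bullet> flip_snd (z - zs)"
      by (simp add: algebra_simps)
  qed
  then show ?thesis using pos by (simp add: field_simps)
qed

text \<open>The increment is odd in the direction and \<open>2 * \<tau> * M\<close>-Lipschitz on the
  ball; the number 20 is \<open>10 / 2\<close> times the square of 2.\<close>

lemma increment_second_moment:
  assumes z: "z \<in> Z"
  shows "(\<integral>e. (increment \<phi> z e)\<^sup>2 \<partial>uniform_sphere) \<le> 20 * \<tau>\<^sup>2 * M\<^sup>2 / real DIM('a \<times> 'b)"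
proof -
  interpret smooth_on_unit_ball "increment \<phi> z" "increment_gradient z" "2 * \<tau> * M"
    by (rule increment_smooth[OF z])
  have "(\<integral>e. (increment \<phi> z e)\<^sup>2 \<partial>uniform_sphere) \<le> pi\<^sup>2 / 2 * (2 * \<tau> * M)\<^sup>2 / real DIM('a \<times> 'b)"
  proof (rule sphere_odd_second_moment[where h'="increment_gradient z"])
    show "increment \<phi> z (- x) = - increment \<phi> z x" for x by (simp add: increment_def)
  qed (use lipschitz deriv grad in auto)
  also have "\<dots> \<le> 10 / 2 * (2 * \<tau> * M)\<^sup>2 / real DIM('a \<times> 'b)"
    using pi_square_less_10 by (intro divide_right_mono mult_right_mono) auto
  finally show ?thesis by (simp add: power_mult_distrib mult_ac)
qed

lemma increment_le:
  assumes "z \<in> Z" "norm e = 1"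
  shows "\<bar>increment \<phi> z e\<bar> \<le> 2 * \<tau> * M"
proof -
  have U: "z + \<tau> *\<^sub>R e \<in> U" "z - \<tau> *\<^sub>R e \<in> U" using assms by (simp_all only: nbhd nbhd_minus order_refl)
  have "(z + \<tau> *\<^sub>R e) - (z - \<tau> *\<^sub>R e) = (2 * \<tau>) *\<^sub>R e" by (simp add: scaleR_2 flip: scaleR_scaleR)
  then show ?thesis
    using lipschitz_onD[OF lip U] U pos assms by (simp add: increment_def dist_norm mult_ac)
qed

text \<open>It agrees with \<open>gradient_estimator\<close> when both query points lie in
  \<open>U\<close>, and the zero extensions make it jointly measurable. The sample is packed into
  one triple because the iterations are independent as triples.\<close>

definition estimator :: "('a \<times> 'b \<Rightarrow> real) \<Rightarrow> 'a \<times> 'b \<Rightarrow> ('a \<times> 'b) \<times> real \<times> real \<Rightarrow> 'a \<times> 'b" where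
  "estimator \<delta> z = (\<lambda>(e, p, m). (real DIM('a \<times> 'b) / (2 * \<tau>) * (increment \<phi> z e + increment \<delta> z e + (p - m)))
      *\<^sub>R flip_snd e)"

end

text \<open>One iteration in isolation: the query point is deterministic here and becomes random
  only after freezing.\<close>

locale oracle_sample = saddle_problem X Y UX UY \<phi> \<phi>' \<tau> \<mu> M L xs ys + prob_space P
  for X :: "'a::euclidean_space set" and Y :: "'b::euclidean_space set"
    and UX UY \<phi> \<phi>' \<tau> \<mu> M L xs ys and P :: "'w measure" +
  fixes \<delta> :: "'a \<times> 'b \<Rightarrow> real" and \<Delta> \<sigma> :: real
    and e :: "'w \<Rightarrow> 'a \<times> 'b" and p m :: "'w \<Rightarrow> real"
  assumes \<delta>_meas: "\<delta> \<in> borel_measurable (restrict_space borel (UX \<times> UY))"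
    and \<delta>_bound: "\<And>w. w \<in> UX \<times> UY \<Longrightarrow> \<bar>\<delta> w\<bar> \<le> \<Delta>"
    and e_sphere: "\<And>\<omega>. \<omega> \<in> space P \<Longrightarrow> norm (e \<omega>) = 1"
    and e_unif: "distr P borel e = uniform_sphere"
    and noise: "oracle_noise P \<sigma> p" "oracle_noise P \<sigma> m"
    and indep_direction: "indep_rv P e (\<lambda>\<omega>. (p \<omega>, m \<omega>))"
    and indep_noise: "indep_var borel p borel m"
begin

lemma sample_measurable [measurable]:
  "e \<in> borel_measurable P" "p \<in> borel_measurable P" "m \<in> borel_measurable P"
  using indep_direction noise by (auto simp: indep_rv_def oracle_noise_def)

lemma noise_integrable:
  "integrable P p" "integrable P m" "integrable P (\<lambda>\<omega>. (p \<omega>)\<^sup>2)" "integrable P (\<lambda>\<omega>. (m \<omega>)\<^sup>2)"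
  using noise by (auto simp: oracle_noise_def)

lemma integral_direction:
  fixes f :: "'a \<times> 'b \<Rightarrow> real"
  assumes [measurable]: "f \<in> borel_measurable borel"
  shows "(\<integral>\<omega>. f (e \<omega>) \<partial>P) = (\<integral>x. f x \<partial>uniform_sphere)"
  unfolding e_unif[symmetric] by (subst integral_distr) auto

lemma delta_measurable: "zero_ext \<delta> \<in> borel_measurable borel"
  by (rule zero_ext_measurable[OF \<delta>_meas])

lemma \<Delta>_nonneg: "\<Delta> \<ge> 0"
  using \<delta>_bound[OF Z_subset_U[OF zs_in_Z]] by linarith

lemma delta_increment_le:
  assumes "z \<in> Z" "norm x = 1"
  shows "\<bar>increment \<delta> z x\<bar> \<le> 2 * \<Delta>"
proof -
  have U: "z + \<tau> *\<^sub>R x \<in> U" "z - \<tau> *\<^sub>R x \<in> U" using assms by (simp_all only: nbhd nbhd_minus order_refl)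
  then show ?thesis using \<delta>_bound[OF U(1)] \<delta>_bound[OF U(2)] by (simp add: increment_def)
qed

definition signal :: "'a \<times> 'b \<Rightarrow> 'a \<times> 'b \<Rightarrow> real" where
  "signal z x = increment \<phi> z x + increment \<delta> z x"

lemma signal_measurable [measurable]: "signal z \<in> borel_measurable borel"
  using increment_measurable[OF phi_measurable] increment_measurable[OF delta_measurable]
  unfolding signal_def[abs_def] by measurable

lemma increment_borel [measurable]:
  "increment \<phi> z \<in> borel_measurable borel" "increment \<delta> z \<in> borel_measurable borel"
  by (intro increment_measurable phi_measurable delta_measurable)+

lemma signal_le: "z \<in> Z \<Longrightarrow> norm x = 1 \<Longrightarrow> \<bar>signal z x\<bar> \<le> 2 * \<tau> * M + 2 * \<Delta>"
  using increment_le[of z x] delta_increment_le[of z x] by (simp add: signal_def)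

lemma direction_integrable:
  fixes f :: "'a \<times> 'b \<Rightarrow> real"
  assumes [measurable]: "f \<in> borel_measurable borel" and bd: "\<And>x. norm x = 1 \<Longrightarrow> \<bar>f x\<bar> \<le> b"
  shows "integrable P (\<lambda>\<omega>. f (e \<omega>))"
  by (rule integrable_const_bound[of _ b]) (auto intro!: AE_I2 bd e_sphere)

text \<open>The noise pair is independent of the direction and has mean difference 0. This removes
  the noise from the first moment and the cross term from the second.\<close>

lemma direction_times_noise:
  assumes [measurable]: "f \<in> borel_measurable borel" and bd: "\<And>x. norm x = 1 \<Longrightarrow> \<bar>f x\<bar> \<le> b"
  shows "integrable P (\<lambda>\<omega>. f (e \<omega>) * (p \<omega> - m \<omega>))" "(\<integral>\<omega>. f (e \<omega>) * (p \<omega> - m \<omega>) \<partial>P) = 0"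
proof -
  show int: "integrable P (\<lambda>\<omega>. f (e \<omega>) * (p \<omega> - m \<omega>))"
  proof (rule Bochner_Integration.integrable_bound[where f="\<lambda>\<omega>. b * (p \<omega> - m \<omega>)"])
    show "AE \<omega> in P. norm (f (e \<omega>) * (p \<omega> - m \<omega>)) \<le> norm (b * (p \<omega> - m \<omega>))"
    proof (rule AE_I2)
      fix \<omega> assume "\<omega> \<in> space P"
      then have "\<bar>f (e \<omega>)\<bar> \<le> \<bar>b\<bar>" using bd[OF e_sphere] by force
      then show "norm (f (e \<omega>) * (p \<omega> - m \<omega>)) \<le> norm (b * (p \<omega> - m \<omega>))"
        by (simp add: abs_mult mult_right_mono)
    qed
  qed (use noise_integrable in auto)
  define F where "F = (\<lambda>q :: ('a \<times> 'b) \<times> real \<times> real. f (fst q) * (fst (snd q) - snd (snd q)))"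
  have "F \<in> borel_measurable (borel \<Otimes>\<^sub>M (borel \<Otimes>\<^sub>M borel))" unfolding F_def by measurable
  then have F: "F \<in> borel_measurable borel" by (simp only: borel_prod)
  have "(\<integral>\<omega>. f (e \<omega>) * (p \<omega> - m \<omega>) \<partial>P) = (\<integral>\<omega>. (\<integral>\<omega>'. f (e \<omega>) * (p \<omega>' - m \<omega>') \<partial>P) \<partial>P)"
    using indep_rv_expectation(1)[OF prob_space_axioms indep_direction F] int by (simp add: F_def)
  also have "\<dots> = 0"
    using noise noise_integrable by (simp add: oracle_noise_def)
  finally show "(\<integral>\<omega>. f (e \<omega>) * (p \<omega> - m \<omega>) \<partial>P) = 0" .
qed

lemma noise_second_moment:
  "integrable P (\<lambda>\<omega>. (p \<omega> - m \<omega>)\<^sup>2)" "(\<integral>\<omega>. (p \<omega> - m \<omega>)\<^sup>2 \<partial>P) \<le> 2 * \<sigma>\<^sup>2"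
proof -
  have eq: "(p \<omega> - m \<omega>)\<^sup>2 = (p \<omega>)\<^sup>2 + (m \<omega>)\<^sup>2 - 2 * (p \<omega> * m \<omega>)" for \<omega>
    by (simp add: power2_eq_square algebra_simps)
  have pm: "integrable P (\<lambda>\<omega>. p \<omega> * m \<omega>)"
    by (rule indep_var_integrable[OF indep_noise noise_integrable(1,2)])
  have "(\<integral>\<omega>. p \<omega> * m \<omega> \<partial>P) = (\<integral>\<omega>. p \<omega> \<partial>P) * (\<integral>\<omega>. m \<omega> \<partial>P)"
    by (rule indep_var_lebesgue_integral[OF indep_noise noise_integrable(1,2)])
  then have pm0: "(\<integral>\<omega>. p \<omega> * m \<omega> \<partial>P) = 0" using noise by (simp add: oracle_noise_def)
  show "integrable P (\<lambda>\<omega>. (p \<omega> - m \<omega>)\<^sup>2)"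
    unfolding eq using pm noise_integrable by auto
  have "(\<integral>\<omega>. (p \<omega> - m \<omega>)\<^sup>2 \<partial>P) = (\<integral>\<omega>. (p \<omega>)\<^sup>2 \<partial>P) + (\<integral>\<omega>. (m \<omega>)\<^sup>2 \<partial>P)"
    unfolding eq using pm pm0 noise_integrable by simp
  also have "\<dots> \<le> \<sigma>\<^sup>2 + \<sigma>\<^sup>2" using noise by (intro add_mono) (auto simp: oracle_noise_def)
  finally show "(\<integral>\<omega>. (p \<omega> - m \<omega>)\<^sup>2 \<partial>P) \<le> 2 * \<sigma>\<^sup>2" by simp
qed

abbreviation sample where "sample \<omega> \<equiv> (e \<omega>, p \<omega>, m \<omega>)"

lemma norm_estimator:
  assumes "\<omega> \<in> space P"
  shows "(norm (estimator \<delta> z (sample \<omega>)))\<^sup>2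
    = (real DIM('a \<times> 'b) / (2 * \<tau>))\<^sup>2 * (signal z (e \<omega>) + (p \<omega> - m \<omega>))\<^sup>2"
  using e_sphere[OF assms]
  by (simp only: estimator_def prod.case norm_scaleR norm_flip_snd power2_abs mult_1_right signal_def
      power_mult_distrib)

text \<open>The noise averages out, but \<open>\<delta>\<close> may be correlated with the
  direction; its increment is at most \<open>2 * \<Delta>\<close>, and the factor
  \<open>n / (2 * \<tau>)\<close> turns this into the bias term.\<close>

lemma estimator_inner:
  assumes z: "z \<in> Z"
  shows "gap z + \<mu> / 2 * (norm (z - zs))\<^sup>2 - L * \<tau>\<^sup>2 - real DIM('a \<times> 'b) * \<Delta> * norm (z - zs) / \<tau>
    \<le> (\<integral>\<omega>. estimator \<delta> z (sample \<omega>) \<bullet> (z - zs) \<partial>P)"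
proof -
  let ?c = "real DIM('a \<times> 'b) / (2 * \<tau>)"
  let ?v = "flip_snd (z - zs)"
  have c: "?c \<ge> 0" using pos by simp
  have vb: "\<bar>x \<bullet> ?v\<bar> \<le> norm (z - zs)" if "norm x = 1" for x
    using Cauchy_Schwarz_ineq2[of x ?v] that by simp
  have hb: "\<bar>increment \<phi> z x * (x \<bullet> ?v)\<bar> \<le> (2 * \<tau> * M) * norm (z - zs)" if "norm x = 1" for x
    unfolding abs_mult using that pos by (intro mult_mono increment_le z vb) auto
  have db: "\<bar>increment \<delta> z x * (x \<bullet> ?v)\<bar> \<le> (2 * \<Delta>) * norm (z - zs)" if "norm x = 1" for x
    unfolding abs_mult using that \<Delta>_nonneg by (intro mult_mono delta_increment_le z vb) auto
  have i1: "integrable P (\<lambda>\<omega>. increment \<phi> z (e \<omega>) * (e \<omega> \<bullet> ?v))"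
    by (rule direction_integrable[OF _ hb]) measurable
  have i2: "integrable P (\<lambda>\<omega>. increment \<delta> z (e \<omega>) * (e \<omega> \<bullet> ?v))"
    by (rule direction_integrable[OF _ db]) measurable
  have i3: "integrable P (\<lambda>\<omega>. (e \<omega> \<bullet> ?v) * (p \<omega> - m \<omega>))" "(\<integral>\<omega>. (e \<omega> \<bullet> ?v) * (p \<omega> - m \<omega>) \<partial>P) = 0"
    using direction_times_noise[of "\<lambda>x. x \<bullet> ?v", OF _ vb] by simp_all
  have "(\<integral>\<omega>. estimator \<delta> z (sample \<omega>) \<bullet> (z - zs) \<partial>P)
      = (\<integral>\<omega>. ?c * (increment \<phi> z (e \<omega>) * (e \<omega> \<bullet> ?v)) + ?c * (increment \<delta> z (e \<omega>) * (e \<omega> \<bullet> ?v))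
          + ?c * ((e \<omega> \<bullet> ?v) * (p \<omega> - m \<omega>)) \<partial>P)"
    by (simp only: estimator_def prod.case inner_scaleR_left inner_flip_snd) (simp add: algebra_simps)
  also have "\<dots> = ?c * (\<integral>\<omega>. increment \<phi> z (e \<omega>) * (e \<omega> \<bullet> ?v) \<partial>P)
      + ?c * (\<integral>\<omega>. increment \<delta> z (e \<omega>) * (e \<omega> \<bullet> ?v) \<partial>P)"
    using i1 i2 i3 by (simp del: times_divide_eq_left)
  finally have eq: "(\<integral>\<omega>. estimator \<delta> z (sample \<omega>) \<bullet> (z - zs) \<partial>P) = \<dots>" .
  have "(\<integral>\<omega>. increment \<phi> z (e \<omega>) * (e \<omega> \<bullet> ?v) \<partial>P)
      = (\<integral>x. increment \<phi> z x * (x \<bullet> ?v) \<partial>uniform_sphere)"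
    by (rule integral_direction) measurable
  then have 1: "gap z + \<mu> / 2 * (norm (z - zs))\<^sup>2 - L * \<tau>\<^sup>2
      \<le> ?c * (\<integral>\<omega>. increment \<phi> z (e \<omega>) * (e \<omega> \<bullet> ?v) \<partial>P)"
    using increment_first_moment[OF z] by simp
  have "- ((2 * \<Delta>) * norm (z - zs)) = (\<integral>\<omega>. - ((2 * \<Delta>) * norm (z - zs)) \<partial>P)"
    by (simp add: prob_space)
  also have "\<dots> \<le> (\<integral>\<omega>. increment \<delta> z (e \<omega>) * (e \<omega> \<bullet> ?v) \<partial>P)"
    using i2 by (intro integral_mono) (auto dest!: e_sphere db simp: abs_le_iff)
  finally have "?c * - ((2 * \<Delta>) * norm (z - zs)) \<le> ?c * (\<integral>\<omega>. increment \<delta> z (e \<omega>) * (e \<omega> \<bullet> ?v) \<partial>P)"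
    by (rule mult_left_mono[OF _ c])
  moreover have "?c * - ((2 * \<Delta>) * norm (z - zs)) = - (real DIM('a \<times> 'b) * \<Delta> * norm (z - zs) / \<tau>)"
    using pos by simp
  ultimately show ?thesis using 1 unfolding eq by linarith
qed

lemma estimator_norm:
  assumes z: "z \<in> Z"
  shows "(\<integral>\<omega>. (norm (estimator \<delta> z (sample \<omega>)))\<^sup>2 \<partial>P)
    \<le> 15 / 2 * real DIM('a \<times> 'b) * M\<^sup>2 + 3 * (real DIM('a \<times> 'b))\<^sup>2 * (\<sigma>\<^sup>2 + \<Delta>\<^sup>2) / \<tau>\<^sup>2"
proof -
  let ?n = "real DIM('a \<times> 'b)"
  let ?c = "?n / (2 * \<tau>)"
  have sb: "\<bar>signal z x\<bar> \<le> 2 * \<tau> * M + 2 * \<Delta>" if "norm x = 1" for x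
    using that z by (intro signal_le)
  have hb: "(increment \<phi> z x)\<^sup>2 \<le> (2 * \<tau> * M)\<^sup>2" if "norm x = 1" for x
    using increment_le[OF z that] by (metis abs_ge_zero power2_abs power_mono)
  have sq: "(signal z x)\<^sup>2 \<le> 3 / 2 * (increment \<phi> z x)\<^sup>2 + 12 * \<Delta>\<^sup>2" if "norm x = 1" for x
  proof -
    have "(increment \<delta> z x)\<^sup>2 \<le> (2 * \<Delta>)\<^sup>2"
      using delta_increment_le[OF z that] by (metis abs_ge_zero power2_abs power_mono)
    \<comment> \<open>With \<open>a\<close> and \<open>b\<close> for the two increments, the
      right-hand side minus the left is half the square of \<open>a - 2 * b\<close>. The uneven
      weights favour the part that is small by the variance bound.\<close>
    moreover have "(signal z x)\<^sup>2 \<le> 3 / 2 * (increment \<phi> z x)\<^sup>2 + 3 * (increment \<delta> z x)\<^sup>2"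
      using zero_le_power2[of "increment \<phi> z x - 2 * increment \<delta> z x"]
      by (simp add: signal_def power2_eq_square algebra_simps)
    ultimately show ?thesis by (simp add: power_mult_distrib)
  qed
  have ih: "integrable P (\<lambda>\<omega>. (increment \<phi> z (e \<omega>))\<^sup>2)"
    using hb by (intro direction_integrable[of "\<lambda>x. (increment \<phi> z x)\<^sup>2" "(2 * \<tau> * M)\<^sup>2"]) simp_all
  have isq: "integrable P (\<lambda>\<omega>. (signal z (e \<omega>))\<^sup>2)"
    using order_trans[OF sq add_mono[OF mult_left_mono[OF hb] order_refl]]
    by (intro direction_integrable[of "\<lambda>x. (signal z x)\<^sup>2" "3 / 2 * (2 * \<tau> * M)\<^sup>2 + 12 * \<Delta>\<^sup>2"]) simp_all
  have "(\<integral>\<omega>. (signal z (e \<omega>))\<^sup>2 \<partial>P) \<le> (\<integral>\<omega>. 3 / 2 * (increment \<phi> z (e \<omega>))\<^sup>2 + 12 * \<Delta>\<^sup>2 \<partial>P)"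
    using isq ih by (intro integral_mono sq e_sphere) auto
  also have "\<dots> = 3 / 2 * (\<integral>\<omega>. (increment \<phi> z (e \<omega>))\<^sup>2 \<partial>P) + 12 * \<Delta>\<^sup>2"
    using ih by (simp add: prob_space)
  also have "(\<integral>\<omega>. (increment \<phi> z (e \<omega>))\<^sup>2 \<partial>P) = (\<integral>x. (increment \<phi> z x)\<^sup>2 \<partial>uniform_sphere)"
    by (rule integral_direction) measurable
  also have "3 / 2 * (\<integral>x. (increment \<phi> z x)\<^sup>2 \<partial>uniform_sphere) + 12 * \<Delta>\<^sup>2
      \<le> 3 / 2 * (20 * \<tau>\<^sup>2 * M\<^sup>2 / ?n) + 12 * \<Delta>\<^sup>2"
    by (intro add_right_mono mult_left_mono increment_second_moment z) simp
  finally have s: "(\<integral>\<omega>. (signal z (e \<omega>))\<^sup>2 \<partial>P) \<le> 3 / 2 * (20 * \<tau>\<^sup>2 * M\<^sup>2 / ?n) + 12 * \<Delta>\<^sup>2" .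
  have "(norm (estimator \<delta> z (sample \<omega>)))\<^sup>2
      = ?c\<^sup>2 * ((signal z (e \<omega>))\<^sup>2 + (p \<omega> - m \<omega>)\<^sup>2 + 2 * (signal z (e \<omega>) * (p \<omega> - m \<omega>)))"
    if "\<omega> \<in> space P" for \<omega>
    by (simp only: norm_estimator[OF that] power2_sum mult.assoc)
  then have "(\<integral>\<omega>. (norm (estimator \<delta> z (sample \<omega>)))\<^sup>2 \<partial>P)
      = (\<integral>\<omega>. ?c\<^sup>2 * ((signal z (e \<omega>))\<^sup>2 + (p \<omega> - m \<omega>)\<^sup>2 + 2 * (signal z (e \<omega>) * (p \<omega> - m \<omega>))) \<partial>P)"
    by (intro Bochner_Integration.integral_cong) simp_all
  also have "\<dots> = ?c\<^sup>2 * ((\<integral>\<omega>. (signal z (e \<omega>))\<^sup>2 \<partial>P) + (\<integral>\<omega>. (p \<omega> - m \<omega>)\<^sup>2 \<partial>P))"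
    using isq noise_second_moment(1) direction_times_noise[of "signal z", OF _ sb] by simp
  \<comment> \<open>The noise term \<open>2 * \<sigma>\<^sup>2\<close> is enlarged to 12 times
    \<open>\<sigma>\<^sup>2\<close>, the coefficient of \<open>\<Delta>\<^sup>2\<close>, so that
    both share the factor \<open>3 * n\<^sup>2 / \<tau>\<^sup>2\<close>.\<close>
  also have "\<dots> \<le> ?c\<^sup>2 * ((3 / 2 * (20 * \<tau>\<^sup>2 * M\<^sup>2 / ?n) + 12 * \<Delta>\<^sup>2) + 6 * 2 * \<sigma>\<^sup>2)"
  proof -
    have "2 * \<sigma>\<^sup>2 \<le> 6 * 2 * \<sigma>\<^sup>2" by simp
    then show ?thesis
      by (intro mult_left_mono add_mono s order_trans[OF noise_second_moment(2)]) auto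
  qed
  also have "\<dots> = 15 / 2 * ?n * M\<^sup>2 + 3 * ?n\<^sup>2 * (\<sigma>\<^sup>2 + \<Delta>\<^sup>2) / \<tau>\<^sup>2"
  proof -
    have "k\<^sup>2 / (4 * t) * ((3 / 2 * (20 * t * M\<^sup>2 / k) + 12 * \<Delta>\<^sup>2) + 6 * 2 * \<sigma>\<^sup>2)
        = 15 / 2 * k * M\<^sup>2 + 3 * k\<^sup>2 * (\<sigma>\<^sup>2 + \<Delta>\<^sup>2) / t" if "k > 0" "t > 0" for k t :: real
      using that by (simp add: field_simps power2_eq_square)
    moreover have "?n > 0" using DIM_positive[where 'a="'a \<times> 'b"] by (simp only: of_nat_0_less_iff)
    moreover have "\<tau>\<^sup>2 > 0" using pos by simp
    moreover have "?c\<^sup>2 = ?n\<^sup>2 / (4 * \<tau>\<^sup>2)" by (simp only: power_divide power_mult_distrib) simp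
    ultimately show ?thesis by (simp only:)
  qed
  finally show ?thesis .
qed

end

section \<open>Convergence of the noisy iteration\<close>

context saddle_problem
begin

text \<open>Joint measurability in point and sample is required because the iterates are
  random.\<close>

lemma estimator_measurable:
  assumes \<delta>: "\<delta> \<in> borel_measurable (restrict_space borel U)"
  shows "(\<lambda>q. estimator \<delta> (fst q) (snd q)) \<in> borel_measurable borel"
proof -
  let ?T = "\<lambda>f :: ('a \<times> 'b) \<times> ('a \<times> 'b) \<times> real \<times> real \<Rightarrow> _. f \<in> borel_measurable borel"
  have cont: "?T (\<lambda>q. fst q + \<tau> *\<^sub>R fst (snd q))" "?T (\<lambda>q. fst q - \<tau> *\<^sub>R fst (snd q))"
    "?T (\<lambda>q. fst (snd (snd q)) - snd (snd (snd q)))"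
    "?T (\<lambda>q. (fst (fst (snd q)), - snd (fst (snd q))))"
    by (intro borel_measurable_continuous_onI continuous_intros)+
  have "?T (\<lambda>q. (real DIM('a \<times> 'b) / (2 * \<tau>) *
      (increment \<phi> (fst q) (fst (snd q)) + increment \<delta> (fst q) (fst (snd q)) + (fst (snd (snd q)) - snd (snd (snd q)))))
      *\<^sub>R (fst (fst (snd q)), - snd (fst (snd q))))"
    unfolding increment_def
    by (intro borel_measurable_scaleR borel_measurable_times borel_measurable_const cont(3,4)
        borel_measurable_add[OF borel_measurable_add] borel_measurable_diff[OF
          measurable_compose[OF cont(1) phi_measurable] measurable_compose[OF cont(2) phi_measurable]]
        borel_measurable_diff[OF measurable_compose[OF cont(1) zero_ext_measurable[OF \<delta>]]
          measurable_compose[OF cont(2) zero_ext_measurable[OF \<delta>]]])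
  then show ?thesis
    by (simp only: estimator_def case_prod_unfold flip_snd_def)
qed

lemma gap_eq_zero_ext:
  assumes "z \<in> Z"
  shows "gap z = zero_ext \<phi> (fst z, ys) - zero_ext \<phi> (xs, snd z)"
proof -
  have "(fst z, ys) \<in> U" "(xs, snd z) \<in> U" using assms zs_in_Z Z_subset_U by fastforce+
  then show ?thesis by (simp add: gap_def)
qed

lemma gap_nonneg: "z \<in> Z \<Longrightarrow> 0 \<le> gap z"
  using pos by (intro order_trans[OF _ gap_ge]) auto

lemma closed_Z: "closed Z" and convex_Z: "convex Z" and Z_nonempty: "Z \<noteq> {}" and bounded_Z: "bounded Z"
  using X Y by (auto intro: closed_Times compact_imp_closed convex_Times bounded_Times compact_imp_bounded)

lemma closest_point_Z_measurable [measurable]: "closest_point Z \<in> borel_measurable borel"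
  by (intro borel_measurable_continuous_onI continuous_on_closest_point convex_Z closed_Z Z_nonempty)

lemma dist_saddle_le_diameter: "z \<in> Z \<Longrightarrow> norm (z - zs) \<le> diameter Z"
  using diameter_bounded_bound[OF bounded_Z _ zs_in_Z] by (simp add: dist_norm)

end

locale noisy_descent_ascent = saddle_problem X Y UX UY \<phi> \<phi>' \<tau> \<mu> M L xs ys + prob_space P
  for X :: "'a::euclidean_space set" and Y :: "'b::euclidean_space set"
    and UX UY \<phi> \<phi>' \<tau> \<mu> M L xs ys and P :: "'w measure" +
  fixes \<delta> :: "'a \<times> 'b \<Rightarrow> real" and \<Delta> \<sigma> :: real
    and e :: "nat \<Rightarrow> 'w \<Rightarrow> 'a \<times> 'b" and p m :: "nat \<Rightarrow> 'w \<Rightarrow> real"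
    and z :: "nat \<Rightarrow> 'w \<Rightarrow> 'a \<times> 'b" and z0 :: "'a \<times> 'b" and N :: nat
  assumes samples: "\<And>k. k \<le> N \<Longrightarrow> oracle_sample X Y UX UY \<phi> \<phi>' \<tau> \<mu> M L xs ys P \<delta> \<Delta> \<sigma> (e k) (p k) (m k)"
    and indep_iterations: "indep_vars (\<lambda>_. borel) (\<lambda>k \<omega>. (e k \<omega>, p k \<omega>, m k \<omega>)) {..N}"
    and z0: "z0 \<in> X \<times> Y" "\<And>\<omega>. \<omega> \<in> space P \<Longrightarrow> z 0 \<omega> = z0"
    and z_step: "\<And>k \<omega>. k \<le> N \<Longrightarrow> \<omega> \<in> space P \<Longrightarrow>
      z (Suc k) \<omega> = closest_point (X \<times> Y)
        (z k \<omega> - (1 / (\<mu> * (real k + 1))) *\<^sub>R estimator \<delta> (z k \<omega>) (e k \<omega>, p k \<omega>, m k \<omega>))"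
begin

section \<open>Measurability and independence of the iterates\<close>

abbreviation W where "W k \<omega> \<equiv> (e k \<omega>, p k \<omega>, m k \<omega>)"

lemma z_in_Z: "k \<le> Suc N \<Longrightarrow> \<omega> \<in> space P \<Longrightarrow> z k \<omega> \<in> Z"
proof (cases k)
  case (Suc j)
  assume "k \<le> Suc N" "\<omega> \<in> space P"
  then show ?thesis
    using z_step[of j \<omega>] closest_point_in_set[OF closed_Z Z_nonempty] Suc by simp
qed (use z0 in auto)

lemma \<delta>_meas: "\<delta> \<in> borel_measurable (restrict_space borel U)"
  using samples[of 0] by (simp add: oracle_sample_def oracle_sample_axioms_def)

text \<open>The witness is built along the recursion. Since only samples with index below
  \<open>k\<close> enter, the fresh sample of iteration \<open>k\<close> is independent of
  \<open>z k\<close>.\<close>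

lemma z_function_of_past:
  assumes "k \<le> Suc N"
  shows "\<exists>g. g \<in> borel_measurable (PiM {..<k} (\<lambda>_. borel)) \<and>
    (\<forall>\<omega>\<in>space P. z k \<omega> = g (\<lambda>i\<in>{..<k}. W i \<omega>))"
  using assms
proof (induction k)
  case 0
  show ?case by (rule exI[of _ "\<lambda>_. z0"]) (use z0 in auto)
next
  case (Suc k)
  then obtain g where g [measurable]: "g \<in> borel_measurable (PiM {..<k} (\<lambda>_. borel))"
    and zg: "\<And>\<omega>. \<omega> \<in> space P \<Longrightarrow> z k \<omega> = g (\<lambda>i\<in>{..<k}. W i \<omega>)"
    using Suc_leD by blast
  define g1 where "g1 w = g (restrict w {..<k})" for w
  have r: "(\<lambda>w. restrict w {..<k}) \<in> PiM {..<Suc k} (\<lambda>_. borel) \<rightarrow>\<^sub>M PiM {..<k} (\<lambda>_. borel)"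
    by (rule measurable_restrict_subset) auto
  have g1 [measurable]: "g1 \<in> borel_measurable (PiM {..<Suc k} (\<lambda>_. borel))"
    unfolding g1_def by (rule measurable_compose[OF r g])
  have wk [measurable]: "(\<lambda>w. w k) \<in> borel_measurable (PiM {..<Suc k} (\<lambda>_. borel :: (('a \<times> 'b) \<times> real \<times> real) measure))"
    by (rule measurable_component_singleton) simp
  have "(\<lambda>w. (g1 w, w k)) \<in> PiM {..<Suc k} (\<lambda>_. borel) \<rightarrow>\<^sub>M borel \<Otimes>\<^sub>M borel"
    by measurable
  then have "(\<lambda>w. (g1 w, w k)) \<in> PiM {..<Suc k} (\<lambda>_. borel) \<rightarrow>\<^sub>M borel" by (simp only: borel_prod)
  from measurable_compose[OF this estimator_measurable[OF \<delta>_meas]]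
  have [measurable]: "(\<lambda>w. estimator \<delta> (g1 w) (w k)) \<in> borel_measurable (PiM {..<Suc k} (\<lambda>_. borel))"
    by simp
  define h where "h w = closest_point Z (g1 w - (1 / (\<mu> * (real k + 1))) *\<^sub>R estimator \<delta> (g1 w) (w k))" for w
  have "h \<in> borel_measurable (PiM {..<Suc k} (\<lambda>_. borel))" unfolding h_def by measurable
  moreover have "z (Suc k) \<omega> = h (\<lambda>i\<in>{..<Suc k}. W i \<omega>)" if \<omega>: "\<omega> \<in> space P" for \<omega>
  proof -
    have "restrict (\<lambda>i\<in>{..<Suc k}. W i \<omega>) {..<k} = (\<lambda>i\<in>{..<k}. W i \<omega>)" by (auto simp: fun_eq_iff)
    then have "g1 (\<lambda>i\<in>{..<Suc k}. W i \<omega>) = z k \<omega>" using zg[OF \<omega>] by (simp add: g1_def)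
    then show ?thesis using z_step[of k \<omega>] Suc.prems \<omega> by (simp add: h_def)
  qed
  ultimately show ?case by blast
qed

text \<open>Samples over the disjoint index sets \<open>{..<k}\<close> and \<open>{k}\<close> are
  independent as tuples, and preimages under \<open>z k\<close> are preimages under the tuple of the
  past.\<close>

lemma indep_past:
  assumes k: "k \<le> N"
  shows "indep_rv P (z k) (W k)"
proof -
  obtain g where g [measurable]: "g \<in> borel_measurable (PiM {..<k} (\<lambda>_. borel))"
    and zg: "\<And>\<omega>. \<omega> \<in> space P \<Longrightarrow> z k \<omega> = g (\<lambda>i\<in>{..<k}. W i \<omega>)"
    using z_function_of_past[OF le_SucI[OF k]] by blast
  let ?A = "\<lambda>\<omega>. \<lambda>i\<in>{..<k}. W i \<omega>" and ?B = "\<lambda>\<omega>. \<lambda>i\<in>{k}. W i \<omega>"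
  have iv: "indep_var (PiM {..<k} (\<lambda>_. borel)) ?A (PiM {k} (\<lambda>_. borel)) ?B"
    using k by (intro indep_var_restrict[OF indep_iterations]) auto
  then have A: "?A \<in> P \<rightarrow>\<^sub>M PiM {..<k} (\<lambda>_. borel)" and B: "?B \<in> P \<rightarrow>\<^sub>M PiM {k} (\<lambda>_. borel)"
    and ind: "indep_set (sigma_sets (space P) {?A -` S \<inter> space P | S. S \<in> sets (PiM {..<k} (\<lambda>_. borel))})
      (sigma_sets (space P) {?B -` S \<inter> space P | S. S \<in> sets (PiM {k} (\<lambda>_. borel))})"
    unfolding indep_var_eq by blast+
  have "(\<lambda>\<omega>. g (?A \<omega>)) \<in> borel_measurable P" by (rule measurable_compose[OF A g])
  then have zm: "z k \<in> borel_measurable P" by (rule measurable_cong[THEN iffD2, rotated]) (rule zg)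
  have c: "(\<lambda>w. w k) \<in> borel_measurable (PiM {k} (\<lambda>_. borel :: (('a \<times> 'b) \<times> real \<times> real) measure))"
    by (rule measurable_component_singleton) simp
  have Wm: "W k \<in> borel_measurable P" using measurable_compose[OF B c] by simp
  have "indep_set {z k -` S \<inter> space P | S. S \<in> sets borel} {W k -` S \<inter> space P | S. S \<in> sets borel}"
    unfolding indep_sets2_eq
  proof (intro conjI ballI)
    show "{z k -` S \<inter> space P | S. S \<in> sets borel} \<subseteq> events"
      "{W k -` S \<inter> space P | S. S \<in> sets borel} \<subseteq> events"
      using zm Wm by (auto intro: measurable_sets)
    fix a b assume "a \<in> {z k -` S \<inter> space P | S. S \<in> sets borel}" "b \<in> {W k -` S \<inter> space P | S. S \<in> sets borel}"
    then obtain S T where a: "a = z k -` S \<inter> space P" "S \<in> sets borel"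
      and b: "b = W k -` T \<inter> space P" "T \<in> sets borel" by blast
    have "a = ?A -` (g -` S \<inter> space (PiM {..<k} (\<lambda>_. borel))) \<inter> space P"
      using zg measurable_space[OF A] by (auto simp: a)
    then have "a \<in> sigma_sets (space P) {?A -` S \<inter> space P | S. S \<in> sets (PiM {..<k} (\<lambda>_. borel))}"
      using measurable_sets[OF g a(2)] by (intro sigma_sets.Basic) blast
    moreover have "b = ?B -` ((\<lambda>w. w k) -` T \<inter> space (PiM {k} (\<lambda>_. borel))) \<inter> space P"
      using measurable_space[OF B] by (auto simp: b)
    then have "b \<in> sigma_sets (space P) {?B -` S \<inter> space P | S. S \<in> sets (PiM {k} (\<lambda>_. borel))}"
      using measurable_sets[OF c b(2)] by (intro sigma_sets.Basic) blast
    ultimately show "prob (a \<inter> b) = prob a * prob b" by (rule indep_setD[OF ind])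
  qed
  then show ?thesis using zm Wm by (simp add: indep_rv_def)
qed

text \<open>\<open>indep_past\<close> reaches only up to \<open>k = N\<close>; the last iterate
  \<open>z (Suc N)\<close>, which occurs in the telescoping sum, is handled through the
  recursion.\<close>

lemma z_measurable: "k \<le> Suc N \<Longrightarrow> z k \<in> borel_measurable P"
proof (cases k)
  case 0
  then show ?thesis using z0 by (subst measurable_cong[of _ _ "\<lambda>_. z0"]) auto
next
  case (Suc j)
  assume "k \<le> Suc N"
  then have j: "j \<le> N" using Suc by simp
  have m [measurable]: "z j \<in> borel_measurable P" "W j \<in> borel_measurable P"
    using indep_past[OF j] by (auto simp: indep_rv_def)
  have "(\<lambda>\<omega>. (z j \<omega>, W j \<omega>)) \<in> P \<rightarrow>\<^sub>M borel \<Otimes>\<^sub>M borel" using m by (rule measurable_Pair)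
  then have "(\<lambda>\<omega>. (z j \<omega>, W j \<omega>)) \<in> borel_measurable P" by (simp only: borel_prod)
  from measurable_compose[OF this estimator_measurable[OF \<delta>_meas]]
  have [measurable]: "(\<lambda>\<omega>. estimator \<delta> (z j \<omega>) (W j \<omega>)) \<in> borel_measurable P" by simp
  have "(\<lambda>\<omega>. closest_point Z (z j \<omega> - (1 / (\<mu> * (real j + 1))) *\<^sub>R estimator \<delta> (z j \<omega>) (W j \<omega>))) \<in> borel_measurable P"
    by measurable
  then show ?thesis using z_step[OF j] by (subst Suc, subst measurable_cong) auto
qed

lemma gap_integrable:
  assumes [measurable]: "u \<in> borel_measurable P" and u: "\<And>\<omega>. \<omega> \<in> space P \<Longrightarrow> u \<omega> \<in> Z"
  shows "integrable P (\<lambda>\<omega>. gap (u \<omega>))"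
proof (rule integrable_const_bound[of _ "M\<^sup>2 / (2 * \<mu>)"])
  show "AE \<omega> in P. norm (gap (u \<omega>)) \<le> M\<^sup>2 / (2 * \<mu>)"
    using gap_le[OF u] gap_nonneg[OF u] by (intro AE_I2) simp
  have f: "(\<lambda>q::'a \<times> 'b. zero_ext \<phi> (fst q, ys) - zero_ext \<phi> (xs, snd q)) \<in> borel_measurable borel"
  proof -
    have "(\<lambda>q::'a \<times> 'b. zero_ext \<phi> (fst q, ys) - zero_ext \<phi> (xs, snd q)) \<in> borel_measurable (borel \<Otimes>\<^sub>M borel)"
      by (intro borel_measurable_diff measurable_compose[OF _ phi_measurable[folded borel_prod]]) measurable
    then show ?thesis by (simp only: borel_prod)
  qed
  have "(\<lambda>\<omega>. zero_ext \<phi> (fst (u \<omega>), ys) - zero_ext \<phi> (xs, snd (u \<omega>))) \<in> borel_measurable P"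
    using measurable_compose[OF assms(1) f] .
  then show "(\<lambda>\<omega>. gap (u \<omega>)) \<in> borel_measurable P"
    using gap_eq_zero_ext[OF u] by (subst measurable_cong) auto
qed

section \<open>Moments of the estimator along the iteration\<close>

abbreviation sqdist where "sqdist k \<omega> \<equiv> (norm (z k \<omega> - zs))\<^sup>2"
abbreviation est where "est k \<omega> \<equiv> estimator \<delta> (z k \<omega>) (W k \<omega>)"

definition bias :: real where
  "bias = L * \<tau>\<^sup>2 + real DIM('a \<times> 'b) * \<Delta> * diameter (X \<times> Y) / \<tau>"

definition variance_bound :: real where
  "variance_bound = 15 / 2 * real DIM('a \<times> 'b) * M\<^sup>2 + 3 * (real DIM('a \<times> 'b))\<^sup>2 * (\<sigma>\<^sup>2 + \<Delta>\<^sup>2) / \<tau>\<^sup>2"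

lemma z_W_measurable:
  assumes k: "k \<le> N"
  shows "z k \<in> borel_measurable P" "W k \<in> borel_measurable P" "est k \<in> borel_measurable P"
    "(\<lambda>\<omega>. norm (z k \<omega> - zs)) \<in> borel_measurable P"
proof -
  show m [measurable]: "z k \<in> borel_measurable P" "W k \<in> borel_measurable P"
    using indep_past[OF k] by (auto simp: indep_rv_def)
  show "(\<lambda>\<omega>. norm (z k \<omega> - zs)) \<in> borel_measurable P" by measurable
  have "(\<lambda>\<omega>. (z k \<omega>, W k \<omega>)) \<in> P \<rightarrow>\<^sub>M borel \<Otimes>\<^sub>M borel" using m by (rule measurable_Pair)
  then have "(\<lambda>\<omega>. (z k \<omega>, W k \<omega>)) \<in> borel_measurable P" by (simp only: borel_prod)
  from measurable_compose[OF this estimator_measurable[OF \<delta>_meas]]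
  show "est k \<in> borel_measurable P" by simp
qed

lemma sqdist_integrable: "k \<le> Suc N \<Longrightarrow> integrable P (sqdist k)"
proof (rule integrable_const_bound[of _ "(M / \<mu>)\<^sup>2"])
  assume k: "k \<le> Suc N"
  show "AE \<omega> in P. norm (sqdist k \<omega>) \<le> (M / \<mu>)\<^sup>2"
    using dist_saddle_le[OF z_in_Z[OF k]] by (intro AE_I2) (simp add: power_mono)
  have [measurable]: "z k \<in> borel_measurable P" by (rule z_measurable[OF k])
  show "sqdist k \<in> borel_measurable P" by measurable
qed

text \<open>A crude pointwise bound, made for integrability, which has to be known before the
  current iterate can be frozen.\<close>

lemma est_norm_le:
  assumes k: "k \<le> N" and \<omega>: "\<omega> \<in> space P"
  shows "(norm (est k \<omega>))\<^sup>2 \<le> 3 * (real DIM('a \<times> 'b) / (2 * \<tau>))\<^sup>2 * ((2 * \<tau> * M + 2 * \<Delta>)\<^sup>2 + (p k \<omega>)\<^sup>2 + (m k \<omega>)\<^sup>2)"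
proof -
  interpret S: oracle_sample X Y UX UY \<phi> \<phi>' \<tau> \<mu> M L xs ys P \<delta> \<Delta> \<sigma> "e k" "p k" "m k"
    by (rule samples[OF k])
  let ?c = "real DIM('a \<times> 'b) / (2 * \<tau>)"
  let ?s = "S.signal (z k \<omega>) (e k \<omega>)"
  have "\<bar>?s\<bar> \<le> 2 * \<tau> * M + 2 * \<Delta>"
    using k by (intro S.signal_le z_in_Z S.e_sphere \<omega>) simp
  then have s: "?s\<^sup>2 \<le> (2 * \<tau> * M + 2 * \<Delta>)\<^sup>2" by (metis abs_ge_zero power2_abs power_mono)
  have "(?s + (p k \<omega> - m k \<omega>))\<^sup>2 \<le> 3 * (?s\<^sup>2 + (p k \<omega>)\<^sup>2 + (m k \<omega>)\<^sup>2)"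
    using sum_squares_bound[of ?s "p k \<omega>"] zero_le_power2[of "?s + m k \<omega>"] zero_le_power2[of "p k \<omega> + m k \<omega>"]
    by (simp add: power2_eq_square algebra_simps)
  also have "\<dots> \<le> 3 * ((2 * \<tau> * M + 2 * \<Delta>)\<^sup>2 + (p k \<omega>)\<^sup>2 + (m k \<omega>)\<^sup>2)"
    using s by simp
  finally have "?c\<^sup>2 * (?s + (p k \<omega> - m k \<omega>))\<^sup>2
      \<le> ?c\<^sup>2 * (3 * ((2 * \<tau> * M + 2 * \<Delta>)\<^sup>2 + (p k \<omega>)\<^sup>2 + (m k \<omega>)\<^sup>2))"
    by (intro mult_left_mono zero_le_power2)
  then show ?thesis unfolding S.norm_estimator[OF \<omega>] by (simp only: mult.assoc mult.left_commute)
qed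

lemma est_square_integrable:
  assumes k: "k \<le> N"
  shows "integrable P (\<lambda>\<omega>. (norm (est k \<omega>))\<^sup>2)"
proof -
  interpret S: oracle_sample X Y UX UY \<phi> \<phi>' \<tau> \<mu> M L xs ys P \<delta> \<Delta> \<sigma> "e k" "p k" "m k"
    by (rule samples[OF k])
  note [measurable] = z_W_measurable[OF k]
  let ?b = "\<lambda>\<omega>. 3 * (real DIM('a \<times> 'b) / (2 * \<tau>))\<^sup>2 * ((2 * \<tau> * M + 2 * \<Delta>)\<^sup>2 + (p k \<omega>)\<^sup>2 + (m k \<omega>)\<^sup>2)"
  show ?thesis
  proof (rule Bochner_Integration.integrable_bound[where f="?b"])
    show "integrable P ?b"
      by (intro integrable_mult_right Bochner_Integration.integrable_add integrable_const S.noise_integrable)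
    show "AE \<omega> in P. norm ((norm (est k \<omega>))\<^sup>2) \<le> norm (?b \<omega>)"
      by (intro AE_I2) (simp only: real_norm_def abs_of_nonneg zero_le_power2, rule order_trans[OF est_norm_le[OF k] abs_ge_self])
  qed measurable
qed

lemma est_inner_integrable:
  assumes k: "k \<le> N"
  shows "integrable P (\<lambda>\<omega>. est k \<omega> \<bullet> (z k \<omega> - zs))"
proof -
  note [measurable] = z_W_measurable[OF k]
  have k': "k \<le> Suc N" using k by simp
  show ?thesis
  proof (rule Bochner_Integration.integrable_bound[where f="\<lambda>\<omega>. (norm (est k \<omega>))\<^sup>2 + sqdist k \<omega>"])
    show "integrable P (\<lambda>\<omega>. (norm (est k \<omega>))\<^sup>2 + sqdist k \<omega>)"
      by (intro Bochner_Integration.integrable_add est_square_integrable[OF k] sqdist_integrable[OF k'])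
    show "AE \<omega> in P. norm (est k \<omega> \<bullet> (z k \<omega> - zs)) \<le> norm ((norm (est k \<omega>))\<^sup>2 + sqdist k \<omega>)"
    proof (rule AE_I2)
      fix \<omega>
      have "\<bar>est k \<omega> \<bullet> (z k \<omega> - zs)\<bar> \<le> norm (est k \<omega>) * norm (z k \<omega> - zs)" by (rule Cauchy_Schwarz_ineq2)
      also have "\<dots> \<le> (norm (est k \<omega>))\<^sup>2 + sqdist k \<omega>"
        using sum_squares_bound[of "norm (est k \<omega>)" "norm (z k \<omega> - zs)"]
          mult_nonneg_nonneg[OF norm_ge_zero[of "est k \<omega>"] norm_ge_zero[of "z k \<omega> - zs"]] by linarith
      finally show "norm (est k \<omega> \<bullet> (z k \<omega> - zs)) \<le> norm ((norm (est k \<omega>))\<^sup>2 + sqdist k \<omega>)" by simp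
    qed
  qed measurable
qed

text \<open>\<open>estimator_inner\<close> is applied to each frozen value of \<open>z k\<close>;
  the diameter then replaces the random distance in the bias.\<close>

lemma est_inner_expectation:
  assumes k: "k \<le> N"
  shows "expectation (\<lambda>\<omega>. gap (z k \<omega>)) + \<mu> / 2 * expectation (sqdist k) - bias
    \<le> expectation (\<lambda>\<omega>. est k \<omega> \<bullet> (z k \<omega> - zs))"
proof -
  interpret S: oracle_sample X Y UX UY \<phi> \<phi>' \<tau> \<mu> M L xs ys P \<delta> \<Delta> \<sigma> "e k" "p k" "m k"
    by (rule samples[OF k])
  have k': "k \<le> Suc N" using k by simp
  note [measurable] = z_W_measurable[OF k]
  define f where "f q = estimator \<delta> (fst q) (snd q) \<bullet> (fst q - zs)" for q
  have fst_m: "(\<lambda>q::('a \<times> 'b) \<times> ('a \<times> 'b) \<times> real \<times> real. fst q - zs) \<in> borel_measurable borel"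
    by (intro borel_measurable_continuous_onI continuous_intros)
  have f: "f \<in> borel_measurable borel"
    unfolding f_def[abs_def] by (intro borel_measurable_inner estimator_measurable[OF \<delta>_meas] fst_m)
  have int: "integrable P (\<lambda>\<omega>. f (z k \<omega>, W k \<omega>))"
    using est_inner_integrable[OF k] by (simp add: f_def)
  note E = indep_rv_expectation[OF prob_space_axioms indep_past[OF k] f int]
  have g: "integrable P (\<lambda>\<omega>. gap (z k \<omega>))"
    by (intro gap_integrable z_measurable[OF k'] z_in_Z[OF k'])
  have "expectation (\<lambda>\<omega>. gap (z k \<omega>)) + \<mu> / 2 * expectation (sqdist k) - bias
      = expectation (\<lambda>\<omega>. gap (z k \<omega>) + \<mu> / 2 * sqdist k \<omega> - bias)"
    using g sqdist_integrable[OF k'] by (simp add: prob_space del: times_divide_eq_left)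
  also have "\<dots> \<le> expectation (\<lambda>\<omega>. expectation (\<lambda>\<omega>'. f (z k \<omega>, W k \<omega>')))"
  proof (rule integral_mono)
    show "integrable P (\<lambda>\<omega>. gap (z k \<omega>) + \<mu> / 2 * sqdist k \<omega> - bias)"
      using g sqdist_integrable[OF k'] by simp
    show "integrable P (\<lambda>\<omega>. expectation (\<lambda>\<omega>'. f (z k \<omega>, W k \<omega>')))" by (rule E(2))
    fix \<omega> assume "\<omega> \<in> space P"
    then have zZ: "z k \<omega> \<in> Z" using z_in_Z[OF k'] by simp
    have "real DIM('a \<times> 'b) * \<Delta> * norm (z k \<omega> - zs) / \<tau> \<le> real DIM('a \<times> 'b) * \<Delta> * diameter Z / \<tau>"
      using pos S.\<Delta>_nonneg dist_saddle_le_diameter[OF zZ]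
      by (intro divide_right_mono mult_left_mono) auto
    then show "gap (z k \<omega>) + \<mu> / 2 * sqdist k \<omega> - bias \<le> expectation (\<lambda>\<omega>'. f (z k \<omega>, W k \<omega>'))"
      using S.estimator_inner[OF zZ] unfolding f_def fst_conv snd_conv bias_def by linarith
  qed
  also have "\<dots> = expectation (\<lambda>\<omega>. est k \<omega> \<bullet> (z k \<omega> - zs))"
    using E(1) by (simp add: f_def)
  finally show ?thesis .
qed

lemma est_square_expectation:
  assumes k: "k \<le> N"
  shows "expectation (\<lambda>\<omega>. (norm (est k \<omega>))\<^sup>2) \<le> variance_bound"
proof -
  interpret S: oracle_sample X Y UX UY \<phi> \<phi>' \<tau> \<mu> M L xs ys P \<delta> \<Delta> \<sigma> "e k" "p k" "m k"
    by (rule samples[OF k])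
  have k': "k \<le> Suc N" using k by simp
  define f where "f q = (norm (estimator \<delta> (fst q) (snd q)))\<^sup>2" for q
  have f: "f \<in> borel_measurable borel"
    unfolding f_def[abs_def]
    by (rule borel_measurable_power[OF measurable_compose[OF estimator_measurable[OF \<delta>_meas] borel_measurable_norm]])
  have int: "integrable P (\<lambda>\<omega>. f (z k \<omega>, W k \<omega>))"
    using est_square_integrable[OF k] by (simp add: f_def)
  note E = indep_rv_expectation[OF prob_space_axioms indep_past[OF k] f int]
  have "expectation (\<lambda>\<omega>. (norm (est k \<omega>))\<^sup>2) = expectation (\<lambda>\<omega>. expectation (\<lambda>\<omega>'. f (z k \<omega>, W k \<omega>')))"
    using E(1) by (simp add: f_def)
  also have "\<dots> \<le> expectation (\<lambda>\<omega>. variance_bound)"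
    using E(2) S.estimator_norm[OF z_in_Z[OF k']]
    by (intro integral_mono) (simp_all add: f_def variance_bound_def)
  finally show ?thesis by (simp add: prob_space)
qed

section \<open>The descent inequality and its summation\<close>

lemma sqdist_step:
  assumes k: "k \<le> N" and \<omega>: "\<omega> \<in> space P"
  shows "sqdist (Suc k) \<omega> \<le> sqdist k \<omega> - 2 * (1 / (\<mu> * (real k + 1))) * (est k \<omega> \<bullet> (z k \<omega> - zs))
    + (1 / (\<mu> * (real k + 1)))\<^sup>2 * (norm (est k \<omega>))\<^sup>2"
proof -
  let ?g = "1 / (\<mu> * (real k + 1))"
  \<comment> \<open>The saddle point is its own projection, and the projection onto a closed convex
    set is nonexpansive.\<close>
  have "norm (z (Suc k) \<omega> - zs) = dist (closest_point Z (z k \<omega> - ?g *\<^sub>R est k \<omega>)) (closest_point Z zs)"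
    using z_step[OF k \<omega>] closest_point_self[OF zs_in_Z] by (simp add: dist_norm)
  also have "\<dots> \<le> dist (z k \<omega> - ?g *\<^sub>R est k \<omega>) zs"
    by (rule closest_point_lipschitz[OF convex_Z closed_Z Z_nonempty])
  finally have "sqdist (Suc k) \<omega> \<le> (norm ((z k \<omega> - zs) - ?g *\<^sub>R est k \<omega>))\<^sup>2"
    by (intro power_mono) (simp_all add: dist_norm algebra_simps)
  also have "\<dots> = sqdist k \<omega> - 2 * ?g * (est k \<omega> \<bullet> (z k \<omega> - zs)) + ?g\<^sup>2 * (norm (est k \<omega>))\<^sup>2"
  proof -
    have "(norm (a - g *\<^sub>R b))\<^sup>2 = (norm a)\<^sup>2 - 2 * g * (b \<bullet> a) + g\<^sup>2 * (norm b)\<^sup>2" for a b :: "'a \<times> 'b" and g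
      unfolding power2_norm_eq_inner
      by (simp only: inner_diff inner_scaleR_left inner_scaleR_right inner_commute[of a b])
        (simp only: power2_eq_square algebra_simps)
    then show ?thesis .
  qed
  finally show ?thesis .
qed

text \<open>The descent inequality divided by twice the step size. Strong convexity-concavity lowers
  the coefficient of the old squared distance from \<open>\<mu> * (k + 1) / 2\<close> to
  \<open>\<mu> * k / 2\<close>, the coefficient left by the previous step, so the distances
  telescope.\<close>

lemma expected_gap_step:
  assumes k: "k \<le> N"
  shows "expectation (\<lambda>\<omega>. gap (z k \<omega>)) \<le> bias + \<mu> * real k / 2 * expectation (sqdist k)
    - \<mu> * (real k + 1) / 2 * expectation (sqdist (Suc k)) + variance_bound / (2 * \<mu>) * (1 / (real k + 1))"
proof -
  let ?g = "1 / (\<mu> * (real k + 1))"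
  let ?G = "expectation (\<lambda>\<omega>. gap (z k \<omega>))" and ?R = "expectation (sqdist k)"
    and ?R' = "expectation (sqdist (Suc k))"
  have k': "k \<le> Suc N" "Suc k \<le> Suc N" using k by auto
  have g: "?g > 0" using pos by simp
  note i = sqdist_integrable[OF k'(1)] est_inner_integrable[OF k] est_square_integrable[OF k]
  have "?R' \<le> expectation (\<lambda>\<omega>. sqdist k \<omega> - 2 * ?g * (est k \<omega> \<bullet> (z k \<omega> - zs)) + ?g\<^sup>2 * (norm (est k \<omega>))\<^sup>2)"
    using i by (intro integral_mono sqdist_step[OF k] sqdist_integrable k') auto
  also have "\<dots> = ?R - 2 * ?g * expectation (\<lambda>\<omega>. est k \<omega> \<bullet> (z k \<omega> - zs)) + ?g\<^sup>2 * expectation (\<lambda>\<omega>. (norm (est k \<omega>))\<^sup>2)"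
    using i by (simp del: times_divide_eq_left times_divide_eq_right)
  also have "\<dots> \<le> ?R - 2 * ?g * (?G + \<mu> / 2 * ?R - bias) + ?g\<^sup>2 * variance_bound"
    using g by (intro add_mono diff_mono mult_left_mono est_inner_expectation[OF k] est_square_expectation[OF k]) auto
  finally have main: "?R' \<le> ?R - 2 * ?g * (?G + \<mu> / 2 * ?R - bias) + ?g\<^sup>2 * variance_bound" .
  have eq: "(R - 2 * (1 / (\<mu> * K)) * x + (1 / (\<mu> * K))\<^sup>2 * V) * (\<mu> * K / 2)
      = R * (\<mu> * K / 2) - x + V / (2 * \<mu>) * (1 / K)" if "K > 0" for R x V K :: real
    using that pos by (simp add: field_simps power2_eq_square)
  have "?R' * (\<mu> * (real k + 1) / 2)
      \<le> (?R - 2 * ?g * (?G + \<mu> / 2 * ?R - bias) + ?g\<^sup>2 * variance_bound) * (\<mu> * (real k + 1) / 2)"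
    using pos by (intro mult_right_mono main) auto
  also have "\<dots> = ?R * (\<mu> * (real k + 1) / 2) - (?G + \<mu> / 2 * ?R - bias) + variance_bound / (2 * \<mu>) * (1 / (real k + 1))"
    by (rule eq) simp
  finally show ?thesis by (simp add: algebra_simps add_divide_distrib)
qed

text \<open>Starting at \<open>k = 1\<close> omits the leading 1 of the harmonic sum, so the
  remaining \<open>1 / 2 + ... + 1 / (j + 1)\<close> is at most \<open>ln (j + 1)\<close>. The
  negative last distance is kept for the induction.\<close>

lemma sum_expected_gap:
  assumes "j \<le> N"
  shows "(\<Sum>k=1..j. expectation (\<lambda>\<omega>. gap (z k \<omega>))) \<le> real j * bias + \<mu> / 2 * expectation (sqdist 1)
    - \<mu> * (real j + 1) / 2 * expectation (sqdist (Suc j)) + variance_bound / (2 * \<mu>) * ln (real j + 1)"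
  using assms
proof (induction j)
  case (Suc j)
  define c where "c = variance_bound / (2 * \<mu>)"
  have V: "variance_bound / (2 * \<mu>) \<ge> 0"
    unfolding variance_bound_def using pos by (intro divide_nonneg_pos add_nonneg_nonneg) auto
  have "1 / (real j + 2) \<le> ln (real j + 2) - ln (real j + 1)"
    using ln_diff_le[of "real j + 1" "real j + 2"] by (simp add: field_simps)
  then have l: "variance_bound / (2 * \<mu>) * (1 / (real j + 2)) \<le> variance_bound / (2 * \<mu>) * (ln (real j + 2) - ln (real j + 1))"
    by (rule mult_left_mono[OF _ V])
  have "(\<Sum>k=1..Suc j. expectation (\<lambda>\<omega>. gap (z k \<omega>)))
      = (\<Sum>k=1..j. expectation (\<lambda>\<omega>. gap (z k \<omega>))) + expectation (\<lambda>\<omega>. gap (z (Suc j) \<omega>))" by simp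
  also have "\<dots> \<le> (real j * bias + \<mu> / 2 * expectation (sqdist 1)
      - \<mu> * (real j + 1) / 2 * expectation (sqdist (Suc j)) + variance_bound / (2 * \<mu>) * ln (real j + 1))
    + (bias + \<mu> * real (Suc j) / 2 * expectation (sqdist (Suc j))
      - \<mu> * (real (Suc j) + 1) / 2 * expectation (sqdist (Suc (Suc j))) + variance_bound / (2 * \<mu>) * (1 / (real (Suc j) + 1)))"
    using Suc by (intro add_mono expected_gap_step) auto
  also have "\<dots> \<le> real (Suc j) * bias + \<mu> / 2 * expectation (sqdist 1)
    - \<mu> * (real (Suc j) + 1) / 2 * expectation (sqdist (Suc (Suc j))) + variance_bound / (2 * \<mu>) * ln (real (Suc j) + 1)"
    using l unfolding c_def[symmetric] by (simp add: algebra_simps add_divide_distrib)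
  finally show ?case .
qed simp

text \<open>The term \<open>2 * M\<^sup>2\<close> is the price of starting at 1: the gap at
  \<open>z 0\<close> and the distance term at \<open>z 1\<close> are each at most
  \<open>M\<^sup>2 / (2 * \<mu>)\<close>.\<close>

lemma expected_gap_average:
  assumes N: "N \<ge> 1" and zbar: "\<And>\<omega>. \<omega> \<in> space P \<Longrightarrow> zbar \<omega> = (1 / (real N + 1)) *\<^sub>R (\<Sum>k=0..N. z k \<omega>)"
  shows "integrable P (\<lambda>\<omega>. gap (zbar \<omega>))"
    and "expectation (\<lambda>\<omega>. gap (zbar \<omega>))
      \<le> (2 * M\<^sup>2 + variance_bound * ln (real N + 1)) / (2 * \<mu> * (real N + 1)) + bias"
proof -
  have zi: "z k \<omega> \<in> Z" if "k \<in> {0..N}" "\<omega> \<in> space P" for k \<omega> using that by (intro z_in_Z) auto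
  have gi: "integrable P (\<lambda>\<omega>. gap (z k \<omega>))" if "k \<in> {0..N}" for k
    using that by (intro gap_integrable z_measurable z_in_Z) auto
  have avg: "gap (zbar \<omega>) \<le> (\<Sum>k=0..N. gap (z k \<omega>)) / (real N + 1)" "zbar \<omega> \<in> Z" if \<omega>: "\<omega> \<in> space P" for \<omega>
    using gap_average_le[of "{0..N}" "\<lambda>k. z k \<omega>"] zi[OF _ \<omega>] zbar[OF \<omega>] by (simp_all add: add.commute)
  have zm: "z k \<in> borel_measurable P" if "k \<in> {0..N}" for k using that z_measurable[of k] by simp
  have "(\<lambda>\<omega>. (1 / (real N + 1)) *\<^sub>R (\<Sum>k=0..N. z k \<omega>)) \<in> borel_measurable P"
    by (intro borel_measurable_scaleR borel_measurable_const borel_measurable_sum zm)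
  then have zbm: "zbar \<in> borel_measurable P" using zbar by (subst measurable_cong) auto
  show gz: "integrable P (\<lambda>\<omega>. gap (zbar \<omega>))" by (rule gap_integrable[OF zbm avg(2)])
  have "expectation (\<lambda>\<omega>. gap (zbar \<omega>)) \<le> expectation (\<lambda>\<omega>. (\<Sum>k=0..N. gap (z k \<omega>)) / (real N + 1))"
    using gi gz by (intro integral_mono avg integrable_divide_zero Bochner_Integration.integrable_sum) auto
  also have "\<dots> = (\<Sum>k=0..N. expectation (\<lambda>\<omega>. gap (z k \<omega>))) / (real N + 1)"
    using gi by simp
  also have "(\<Sum>k=0..N. expectation (\<lambda>\<omega>. gap (z k \<omega>)))
      = expectation (\<lambda>\<omega>. gap (z 0 \<omega>)) + (\<Sum>k=1..N. expectation (\<lambda>\<omega>. gap (z k \<omega>)))"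
    by (simp add: sum.atLeast_Suc_atMost)
  also have "\<dots> \<le> M\<^sup>2 / (2 * \<mu>) + (real N * bias + M\<^sup>2 / (2 * \<mu>) + variance_bound / (2 * \<mu>) * ln (real N + 1))"
  proof (rule add_mono)
    have "expectation (\<lambda>\<omega>. gap (z 0 \<omega>)) \<le> expectation (\<lambda>\<omega>. M\<^sup>2 / (2 * \<mu>))"
      using gi[of 0] zi[of 0] by (intro integral_mono gap_le) auto
    then show "expectation (\<lambda>\<omega>. gap (z 0 \<omega>)) \<le> M\<^sup>2 / (2 * \<mu>)" by (simp add: prob_space)
    have "expectation (sqdist 1) \<le> expectation (\<lambda>\<omega>. (M / \<mu>)\<^sup>2)"
      using sqdist_integrable[of 1] z_in_Z[of 1] by (intro integral_mono power_mono dist_saddle_le) auto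
    then have "\<mu> / 2 * expectation (sqdist 1) \<le> \<mu> / 2 * (M / \<mu>)\<^sup>2"
      using pos by (intro mult_left_mono) (auto simp: prob_space)
    also have "\<dots> = M\<^sup>2 / (2 * \<mu>)" using pos by (simp add: power2_eq_square)
    finally have "\<mu> / 2 * expectation (sqdist 1) \<le> M\<^sup>2 / (2 * \<mu>)" .
    moreover have "\<mu> * (real N + 1) / 2 * expectation (sqdist (Suc N)) \<ge> 0"
      using pos by (intro mult_nonneg_nonneg integral_nonneg_AE) auto
    ultimately show "(\<Sum>k=1..N. expectation (\<lambda>\<omega>. gap (z k \<omega>)))
        \<le> real N * bias + M\<^sup>2 / (2 * \<mu>) + variance_bound / (2 * \<mu>) * ln (real N + 1)"
      using sum_expected_gap[of N] by linarith
  qed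
  finally have 1: "expectation (\<lambda>\<omega>. gap (zbar \<omega>))
      \<le> (M\<^sup>2 / (2 * \<mu>) + (real N * bias + M\<^sup>2 / (2 * \<mu>) + variance_bound / (2 * \<mu>) * ln (real N + 1))) / (real N + 1)"
    by (simp add: divide_right_mono)
  have "real DIM('a \<times> 'b) * \<Delta> * diameter Z / \<tau> \<ge> 0"
  proof -
    interpret S: oracle_sample X Y UX UY \<phi> \<phi>' \<tau> \<mu> M L xs ys P \<delta> \<Delta> \<sigma> "e 0" "p 0" "m 0"
      by (rule samples) simp
    show ?thesis using pos S.\<Delta>_nonneg diameter_ge_0[OF bounded_Z] by (intro divide_nonneg_pos mult_nonneg_nonneg) auto
  qed
  then have "bias \<ge> 0" using pos by (simp add: bias_def)
  \<comment> \<open>Only \<open>N\<close> of the \<open>N + 1\<close> averaged gaps carry a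
    bias.\<close>
  then have b: "bias * (real N / (real N + 1)) \<le> bias * 1"
    by (intro mult_left_mono) (auto simp: field_simps)
  have "(M\<^sup>2 / (2 * \<mu>) + (R * b + M\<^sup>2 / (2 * \<mu>) + V / (2 * \<mu>) * l)) / K
      = (2 * M\<^sup>2 + V * l) / (2 * \<mu> * K) + b * (R / K)" if "K > 0" for R b V l K :: real
    using that pos by (simp add: field_simps)
  from this[of "real N + 1" "real N" bias variance_bound "ln (real N + 1)"] b
  have "(M\<^sup>2 / (2 * \<mu>) + (real N * bias + M\<^sup>2 / (2 * \<mu>) + variance_bound / (2 * \<mu>) * ln (real N + 1))) / (real N + 1)
      \<le> (2 * M\<^sup>2 + variance_bound * ln (real N + 1)) / (2 * \<mu> * (real N + 1)) + bias"
    by simp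
  with 1 show "expectation (\<lambda>\<omega>. gap (zbar \<omega>))
      \<le> (2 * M\<^sup>2 + variance_bound * ln (real N + 1)) / (2 * \<mu> * (real N + 1)) + bias" by linarith
qed

end

theorem theorem5:
  fixes X :: "(real^'nx) set" and Y :: "(real^'ny) set"
    and UX :: "(real^'nx) set" and UY :: "(real^'ny) set"
    and \<phi> \<delta> :: "(real^'nx) \<times> (real^'ny) \<Rightarrow> real"
    and P :: "'w measure"
    and e z :: "nat \<Rightarrow> 'w \<Rightarrow> (real^'nx) \<times> (real^'ny)"
    and \<xi>p \<xi>m :: "nat \<Rightarrow> 'w \<Rightarrow> real"
    and zbar :: "'w \<Rightarrow> (real^'nx) \<times> (real^'ny)"
    and z0 :: "(real^'nx) \<times> (real^'ny)"
    and xs :: "real^'nx" and ys :: "real^'ny"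
    and N n :: nat
    and \<tau> \<mu> M L \<sigma> \<Delta> \<Omega> :: real
  assumes N: "N \<ge> 1" and n: "n = CARD('nx) + CARD('ny)"
    and pos: "\<tau> > 0" "\<mu> > 0" "M > 0" "L > 0" "\<sigma> > 0" "\<Delta> > 0"
    and X: "X \<noteq> {}" "compact X" "convex X"
    and Y: "Y \<noteq> {}" "compact Y" "convex Y"
    and \<Omega>: "\<Omega> = diameter (X \<times> Y)"
    and UX: "open UX" "convex UX" and UY: "open UY" "convex UY"
    and nbhd: "\<And>w v. w \<in> X \<times> Y \<Longrightarrow> norm v \<le> 1 \<Longrightarrow> w + \<tau> *\<^sub>R v \<in> UX \<times> UY"
    and scsc: "strongly_convex_concave_on \<mu> UX UY \<phi>"
    and lip: "M-lipschitz_on (UX \<times> UY) \<phi>"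
    and grad_lip: "lipschitz_gradient_on L (UX \<times> UY) \<phi>"
    and \<delta>_meas: "\<delta> \<in> borel_measurable (restrict_space borel (UX \<times> UY))"
    and \<delta>_bound: "\<And>w. w \<in> UX \<times> UY \<Longrightarrow> \<bar>\<delta> w\<bar> \<le> \<Delta>"
    and P: "prob_space P"
    and e_sphere: "\<And>k \<omega>. k \<le> N \<Longrightarrow> \<omega> \<in> space P \<Longrightarrow> norm (e k \<omega>) = 1"
    and e_unif: "\<And>k. k \<le> N \<Longrightarrow> distr P borel (e k) = uniform_sphere"
    and noise: "\<And>k. k \<le> N \<Longrightarrow> oracle_noise P \<sigma> (\<xi>p k)"
               "\<And>k. k \<le> N \<Longrightarrow> oracle_noise P \<sigma> (\<xi>m k)"
    and indep_iterations:
      "prob_space.indep_vars P (\<lambda>_. borel) (\<lambda>k \<omega>. (e k \<omega>, \<xi>p k \<omega>, \<xi>m k \<omega>)) {..N}"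
    and indep_direction:
      "\<And>k. k \<le> N \<Longrightarrow> indep_rv P (e k) (\<lambda>\<omega>. (\<xi>p k \<omega>, \<xi>m k \<omega>))"
    and indep_noise: "\<And>k. k \<le> N \<Longrightarrow> prob_space.indep_var P borel (\<xi>p k) borel (\<xi>m k)"
    and z0: "z0 \<in> X \<times> Y"
    and z_init: "\<And>\<omega>. \<omega> \<in> space P \<Longrightarrow> z 0 \<omega> = z0"
    and z_step: "\<And>k \<omega>. k \<le> N \<Longrightarrow> \<omega> \<in> space P \<Longrightarrow>
      z (Suc k) \<omega> = closest_point (X \<times> Y)
        (z k \<omega> - (1 / (\<mu> * (real k + 1))) *\<^sub>R
           gradient_estimator \<phi> \<delta> (z k \<omega>) (e k \<omega>) \<tau> (\<xi>p k \<omega>) (\<xi>m k \<omega>))"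
    and zbar: "\<And>\<omega>. \<omega> \<in> space P \<Longrightarrow> zbar \<omega> = (1 / (real N + 1)) *\<^sub>R (\<Sum>k=0..N. z k \<omega>)"
    and saddle: "saddle_point X Y \<phi> xs ys"
  shows "integrable P (\<lambda>\<omega>. \<phi> (fst (zbar \<omega>), ys) - \<phi> (xs, snd (zbar \<omega>))) \<and>
    (\<integral>\<omega>. (\<phi> (fst (zbar \<omega>), ys) - \<phi> (xs, snd (zbar \<omega>))) \<partial>P)
      \<le> 3 * (3 * real n * M\<^sup>2 + (real n)\<^sup>2 * (\<sigma>\<^sup>2 + \<Delta>\<^sup>2) / \<tau>\<^sup>2) * ln (real N + 1)
            / (2 * \<mu> * (real N + 1))
          + \<Delta> * real n * \<Omega> / \<tau> + L * \<tau>\<^sup>2"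
proof -
  interpret prob_space P by (rule P)
  obtain \<phi>' where \<phi>': "\<And>w. w \<in> UX \<times> UY \<Longrightarrow> GDERIV \<phi> w :> \<phi>' w" "L-lipschitz_on (UX \<times> UY) \<phi>'"
    using grad_lip by (auto simp: lipschitz_gradient_on_def)
  interpret saddle_problem X Y UX UY \<phi> \<phi>' \<tau> \<mu> M L xs ys
    by unfold_locales (fact pos X Y UX UY nbhd scsc lip \<phi>' saddle)+
  have dim: "real DIM((real^'nx) \<times> (real^'ny)) = real n" by (simp add: n)
  \<comment> \<open>Feasibility of the iterates comes first: only then do the query points lie in
    \<open>U\<close>, where \<open>gradient_estimator\<close> coincides with
    \<open>estimator\<close>.\<close>
  have z_in: "z k \<omega> \<in> X \<times> Y" if "k \<le> N" "\<omega> \<in> space P" for k \<omega>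
  proof (cases k)
    case (Suc j)
    then show ?thesis
      using z_step[of j \<omega>] that closest_point_in_set[OF closed_Z Z_nonempty] by simp
  qed (use that z0 z_init in auto)
  interpret noisy_descent_ascent X Y UX UY \<phi> \<phi>' \<tau> \<mu> M L xs ys P \<delta> \<Delta> \<sigma> e \<xi>p \<xi>m z z0 N
  proof (intro noisy_descent_ascent.intro noisy_descent_ascent_axioms.intro saddle_problem_axioms
      prob_space_axioms)
    fix k assume k: "k \<le> N"
    show "oracle_sample X Y UX UY \<phi> \<phi>' \<tau> \<mu> M L xs ys P \<delta> \<Delta> \<sigma> (e k) (\<xi>p k) (\<xi>m k)"
      by unfold_locales
        (use \<delta>_meas \<delta>_bound e_sphere e_unif noise indep_direction indep_noise k in auto)
    fix \<omega> assume \<omega>: "\<omega> \<in> space P"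
    have "z k \<omega> + \<tau> *\<^sub>R e k \<omega> \<in> UX \<times> UY" "z k \<omega> - \<tau> *\<^sub>R e k \<omega> \<in> UX \<times> UY"
      using e_sphere[OF k \<omega>] z_in[OF k \<omega>] by (simp_all only: nbhd nbhd_minus order_refl)
    moreover have "k * ((a + x + b) - (a' + y + b')) / t = k / t * ((a - a') + (b - b') + (x - y))"
      for k a b a' b' x y t :: real
      by (subst times_divide_eq_left, intro arg_cong[where f="\<lambda>s. k * s / t"]) simp
    ultimately have "gradient_estimator \<phi> \<delta> (z k \<omega>) (e k \<omega>) \<tau> (\<xi>p k \<omega>) (\<xi>m k \<omega>)
        = estimator \<delta> (z k \<omega>) (e k \<omega>, \<xi>p k \<omega>, \<xi>m k \<omega>)"
      by (simp only: gradient_estimator_def estimator_def noisy_value_def increment_def flip_snd_def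
          zero_ext_in_U dim n prod.case)
    then show "z (Suc k) \<omega> = closest_point (X \<times> Y)
        (z k \<omega> - (1 / (\<mu> * (real k + 1))) *\<^sub>R estimator \<delta> (z k \<omega>) (e k \<omega>, \<xi>p k \<omega>, \<xi>m k \<omega>))"
      using z_step[OF k \<omega>] by simp
  qed (fact indep_iterations z0 z_init)+
  define D where "D = (real n)\<^sup>2 * (\<sigma>\<^sup>2 + \<Delta>\<^sup>2) / \<tau>\<^sup>2"
  have ln: "2 / 3 \<le> ln (real N + 1)"
    using ln2_ge_two_thirds N by (intro order_trans[OF ln2_ge_two_thirds] ln_mono) auto
  have "n \<ge> 2"
    using zero_less_card_finite[where 'a='nx] zero_less_card_finite[where 'a='ny] unfolding n by linarith
  \<comment> \<open>The slack \<open>9 - 15 / 2 = 3 / 2\<close> times \<open>2 * (2 / 3)\<close> is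
    exactly the 2 in the term \<open>2 * M\<^sup>2\<close>.\<close>
  then have "2 * (2 / 3) \<le> real n * ln (real N + 1)"
    using ln by (intro mult_mono) auto
  then have "M\<^sup>2 * (3 / 2 * (2 * (2 / 3))) \<le> M\<^sup>2 * (3 / 2 * (real n * ln (real N + 1)))"
    by (intro mult_left_mono) auto
  then have "2 * M\<^sup>2 + (15 / 2 * real n * M\<^sup>2 + 3 * D) * ln (real N + 1)
      \<le> 3 * (3 * real n * M\<^sup>2 + D) * ln (real N + 1)"
    by (simp add: algebra_simps)
  then have "(2 * M\<^sup>2 + (15 / 2 * real n * M\<^sup>2 + 3 * D) * ln (real N + 1)) / (2 * \<mu> * (real N + 1))
      \<le> 3 * (3 * real n * M\<^sup>2 + D) * ln (real N + 1) / (2 * \<mu> * (real N + 1))"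
    using pos by (intro divide_right_mono) auto
  moreover have "variance_bound = 15 / 2 * real n * M\<^sup>2 + 3 * D"
    by (simp add: variance_bound_def D_def n)
  moreover have "bias = \<Delta> * real n * \<Omega> / \<tau> + L * \<tau>\<^sup>2"
    by (simp only: bias_def dim \<Omega> mult_ac add_ac)
  ultimately show ?thesis
    using expected_gap_average[OF N zbar] unfolding gap_def D_def by auto
qed

end
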